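(* Let $q\in\mathbf C^*$ and let $\kappa_1,\kappa_2,\theta_1,\theta_2,c_1,c_2,c_3,c_4$ be generic nonzero complex parameters with $\kappa_1\kappa_2c_1c_2c_3c_4=\theta_1\theta_2$. The transformation $\phi$ from $Y_{\kappa_1,\kappa_2,\theta_1,\theta_2}$ to $Y_{q\kappa_1,\kappa_2,q\theta_1,\theta_2}$ induces, on the Picard group of the surfaces, a translation (an element acting as a translation on the affine root system of type $D_5^{(1)}$ with simple roots $\alpha_0,\dots,\alpha_5$) whose reduced decomposition is $$\phi=\sigma\, w_4w_3w_2w_0w_1w_2w_3w_4 .$$
   Context: Matrix spaces. Let $H$ be a two-dimensional complex vector space. $\bar X_{\kappa_1,\kappa_2,\theta_1,\theta_2}$ (the $c_i$ being fixed) is the space of $A(z)=A_0+A_1z+A_2z^2$ with $A_i\in\mathrm{End}(H)$, such that $A_2$ has spectrum $\{\kappa_1,\kappa_2\}$, $A_0$ has spectrum $\{\theta_1,\theta_2\}$, and $\det A(z)=\kappa_1\kappa_2\prod_{i=1}^4(z-c_i)$. $X_{\kappa_1,\kappa_2,\theta_1,\theta_2}$ is its quotient by conjugation by $GL(H)$. Parameters are generic; in particular $\kappa_1\ne\kappa_2$, $\theta_1\ne\theta_2$, $q\kappa_1\neq\kappa_2$, $q\theta_1\neq\theta_2$. $E_2$ is the $\kappa_2$-eigenspace of $A_2$ and $F_1$ the $\theta_1$-eigenspace of $A_0$. The map $\phi$. For $A$ with $E_2\ne F_1$, in a basis $(u,v)$ with $u\in F_1$, $v\in E_2$, the matrix $\hat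 A(z)=\begin{pmatrix}qz&0\\0&1\end{pmatrix}A(z)\begin{pmatrix}z^{-1}&0\\0&1\end{pmatrix}$ is polynomial and belongs to $\bar X_{q\kappa_1,\kappa_2,q\theta_1,\theta_2}$. The birational map $\phi:X_{\kappa_1,\kappa_2,\theta_1,\theta_2}\to X_{q\kappa_1,\kappa_2,q\theta_1,\theta_2}$ sends the class of $A$ to that of $\hat A$. Coordinates. In a suitably scaled such basis a generic $A$ is $\begin{pmatrix}\kappa_1z^2+az+\theta_1& z-y\\ z(\gamma z+\beta)&\kappa_2z^2+bz+\theta_2\end{pmatrix}$, and the coordinates of its class are $(y,\xi)$ with $\xi=\frac{(y-c_1)(y-c_2)}{\kappa_1y^2+ay+\theta_1}$; similarly on the target, with $\kappa_1,\theta_1$ replaced by $q\kappa_1,q\theta_1$. Surfaces. $Y_{\kappa_1,\kappa_2,\theta_1,\theta_2}$ is $\mathbf P^1\times\mathbf P^1$ with coordinates $(y,\xi)$ blown up at the eight points $$(c_1,0),(c_2,0),(c_3,\infty),(c_4,\infty),(0,c_1c_2/\theta_1),(0,c_1c_2/\theta_2),(\infty,1/\kappa_1),(\infty,q/\kappa_2),$$ minus the strict transforms of the lines $y=0$, $y=\infty$, $\xi=0$, $\xi=\infty$. "Picard group of the surface" means the Picard group of the whole blown-up surface (before removing these strict transforms). It has rank $10$ and is equipped with the intersection form. The map $\phi$ acts on Picard groups by taking images of divisors. Let $\mathcal F_1,\dots,\mathcal F_8$ be the exceptional divisors over the eight points in the order listed. Let $\mathcal H_y$ and $\mathcal H_\xi$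 be the classes of (total transforms of) generic lines $y=\mathrm{const}$ and $\xi=\mathrm{const}$. Basis of the Picard group. Viewing the surface as $\mathbf P^2$ blown up at nine points, one uses the basis $\mathcal E_0,\dots,\mathcal E_9$, where $\mathcal E_0$ is the class of the inverse image of a generic line of $\mathbf P^2$, $\mathcal E_1,\dots,\mathcal E_9$ are the inverse images of the nine points, $\mathcal E_0^2=1$, $\mathcal E_i^2=-1$ for $i\geq1$, $\mathcal E_i\cdot\mathcal E_j=0$ for $i\ne j$. Explicitly $$\mathcal E_2=\mathcal F_1,\ \mathcal E_3=\mathcal F_2,\ \mathcal E_4=\mathcal F_5,\ \mathcal E_5=\mathcal F_6,\ \mathcal E_6=\mathcal F_7,\ \mathcal E_7=\mathcal F_8,\ \mathcal E_9=\mathcal F_4,$$ $$\mathcal E_0=\mathcal H_y+\mathcal H_\xi-\mathcal F_3,\quad \mathcal E_1=\mathcal H_y-\mathcal F_3,\quad \mathcal E_8=\mathcal H_\xi-\mathcal F_3 .$$ The same construction on the target surface $Y_{q\kappa_1,\kappa_2,q\theta_1,\theta_2}$ (points with $\kappa_1,\theta_1$ replaced by $q\kappa_1,q\theta_1$) gives a basis $\tilde{\mathcal E}_0,\dots,\tilde{\mathcal E}_9$, and the two Picard groups are identified via $\mathcal E_i\leftrightarrow\tilde{\mathcal E}_i$. Root system. The strict transforms of the four lines have classes $\mathcal D_0=\mathcal E_8-\mathcal E_9$, $\mathcal D_1=\mathcal E_0-\mathcal E_6-\mathcal E_7-\mathcal E_8$, $\mathcal D_2=\mathcal E_0-\mathcal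 E_1-\mathcal E_2-\mathcal E_3$, $\mathcal D_3=\mathcal E_0-\mathcal E_4-\mathcal E_5-\mathcal E_8$ (type $A_3^{(1)}$). The orthogonal of these is a root lattice of type $D_5^{(1)}$ with simple roots $$\alpha_0=\mathcal E_0-\mathcal E_1-\mathcal E_8-\mathcal E_9,\ \alpha_1=\mathcal E_2-\mathcal E_3,\ \alpha_2=\mathcal E_1-\mathcal E_2,\ \alpha_3=\mathcal E_0-\mathcal E_1-\mathcal E_4-\mathcal E_6,\ \alpha_4=\mathcal E_6-\mathcal E_7,\ \alpha_5=\mathcal E_4-\mathcal E_5 .$$ In its Dynkin diagram $\alpha_0,\alpha_1,\alpha_3$ are joined to $\alpha_2$, and $\alpha_4,\alpha_5$ are joined to $\alpha_3$. The null root is $\delta=\alpha_0+\alpha_1+2\alpha_2+2\alpha_3+\alpha_4+\alpha_5=3\mathcal E_0-\mathcal E_1-\cdots-\mathcal E_9$. The action of $\phi$ is considered on this lattice. $w_i$ is the simple reflection associated with $\alpha_i$, i.e. $w_i(x)=x+(x\cdot\alpha_i)\alpha_i$. $\sigma$ is the automorphism of the Dynkin diagram exchanging $\alpha_0\leftrightarrow\alpha_1$ and $\alpha_4\leftrightarrow\alpha_5$ and fixing $\alpha_2,\alpha_3$. Products are compositions of maps, the rightmost acting first. A translation is an element of the extended affine Weyl group acting by $\alpha_i\mapsto\alpha_i+n_i\delta$ with $n_i\in\mathbf Z$. Reduced means that $w_4w_3w_2w_0w_1w_2w_3w_4$ is a reduced word in the Coxeter group generated by $w_0,\dots,w_5$.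 *)

theory Defs
  imports
    "HOL-Analysis.Analysis"
    "HOL-Computational_Algebra.Polynomial_Factorial"
    "HOL-Computational_Algebra.Field_as_Ring"
    "HOL-Library.Poly_Mapping"
    "HOL-Algebra.Coset"
begin

section \<open>Parameters and genericity\<close>

record params =
  kappa1 :: complex
  kappa2 :: complex
  theta1 :: complex
  theta2 :: complex
  c1 :: complex
  c2 :: complex
  c3 :: complex
  c4 :: complex

definition param_space :: "params set" where
  "param_space = {p. kappa1 p \<noteq> 0 \<and> kappa2 p \<noteq> 0 \<and> theta1 p \<noteq> 0 \<and> theta2 p \<noteq> 0 \<and>
     c1 p \<noteq> 0 \<and> c2 p \<noteq> 0 \<and> c3 p \<noteq> 0 \<and> c4 p \<noteq> 0 \<and>
     kappa1 p * kappa2 p * c1 p * c2 p * c3 p * c4 p = theta1 p * theta2 p}"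

inductive_set param_polynomials :: "(params \<Rightarrow> complex) set" where
  const: "(\<lambda>_. a) \<in> param_polynomials"
| coordinate: "x \<in> {kappa1, kappa2, theta1, theta2, c1, c2, c3, c4} \<Longrightarrow> x \<in> param_polynomials"
| add: "f \<in> param_polynomials \<Longrightarrow> g \<in> param_polynomials \<Longrightarrow> (\<lambda>p. f p + g p) \<in> param_polynomials"
| mult: "f \<in> param_polynomials \<Longrightarrow> g \<in> param_polynomials \<Longrightarrow> (\<lambda>p. f p * g p) \<in> param_polynomials"

text \<open>A property is generic if it holds on a nonempty Zariski open subset of the parameter space,
  which is an irreducible variety. Inequalities such as \<open>kappa1 \<noteq> kappa2\<close> or the distinctness of
  the eight blown-up points are therefore generic.\<close>

definition generically :: "(params \<Rightarrow> bool) \<Rightarrow> bool" where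
  "generically Q \<longleftrightarrow> (\<exists>g\<in>param_polynomials.
     (\<exists>p\<in>param_space. g p \<noteq> 0) \<and> (\<forall>p\<in>param_space. g p \<noteq> 0 \<longrightarrow> Q p))"

definition shift_params :: "complex \<Rightarrow> params \<Rightarrow> params" where
  "shift_params q p = p\<lparr>kappa1 := q * kappa1 p, theta1 := q * theta1 p\<rparr>"


section \<open>Matrix polynomials and the map phi\<close>

text \<open>The space \<open>H\<close> is \<open>complex ^ 2\<close>; the triple \<open>(A0, A1, A2)\<close> stands for
  \<open>A(z) = A0 + z A1 + z\<^sup>2 A2\<close>.\<close>

type_synonym mat2 = "complex ^ 2 ^ 2"
type_synonym matpoly = "mat2 \<times> mat2 \<times> mat2"

definition matpoly_at :: "matpoly \<Rightarrow> complex \<Rightarrow> mat2" where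
  "matpoly_at A z = (case A of (A0, A1, A2) \<Rightarrow>
     \<chi> i j. A0 $ i $ j + z * A1 $ i $ j + z^2 * A2 $ i $ j)"

definition eigenvector_of :: "mat2 \<Rightarrow> complex \<Rightarrow> complex ^ 2 \<Rightarrow> bool" where
  "eigenvector_of M l v \<longleftrightarrow> v \<noteq> 0 \<and> M *v v = l *s v"

definition mat_spectrum :: "mat2 \<Rightarrow> complex set" where
  "mat_spectrum M = {l. \<exists>v. eigenvector_of M l v}"

definition Xbar :: "params \<Rightarrow> matpoly set" where
  "Xbar p = {(A0, A1, A2).
     mat_spectrum A2 = {kappa1 p, kappa2 p} \<and> mat_spectrum A0 = {theta1 p, theta2 p} \<and>
     (\<forall>z. det (matpoly_at (A0, A1, A2) z) =
        kappa1 p * kappa2 p * ((z - c1 p) * (z - c2 p) * (z - c3 p) * (z - c4 p)))}"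

definition conj_rel :: "(matpoly \<times> matpoly) set" where
  "conj_rel = {((A0, A1, A2), (B0, B1, B2)). \<exists>g :: mat2. invertible g \<and>
     B0 = g ** A0 ** matrix_inv g \<and> B1 = g ** A1 ** matrix_inv g \<and> B2 = g ** A2 ** matrix_inv g}"

definition X_space :: "params \<Rightarrow> matpoly set set" where
  "X_space p = Xbar p // conj_rel"

definition mat22 :: "complex \<Rightarrow> complex \<Rightarrow> complex \<Rightarrow> complex \<Rightarrow> mat2" where
  "mat22 a b c d = vector [vector [a, b], vector [c, d]]"

definition columns2 :: "complex ^ 2 \<Rightarrow> complex ^ 2 \<Rightarrow> mat2" where
  "columns2 u v = (\<chi> i j. if j = 1 then u $ i else v $ i)"

text \<open>\<open>phi_rel q p a b\<close>: the map \<open>\<phi>\<close> is defined at the class \<open>a\<close> (that is, the eigenlines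
  \<open>F\<^sub>1\<close> of \<open>A0\<close> and \<open>E\<^sub>2\<close> of \<open>A2\<close> are different) and sends it to the class \<open>b\<close>.\<close>

definition phi_rel :: "complex \<Rightarrow> params \<Rightarrow> matpoly set \<Rightarrow> matpoly set \<Rightarrow> bool" where
  "phi_rel q p a b \<longleftrightarrow> a \<in> X_space p \<and>
     (\<exists>A0 A1 A2 B u v. (A0, A1, A2) \<in> a \<and>
        eigenvector_of A0 (theta1 p) u \<and> eigenvector_of A2 (kappa2 p) v \<and>
        invertible (columns2 u v) \<and>
        (\<forall>z. z \<noteq> 0 \<longrightarrow> matpoly_at B z =
           mat22 (q * z) 0 0 1
           ** (matrix_inv (columns2 u v) ** matpoly_at (A0, A1, A2) z ** columns2 u v)
           ** mat22 (1 / z) 0 0 1) \<and>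
        b = conj_rel `` {B})"

text \<open>The matrix polynomial with rows \<open>\<kappa>\<^sub>1z\<^sup>2 + az + \<theta>\<^sub>1\<close>, \<open>z - y\<close> and
  \<open>z(\<gamma>z + \<beta>)\<close>, \<open>\<kappa>\<^sub>2z\<^sup>2 + bz + \<theta>\<^sub>2\<close>.\<close>

definition normal_form ::
  "params \<Rightarrow> complex \<Rightarrow> complex \<Rightarrow> complex \<Rightarrow> complex \<Rightarrow> complex \<Rightarrow> matpoly" where
  "normal_form p a b \<beta> \<gamma> y =
     (mat22 (theta1 p) (- y) 0 (theta2 p), mat22 a 1 \<beta> b, mat22 (kappa1 p) 0 \<gamma> (kappa2 p))"

definition has_coords :: "params \<Rightarrow> matpoly set \<Rightarrow> complex \<Rightarrow> complex \<Rightarrow> bool" where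
  "has_coords p cl y \<xi> \<longleftrightarrow> cl \<in> X_space p \<and>
     (\<exists>a b \<beta> \<gamma>. normal_form p a b \<beta> \<gamma> y \<in> cl \<and>
        kappa1 p * y^2 + a * y + theta1 p \<noteq> 0 \<and>
        \<xi> = (y - c1 p) * (y - c2 p) / (kappa1 p * y^2 + a * y + theta1 p))"


section \<open>Rational functions in y and xi\<close>

text \<open>Elements of \<open>\<complex>[y,\<xi>]\<close> are polynomials in \<open>\<xi>\<close> whose coefficients are polynomials in \<open>y\<close>.\<close>

type_synonym poly_yxi = "complex poly poly"
type_synonym ratfun = "poly_yxi fract"

definition y_poly :: poly_yxi where "y_poly = [:[:0, 1:]:]"
definition xi_poly :: poly_yxi where "xi_poly = [:0, 1:]"
definition y_fun :: ratfun where "y_fun = to_fract y_poly"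
definition xi_fun :: ratfun where "xi_fun = to_fract xi_poly"
definition const_fun :: "complex \<Rightarrow> ratfun" where "const_fun a = to_fract [:[:a:]:]"

definition numer :: "ratfun \<Rightarrow> poly_yxi" where "numer f = fst (quot_of_fract f)"
definition denom :: "ratfun \<Rightarrow> poly_yxi" where "denom f = snd (quot_of_fract f)"

definition poly_at :: "poly_yxi \<Rightarrow> complex \<Rightarrow> complex \<Rightarrow> complex" where
  "poly_at P y \<xi> = poly (poly P [:\<xi>:]) y"

definition ratfun_at :: "ratfun \<Rightarrow> complex \<Rightarrow> complex \<Rightarrow> complex" where
  "ratfun_at f y \<xi> = poly_at (numer f) y \<xi> / poly_at (denom f) y \<xi>"

definition poly_subst :: "poly_yxi \<Rightarrow> ratfun \<Rightarrow> ratfun \<Rightarrow> ratfun" where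
  "poly_subst P Y X = poly (map_poly (\<lambda>c. poly (map_poly const_fun c) Y) P) X"

definition subst :: "ratfun \<Rightarrow> ratfun \<Rightarrow> ratfun \<Rightarrow> ratfun" where
  "subst f Y X = poly_subst (numer f) Y X / poly_subst (denom f) Y X"

text \<open>\<open>phi_in_coords q p Y X\<close>: in the coordinates of source and target, \<open>\<phi>\<close> is the rational
  map \<open>(y, \<xi>) \<mapsto> (Y(y, \<xi>), X(y, \<xi>))\<close>. As equality on the complement of a curve determines
  rational functions, \<open>Y\<close> and \<open>X\<close> are unique.\<close>

definition phi_in_coords :: "complex \<Rightarrow> params \<Rightarrow> ratfun \<Rightarrow> ratfun \<Rightarrow> bool" where
  "phi_in_coords q p Y X \<longleftrightarrow> (\<exists>g. g \<noteq> 0 \<and> (\<forall>y \<xi>. poly_at g y \<xi> \<noteq> 0 \<longrightarrow>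
     poly_at (denom Y) y \<xi> \<noteq> 0 \<and> poly_at (denom X) y \<xi> \<noteq> 0 \<and>
     (\<exists>a b. has_coords p a y \<xi> \<and> phi_rel q p a b) \<and>
     (\<forall>a b. has_coords p a y \<xi> \<and> phi_rel q p a b \<longrightarrow>
        has_coords (shift_params q p) b (ratfun_at Y y \<xi>) (ratfun_at X y \<xi>))))"


section \<open>The blown-up surface, its divisors and its Picard group\<close>

datatype P1 = Fin complex | Infty

definition center :: "complex \<Rightarrow> params \<Rightarrow> nat \<Rightarrow> P1 \<times> P1" where
  "center q p k =
     [(Fin (c1 p), Fin 0), (Fin (c2 p), Fin 0), (Fin (c3 p), Infty), (Fin (c4 p), Infty),
      (Fin 0, Fin (c1 p * c2 p / theta1 p)), (Fin 0, Fin (c1 p * c2 p / theta2 p)),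
      (Infty, Fin (1 / kappa1 p)), (Infty, Fin (q / kappa2 p))] ! (k - 1)"

text \<open>The prime divisors of \<open>\<bbbP>\<^sup>1 \<times> \<bbbP>\<^sup>1\<close> blown up at eight distinct points are the exceptional
  curves \<open>Exc k\<close> with \<open>k \<in> {1..8}\<close> and the strict transforms of the irreducible curves of
  \<open>\<bbbP>\<^sup>1 \<times> \<bbbP>\<^sup>1\<close>. The latter are the lines \<open>y = \<infinity>\<close> and \<open>\<xi> = \<infinity>\<close> and the closures of the affine
  curves \<open>P = 0\<close> with \<open>P\<close> irreducible; \<^const>\<open>prime\<close> picks one normalized \<open>P\<close> for each curve.\<close>

datatype pdiv = Curve poly_yxi | Line_y_inf | Line_xi_inf | Exc nat

definition prime_divisors :: "pdiv set" where
  "prime_divisors = Curve ` {P. prime P} \<union> {Line_y_inf, Line_xi_inf} \<union> Exc ` {1..8}"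

definition ord_curve :: "poly_yxi \<Rightarrow> ratfun \<Rightarrow> int" where
  "ord_curve P f = int (multiplicity P (numer f)) - int (multiplicity P (denom f))"

definition mult_at_origin :: "poly_yxi \<Rightarrow> nat" where
  "mult_at_origin P = (LEAST n. \<exists>i j. i + j = n \<and> coeff (coeff P i) j \<noteq> 0)"

definition ord_origin :: "ratfun \<Rightarrow> int" where
  "ord_origin f = int (mult_at_origin (numer f)) - int (mult_at_origin (denom f))"

text \<open>The coordinate of \<open>\<bbbP>\<^sup>1\<close> in terms of a local parameter \<open>t\<close> at the given point.\<close>

fun in_local_parameter :: "P1 \<Rightarrow> ratfun \<Rightarrow> ratfun" where
  "in_local_parameter (Fin a) t = const_fun a + t"
| "in_local_parameter Infty t = 1 / t"

text \<open>Order of vanishing of a nonzero rational function along a prime divisor. Along an exceptional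
  curve it is the multiplicity at the blown-up point, computed in local parameters there.\<close>

fun ord_along :: "complex \<Rightarrow> params \<Rightarrow> pdiv \<Rightarrow> ratfun \<Rightarrow> int" where
  "ord_along q p (Curve P) f = ord_curve P f"
| "ord_along q p Line_y_inf f = ord_curve y_poly (subst f (1 / y_fun) xi_fun)"
| "ord_along q p Line_xi_inf f = ord_curve xi_poly (subst f y_fun (1 / xi_fun))"
| "ord_along q p (Exc k) f = ord_origin
     (subst f (in_local_parameter (fst (center q p k)) y_fun)
              (in_local_parameter (snd (center q p k)) xi_fun))"

type_synonym divisor = "pdiv \<Rightarrow>\<^sub>0 int"

definition prime_div :: "pdiv \<Rightarrow> divisor" where
  "prime_div D = Poly_Mapping.single D 1"

definition divisor_group :: "divisor monoid" where
  "divisor_group = \<lparr>carrier = {D. Poly_Mapping.keys D \<subseteq> prime_divisors}, monoid.mult = (+), one = 0\<rparr>"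

definition principal_divisors :: "complex \<Rightarrow> params \<Rightarrow> divisor set" where
  "principal_divisors q p = {D \<in> carrier divisor_group.
     \<exists>f. f \<noteq> 0 \<and> (\<forall>C\<in>prime_divisors. Poly_Mapping.lookup D C = ord_along q p C f)}"

definition Pic :: "complex \<Rightarrow> params \<Rightarrow> divisor set monoid" where
  "Pic q p = divisor_group Mod principal_divisors q p"

definition div_class :: "complex \<Rightarrow> params \<Rightarrow> divisor \<Rightarrow> divisor set" where
  "div_class q p D = principal_divisors q p #>\<^bsub>divisor_group\<^esub> D"


section \<open>Images of divisors\<close>

text \<open>For a rational map \<open>(Y, X)\<close> between two such surfaces, \<open>image_divisor\<close> says that the image
  (closure) of the prime divisor \<open>D\<close> is the prime divisor \<open>D'\<close>, i.e. that the map sends the generic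
  point of \<open>D\<close> to the generic point of \<open>D'\<close>: functions regular along \<open>D'\<close> pull back to functions
  regular along \<open>D\<close>, and functions vanishing along \<open>D'\<close> to functions vanishing along \<open>D\<close>.\<close>

definition regular_along :: "complex \<Rightarrow> params \<Rightarrow> pdiv \<Rightarrow> ratfun \<Rightarrow> bool" where
  "regular_along q p D f \<longleftrightarrow> f = 0 \<or> ord_along q p D f \<ge> 0"

definition vanishes_along :: "complex \<Rightarrow> params \<Rightarrow> pdiv \<Rightarrow> ratfun \<Rightarrow> bool" where
  "vanishes_along q p D f \<longleftrightarrow> f = 0 \<or> ord_along q p D f > 0"

definition image_divisor ::
  "complex \<Rightarrow> params \<Rightarrow> params \<Rightarrow> ratfun \<Rightarrow> ratfun \<Rightarrow> pdiv \<Rightarrow> pdiv \<Rightarrow> bool" where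
  "image_divisor q p p' Y X D D' \<longleftrightarrow> (\<forall>f.
     (regular_along q p' D' f \<longrightarrow> regular_along q p D (subst f Y X)) \<and>
     (vanishes_along q p' D' f \<longrightarrow> vanishes_along q p D (subst f Y X)))"

definition acts_by_images :: "complex \<Rightarrow> params \<Rightarrow> params \<Rightarrow> ratfun \<Rightarrow> ratfun \<Rightarrow>
    (divisor set \<Rightarrow> divisor set) \<Rightarrow> bool" where
  "acts_by_images q p p' Y X \<Phi> \<longleftrightarrow> (\<forall>D\<in>prime_divisors. \<exists>D'\<in>prime_divisors.
     image_divisor q p p' Y X D D' \<and>
     \<Phi> (div_class q p (prime_div D)) = div_class q p' (prime_div D'))"


section \<open>The basis of the Picard group\<close>

text \<open>Representatives of \<open>\<H>\<^sub>y\<close> and \<open>\<H>\<^sub>\<xi>\<close>: lines through none of the eight points, for which total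
  and strict transform coincide.\<close>

definition generic_y_line :: "complex \<Rightarrow> params \<Rightarrow> divisor" where
  "generic_y_line q p =
     (let a = (SOME a. \<forall>k\<in>{1..8}. fst (center q p k) \<noteq> Fin a) in prime_div (Curve [:[:- a, 1:]:]))"

definition generic_xi_line :: "complex \<Rightarrow> params \<Rightarrow> divisor" where
  "generic_xi_line q p =
     (let a = (SOME a. \<forall>k\<in>{1..8}. snd (center q p k) \<noteq> Fin a) in prime_div (Curve [:[:- a:], 1:]))"

type_synonym lattice10 = "int ^ 10"

definition basis_divisor :: "complex \<Rightarrow> params \<Rightarrow> 10 \<Rightarrow> divisor" where
  "basis_divisor q p i =
    (let Hy = generic_y_line q p; Hxi = generic_xi_line q p; F = (\<lambda>k. prime_div (Exc k)) in
     if i = 0 then Hy + Hxi - F 3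
     else if i = 1 then Hy - F 3
     else if i = 2 then F 1
     else if i = 3 then F 2
     else if i = 4 then F 5
     else if i = 5 then F 6
     else if i = 6 then F 7
     else if i = 7 then F 8
     else if i = 8 then Hxi - F 3
     else F 4)"

text \<open>The class \<open>\<Sum> x\<^sub>i \<E>\<^sub>i\<close>.\<close>

definition lattice_class :: "complex \<Rightarrow> params \<Rightarrow> lattice10 \<Rightarrow> divisor set" where
  "lattice_class q p x =
     div_class q p (\<Sum>i\<in>UNIV. Poly_Mapping.map (\<lambda>n. x $ i * n) (basis_divisor q p i))"


section \<open>The root lattice\<close>

definition intersection_form :: "lattice10 \<Rightarrow> lattice10 \<Rightarrow> int" where
  "intersection_form x y = x $ 0 * y $ 0 - (\<Sum>i\<in>UNIV - {0}. x $ i * y $ i)"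

definition simple_root :: "6 \<Rightarrow> lattice10" where
  "simple_root i = (let E = (\<lambda>j. axis j 1) in
     if i = 0 then E 0 - E 1 - E 8 - E 9
     else if i = 1 then E 2 - E 3
     else if i = 2 then E 1 - E 2
     else if i = 3 then E 0 - E 1 - E 4 - E 6
     else if i = 4 then E 6 - E 7
     else E 4 - E 5)"

text \<open>Elements of the root lattice are given by their coordinates with respect to the (linearly
  independent) simple roots; \<open>root_vec\<close> is the embedding into the Picard lattice.\<close>

type_synonym root_lattice = "int ^ 6"

definition root_vec :: "root_lattice \<Rightarrow> lattice10" where
  "root_vec x = (\<Sum>i\<in>UNIV. x $ i *s simple_root i)"

definition simple_reflection :: "6 \<Rightarrow> root_lattice \<Rightarrow> root_lattice" where
  "simple_reflection i x = x + intersection_form (root_vec x) (simple_root i) *s axis i 1"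

definition word_map :: "6 list \<Rightarrow> root_lattice \<Rightarrow> root_lattice" where
  "word_map is = foldr (\<lambda>i f. simple_reflection i \<circ> f) is id"

definition reduced_word :: "6 list \<Rightarrow> bool" where
  "reduced_word is \<longleftrightarrow> (\<forall>js. word_map js = word_map is \<longrightarrow> length is \<le> length js)"

definition root_permutation :: "(6 \<Rightarrow> 6) \<Rightarrow> root_lattice \<Rightarrow> root_lattice" where
  "root_permutation \<tau> x = (\<Sum>i\<in>UNIV. x $ i *s axis (\<tau> i) 1)"

definition diagram_automorphism :: "(6 \<Rightarrow> 6) \<Rightarrow> bool" where
  "diagram_automorphism \<tau> \<longleftrightarrow> bij \<tau> \<and> (\<forall>i j.
     intersection_form (simple_root (\<tau> i)) (simple_root (\<tau> j)) =
     intersection_form (simple_root i) (simple_root j))"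

definition extended_affine_weyl :: "(root_lattice \<Rightarrow> root_lattice) set" where
  "extended_affine_weyl = {root_permutation \<tau> \<circ> word_map is | \<tau> is. diagram_automorphism \<tau>}"

definition null_root :: root_lattice where
  "null_root = (\<chi> i. if i = 2 \<or> i = 3 then 2 else 1)"

definition translation :: "(root_lattice \<Rightarrow> root_lattice) \<Rightarrow> bool" where
  "translation T \<longleftrightarrow> T \<in> extended_affine_weyl \<and>
     (\<exists>n :: 6 \<Rightarrow> int. \<forall>i. T (axis i 1) = axis i 1 + n i *s null_root)"

definition sigma :: "root_lattice \<Rightarrow> root_lattice" where
  "sigma = root_permutation (id(0 := 1, 1 := 0, 4 := 5, 5 := 4))"

end

theory Submission
  imports Defs "HOL-Computational_Algebra.Fundamental_Theorem_Algebra"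
begin

text \<open>In the coordinates \<open>(y, \<xi>)\<close> the map factors into elementary transformations of \<open>\<bbbP>\<^sup>1 \<times> \<bbbP>\<^sup>1\<close> with
  eight marked points: twists \<open>(y, \<xi>) \<mapsto> (y (\<xi> - a) / (\<xi> - b), \<xi>)\<close>, where \<open>(0, b)\<close> and \<open>(\<infinity>, a)\<close> are marked,
  and rotations \<open>(y, \<xi>) \<mapsto> (\<xi>, C / y)\<close>. With \<open>\<eta> = y (\<xi> - q / \<kappa>\<^sub>2) / (\<xi> - c\<^sub>1 c\<^sub>2 / \<theta>\<^sub>1)\<close> and
  \<open>e\<^sub>i = q \<theta>\<^sub>1 c\<^sub>i / (\<kappa>\<^sub>2 c\<^sub>1 c\<^sub>2)\<close>, the image of \<open>(y, \<xi>)\<close> is \<open>(y', \<xi>')\<close>, where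
  \<open>\<xi> \<xi>'\<close> is a constant times \<open>(\<eta> - e\<^sub>1)(\<eta> - e\<^sub>2) / ((\<eta> - c\<^sub>3)(\<eta> - c\<^sub>4))\<close> and
  \<open>\<eta> y' = c\<^sub>3 c\<^sub>4 (\<xi>' - c\<^sub>1 c\<^sub>2 / \<theta>\<^sub>2) / (\<xi>' - 1 / (q \<kappa>\<^sub>1))\<close>. Each elementary transformation lifts to an
  isomorphism of the blown-up surfaces, so it permutes the valuations of the function field that come
  from prime divisors, and its effect on \<open>\<H>\<^sub>y, \<H>\<^sub>\<xi>, \<F>\<^sub>k\<close> can be read off. For the curves that are not
  contracted this is the statement that an isomorphism of localizations of \<open>\<complex>[y, \<xi>]\<close> preserves prime
  elements; the remaining finitely many divisors are compared through local coordinates.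
  The word is reduced because it sends eight positive real roots to negative ones.\<close>

subsection \<open>Valuations of the function field\<close>

text \<open>The images of the infinitely many curves cannot be listed, and
  \<open>image_divisor\<close> compares orders only; hence everything is phrased as an identity of
  valuations \<open>v \<circ> \<sigma> = v'\<close>. Two facts make such identities accessible. A
  valuation with a uniformizer \<open>s\<close> and a residue coordinate \<open>t\<close> is the
  y-adic order in disguise, so a divisor is recognised by pulling back two functions; and such pairs
  are algebraically independent, which is what makes \<open>subst\<close> a field homomorphism.
  Factoring keeps the local computations short: a twist contracts only the lines
  \<open>\<xi> = a\<close> and \<open>\<xi> = b\<close>, a rotation contracts nothing. The constants
  are forced. With \<open>c3 c4\<close> the first rotation interchanges \<open>c3\<close> and
  \<open>c4\<close>, where the next two twists are centred; with \<open>x6 x8\<close>, where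
  \<open>x6 = c1 c2 / \<theta>2\<close> and \<open>x8 = q / \<kappa>2\<close>, the second one
  interchanges the two \<open>\<xi>\<close>-values that \<phi> keeps. The relation between the
  parameters is the condition for the second rotation to carry the points 5 and 7 to the target
  values \<open>x7 / q\<close> and \<open>x5 / q\<close>. On the root lattice the outcome is
  \<open>x \<mapsto> x + (x5 - x4) \<delta>\<close>, which moves only the simple roots 4 and
  5.\<close>

definition valuation :: "(ratfun \<Rightarrow> int) \<Rightarrow> bool" where
  "valuation v \<longleftrightarrow> (\<forall>f g. f \<noteq> 0 \<longrightarrow> g \<noteq> 0 \<longrightarrow> v (f * g) = v f + v g) \<and>
     (\<forall>f g. f \<noteq> 0 \<longrightarrow> g \<noteq> 0 \<longrightarrow> f + g \<noteq> 0 \<longrightarrow> min (v f) (v g) \<le> v (f + g)) \<and>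
     (\<forall>c. c \<noteq> 0 \<longrightarrow> v (const_fun c) = 0)"

lemma const_fun_0 [simp]: "const_fun 0 = 0"
  by (simp add: const_fun_def)

lemma const_fun_1 [simp]: "const_fun 1 = 1"
  by (simp add: const_fun_def one_pCons flip: to_fract_1)

lemma const_fun_add: "const_fun (a + b) = const_fun a + const_fun b"
  by (simp add: const_fun_def flip: to_fract_add)

lemma const_fun_minus: "const_fun (- a) = - const_fun a"
  by (simp add: const_fun_def flip: to_fract_uminus)

lemma const_fun_diff: "const_fun (a - b) = const_fun a - const_fun b"
  by (simp add: const_fun_def flip: to_fract_diff)

lemma const_fun_mult: "const_fun (a * b) = const_fun a * const_fun b"
  by (simp add: const_fun_def flip: to_fract_mult)

lemma const_fun_eq_0_iff [simp]: "const_fun a = 0 \<longleftrightarrow> a = 0"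
  by (simp add: const_fun_def)

lemma const_fun_eq_iff [simp]: "const_fun a = const_fun b \<longleftrightarrow> a = b"
  by (simp add: const_fun_def)

lemma const_fun_inverse: "const_fun (inverse a) = inverse (const_fun a)"
proof (cases "a = 0")
  case False
  then have "const_fun a * const_fun (inverse a) = 1"
    by (simp flip: const_fun_mult)
  then show ?thesis by (simp add: inverse_unique)
qed simp

lemma const_fun_divide: "const_fun (a / b) = const_fun a / const_fun b"
  by (simp add: divide_inverse const_fun_mult const_fun_inverse)

lemma valuationD_mult: "valuation v \<Longrightarrow> f \<noteq> 0 \<Longrightarrow> g \<noteq> 0 \<Longrightarrow> v (f * g) = v f + v g"
  by (simp add: valuation_def)

lemma valuationD_add: "valuation v \<Longrightarrow> f \<noteq> 0 \<Longrightarrow> g \<noteq> 0 \<Longrightarrow> f + g \<noteq> 0 \<Longrightarrow> min (v f) (v g) \<le> v (f + g)"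
  by (simp add: valuation_def)

lemma valuationD_const: "valuation v \<Longrightarrow> c \<noteq> 0 \<Longrightarrow> v (const_fun c) = 0"
  by (simp add: valuation_def)

lemma valuation_1: "valuation v \<Longrightarrow> v 1 = 0"
  using valuationD_const[of v 1] by simp

lemma valuation_uminus:
  assumes "valuation v" shows "v (- f) = v f"
proof (cases "f = 0")
  case False
  have "- f = const_fun (- 1) * f" by (simp add: const_fun_minus)
  then show ?thesis using valuationD_mult[OF assms, of "const_fun (-1)" f] False
      valuationD_const[OF assms, of "-1"] by simp
qed simp

lemma valuation_inverse:
  assumes "valuation v" "f \<noteq> 0" shows "v (inverse f) = - v f"
  using valuationD_mult[OF assms(1,2), of "inverse f"] assms valuation_1[OF assms(1)] by simp

lemma valuation_divide:
  assumes "valuation v" "f \<noteq> 0" "g \<noteq> 0" shows "v (f / g) = v f - v g"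
  using assms by (simp add: divide_inverse valuationD_mult valuation_inverse)

lemma valuation_power:
  assumes "valuation v" "f \<noteq> 0" shows "v (f ^ n) = int n * v f"
  by (induction n) (use assms in \<open>simp_all add: valuation_1 valuationD_mult algebra_simps\<close>)

text \<open>The value of a valuation at \<open>0\<close> is junk, so nonvanishing has to be part of the next statement.\<close>

lemma valuation_dominant:
  assumes v: "valuation v" and "f \<noteq> 0" "g = 0 \<or> v f < v g"
  shows "f + g \<noteq> 0" "v (f + g) = v f"
proof -
  have "f + g \<noteq> 0 \<and> v (f + g) = v f"
  proof (cases "g = 0")
    case False
    with assms have lt: "v f < v g" by blast
    have ne: "f + g \<noteq> 0"
    proof
      assume "f + g = 0"
      then have "g = - f" by (simp add: eq_neg_iff_add_eq_0 add.commute)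
      then show False using lt valuation_uminus[OF v, of f] by simp
    qed
    have "min (v (f + g)) (v (- g)) \<le> v f"
      using valuationD_add[OF v, of "f + g" "- g"] ne False assms(2) by simp
    moreover have "min (v f) (v g) \<le> v (f + g)"
      using valuationD_add[OF v assms(2) False ne] .
    ultimately show ?thesis using lt ne valuation_uminus[OF v, of g] by auto
  qed (use assms in auto)
  then show "f + g \<noteq> 0" "v (f + g) = v f" by auto
qed

lemma prime_elem_multiplicity_add:
  fixes p :: poly_yxi
  assumes "prime_elem p" "a \<noteq> 0" "b \<noteq> 0" "a + b \<noteq> 0"
  shows "min (multiplicity p a) (multiplicity p b) \<le> multiplicity p (a + b)"
proof (rule multiplicity_geI)
  show "\<not> is_unit p" using assms(1) by (simp add: prime_elem_def)
  show "p ^ min (multiplicity p a) (multiplicity p b) dvd a + b"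
    by (intro dvd_add multiplicity_dvd') auto
qed (use assms in auto)

lemma numer_denom:
  "to_fract (numer f) / to_fract (denom f) = f" "denom f \<noteq> 0"
  "coprime (numer f) (denom f)"
  by (simp_all add: numer_def denom_def coprime_quot_of_fract flip: Fract_conv_to_fract)

lemma numer_eq_0_iff [simp]: "numer f = 0 \<longleftrightarrow> f = 0"
  by (simp add: numer_def)

lemma denom_neq_0 [simp]: "denom f \<noteq> 0"
  by (fact numer_denom)

lemma numer_to_fract [simp]: "numer (to_fract P) = P" "denom (to_fract P) = 1"
  by (simp_all add: numer_def denom_def)

lemma ratfun_cases:
  fixes f :: ratfun
  obtains a b where "f = to_fract a / to_fract b" "b \<noteq> 0" "coprime a b"
  using that[of "numer f" "denom f"] by (simp add: numer_denom)

lemma ord_curve_fract: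
  assumes P: "prime_elem P" and "a \<noteq> 0" "b \<noteq> 0"
  shows "ord_curve P (to_fract a / to_fract b) = int (multiplicity P a) - int (multiplicity P b)"
proof -
  let ?f = "to_fract a / to_fract b"
  have "?f \<noteq> 0" using assms by simp
  have "to_fract (numer ?f) * to_fract b = to_fract a * to_fract (denom ?f)"
    using numer_denom(1)[of ?f] assms
    by (metis denom_neq_0 frac_eq_eq to_fract_eq_0_iff)
  then have "numer ?f * b = a * denom ?f"
    by (metis to_fract_eq_iff to_fract_mult)
  then have "multiplicity P (numer ?f) + multiplicity P b = multiplicity P a + multiplicity P (denom ?f)"
    using prime_elem_multiplicity_mult_distrib[OF P] assms \<open>?f \<noteq> 0\<close>
    by (metis denom_neq_0 numer_eq_0_iff)
  then show ?thesis by (simp add: ord_curve_def)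
qed

lemma ord_curve_to_fract:
  "ord_curve P (to_fract a) = int (multiplicity P a)"
  by (simp add: ord_curve_def)

lemma valuation_ord_curve:
  assumes P: "prime_elem P" shows "valuation (ord_curve P)"
  unfolding valuation_def
proof (intro conjI allI impI)
  fix f g :: ratfun assume nz: "f \<noteq> 0" "g \<noteq> 0"
  obtain a b where f: "f = to_fract a / to_fract b" "b \<noteq> 0" by (rule ratfun_cases)
  obtain c d where g: "g = to_fract c / to_fract d" "d \<noteq> 0" by (rule ratfun_cases)
  have nz': "a \<noteq> 0" "c \<noteq> 0" using nz f g by auto
  have fg: "f * g = to_fract (a * c) / to_fract (b * d)" using f g by simp
  show "ord_curve P (f * g) = ord_curve P f + ord_curve P g"
    unfolding fg unfolding f(1) g(1) ord_curve_fract[OF P no_zero_divisors[OF nz'] no_zero_divisors[OF f(2) g(2)]]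
      ord_curve_fract[OF P nz'(1) f(2)] ord_curve_fract[OF P nz'(2) g(2)]
      prime_elem_multiplicity_mult_distrib[OF P f(2) g(2)]
      prime_elem_multiplicity_mult_distrib[OF P nz']
    by linarith
  assume "f + g \<noteq> 0"
  have fg: "f + g = to_fract (a * d + b * c) / to_fract (b * d)"
    using f g by (simp add: add_frac_eq mult.commute)
  have n0: "a * d + b * c \<noteq> 0" using \<open>f + g \<noteq> 0\<close> unfolding fg by (metis div_0 to_fract_0)
  have "min (multiplicity P (a * d)) (multiplicity P (b * c)) \<le> multiplicity P (a * d + b * c)"
    by (rule prime_elem_multiplicity_add) (use P f g nz' n0 in auto)
  then show "min (ord_curve P f) (ord_curve P g) \<le> ord_curve P (f + g)"
    unfolding fg unfolding f(1) g(1) ord_curve_fract[OF P n0 no_zero_divisors[OF f(2) g(2)]]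
      ord_curve_fract[OF P nz'(1) f(2)] ord_curve_fract[OF P nz'(2) g(2)]
      prime_elem_multiplicity_mult_distrib[OF P f(2) g(2)]
      prime_elem_multiplicity_mult_distrib[OF P nz'(1) g(2)]
      prime_elem_multiplicity_mult_distrib[OF P f(2) nz'(2)]
    by linarith
next
  fix c :: complex assume c: "c \<noteq> 0"
  have "is_unit [:[:c:]:]" using c by (simp add: is_unit_const_poly_iff dvd_field_iff)
  then show "ord_curve P (const_fun c) = 0"
    by (simp add: const_fun_def ord_curve_def multiplicity_unit_right)
qed


subsection \<open>Endomorphisms of the function field\<close>

text \<open>These are the pullbacks along dominant rational self-maps. Invertibility is left out,
  since the chart of a blow-up or a single substitution is easier to produce without an
  inverse.\<close>

definition chom :: "(ratfun \<Rightarrow> ratfun) \<Rightarrow> bool" where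
  "chom h \<longleftrightarrow> (\<forall>f g. h (f + g) = h f + h g) \<and> (\<forall>f g. h (f * g) = h f * h g) \<and>
     (\<forall>c. h (const_fun c) = const_fun c)"

lemma chom_add: "chom h \<Longrightarrow> h (f + g) = h f + h g"
  and chom_mult: "chom h \<Longrightarrow> h (f * g) = h f * h g"
  and chom_const: "chom h \<Longrightarrow> h (const_fun c) = const_fun c"
  by (auto simp: chom_def)

lemma chom_0: "chom h \<Longrightarrow> h 0 = 0"
  using chom_const[of h 0] by simp

lemma chom_1: "chom h \<Longrightarrow> h 1 = 1"
  using chom_const[of h 1] by simp

lemma chom_uminus: "chom h \<Longrightarrow> h (- f) = - h f"
  by (metis add.right_inverse add_eq_0_iff chom_0 chom_add)

lemma chom_diff: "chom h \<Longrightarrow> h (f - g) = h f - h g"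
  using chom_add[of h f "- g"] by (simp add: chom_uminus)

lemma chom_eq_0_iff: "chom h \<Longrightarrow> h f = 0 \<longleftrightarrow> f = 0"
  by (metis chom_0 chom_1 chom_mult mult_zero_left right_inverse zero_neq_one)

lemma chom_inverse: "chom h \<Longrightarrow> h (inverse f) = inverse (h f)"
proof (cases "f = 0")
  case False
  assume h: "chom h"
  have "h f * h (inverse f) = 1"
    using False by (simp add: h chom_1 flip: chom_mult[OF h])
  then show ?thesis by (metis inverse_unique)
qed (simp add: chom_0)

lemma chom_divide: "chom h \<Longrightarrow> h (f / g) = h f / h g"
  by (simp add: divide_inverse chom_mult chom_inverse)

lemmas chom_simps = chom_add chom_mult chom_const chom_0 chom_1 chom_uminus chom_diff chom_inverse
  chom_divide chom_eq_0_iff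

lemma chom_comp: "chom g \<Longrightarrow> chom h \<Longrightarrow> chom (\<lambda>f. g (h f))"
  by (simp add: chom_def)

lemma chom_id: "chom (\<lambda>f. f)"
  by (simp add: chom_def)

lemma chom_inj: "chom h \<Longrightarrow> h f = h g \<Longrightarrow> f = g"
  by (metis chom_diff chom_eq_0_iff eq_iff_diff_eq_0)

lemma const_poly_add [simp]: "map_poly const_fun (p + q) = map_poly const_fun p + map_poly const_fun q"
  by (intro poly_eqI) (simp add: coeff_map_poly const_fun_add)

lemma const_poly_pCons [simp]: "map_poly const_fun (pCons a p) = pCons (const_fun a) (map_poly const_fun p)"
  by (rule map_poly_pCons) simp

lemma const_poly_mult [simp]: "map_poly const_fun (p * q) = map_poly const_fun p * map_poly const_fun q"
proof (induction p)
  case (pCons a p)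
  have "map_poly const_fun (smult a q) = smult (const_fun a) (map_poly const_fun q)"
    by (intro poly_eqI) (simp add: coeff_map_poly const_fun_mult)
  then show ?case using pCons by simp
qed simp

definition coeff_at :: "ratfun \<Rightarrow> complex poly \<Rightarrow> ratfun" where
  "coeff_at Y c = poly (map_poly const_fun c) Y"

lemma coeff_at_simps [simp]:
  "coeff_at Y 0 = 0" "coeff_at Y (p + q) = coeff_at Y p + coeff_at Y q"
  "coeff_at Y (p * q) = coeff_at Y p * coeff_at Y q"
  "coeff_at Y (pCons a p) = const_fun a + Y * coeff_at Y p"
  by (simp_all add: coeff_at_def)

lemma poly_subst_conv: "poly_subst P Y X = poly (map_poly (coeff_at Y) P) X"
  by (simp add: poly_subst_def coeff_at_def[abs_def])

lemma poly_subst_pCons [simp]: "poly_subst (pCons c P) Y X = coeff_at Y c + X * poly_subst P Y X"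
  by (simp add: poly_subst_conv map_poly_pCons)

lemma poly_subst_0 [simp]: "poly_subst 0 Y X = 0"
  by (simp add: poly_subst_conv)

lemma poly_subst_add [simp]: "poly_subst (P + Q) Y X = poly_subst P Y X + poly_subst Q Y X"
proof -
  have "map_poly (coeff_at Y) (P + Q) = map_poly (coeff_at Y) P + map_poly (coeff_at Y) Q"
    by (intro poly_eqI) (simp add: coeff_map_poly)
  then show ?thesis by (simp add: poly_subst_conv)
qed

lemma poly_subst_smult [simp]: "poly_subst (smult c P) Y X = coeff_at Y c * poly_subst P Y X"
  by (induction P) (simp_all add: algebra_simps)

lemma poly_subst_mult [simp]: "poly_subst (P * Q) Y X = poly_subst P Y X * poly_subst Q Y X"
  by (induction P) (simp_all add: algebra_simps)

lemma poly_subst_1 [simp]: "poly_subst 1 Y X = 1"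
  by (simp add: one_pCons)

lemma poly_subst_power [simp]: "poly_subst (P ^ n) Y X = poly_subst P Y X ^ n"
  by (induction n) simp_all

lemma poly_subst_y [simp]: "poly_subst y_poly Y X = Y"
  by (simp add: y_poly_def)

lemma poly_subst_xi [simp]: "poly_subst xi_poly Y X = X"
  by (simp add: xi_poly_def one_pCons)

lemma chom_coeff_at: "chom h \<Longrightarrow> h (coeff_at Y c) = coeff_at (h Y) c"
  by (induction c) (simp_all add: chom_simps)

lemma chom_poly_subst: "chom h \<Longrightarrow> h (poly_subst P Y X) = poly_subst P (h Y) (h X)"
  by (induction P) (simp_all add: chom_simps chom_coeff_at)

lemma to_fract_coeff_at: "to_fract [:c:] = coeff_at y_fun c"
proof (induction c)
  case (pCons a c)
  have "[:pCons a c:] = [:[:a:]:] + y_poly * [:c:]" by (simp add: y_poly_def)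
  then have "to_fract [:pCons a c:] = const_fun a + y_fun * to_fract [:c:]"
    by (simp only: to_fract_add to_fract_mult y_fun_def const_fun_def)
  then show ?case using pCons by simp
qed simp

lemma to_fract_conv_subst: "to_fract P = poly_subst P y_fun xi_fun"
proof (induction P)
  case (pCons c P)
  have "pCons c P = [:c:] + xi_poly * P" by (simp add: xi_poly_def)
  then have "to_fract (pCons c P) = to_fract [:c:] + xi_fun * to_fract P"
    by (simp only: to_fract_add to_fract_mult xi_fun_def)
  then show ?case using pCons by (simp add: to_fract_coeff_at)
qed simp

lemma chom_to_fract: "chom h \<Longrightarrow> h (to_fract P) = poly_subst P (h y_fun) (h xi_fun)"
  by (simp add: to_fract_conv_subst chom_poly_subst)

text \<open>An endomorphism over the complex numbers is determined by the images of
  \<open>y_fun\<close> and \<open>xi_fun\<close>. This is the bridge from \<open>subst\<close> in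
  the definitions to homomorphisms.\<close>

lemma chom_eq_subst: "chom h \<Longrightarrow> h f = subst f (h y_fun) (h xi_fun)"
  by (metis chom_divide chom_to_fract numer_denom(1) subst_def)

lemma chom_eqI:
  assumes "chom g" "chom h" "g y_fun = h y_fun" "g xi_fun = h xi_fun"
  shows "g f = h f"
  using assms chom_eq_subst by metis

text \<open>The hypothesis says that \<open>Y\<close> and \<open>X\<close> are algebraically
  independent. Then no denominator is sent to zero and the value does not depend on the fraction
  chosen, so that sums and products can be computed with unreduced fractions.\<close>

lemma chom_subst:
  assumes "\<And>P. P \<noteq> 0 \<Longrightarrow> poly_subst P Y X \<noteq> 0"
  shows "chom (\<lambda>f. subst f Y X)" "subst y_fun Y X = Y" "subst xi_fun Y X = X"
proof -
  have eq: "subst (to_fract a / to_fract b) Y X = poly_subst a Y X / poly_subst b Y X"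
    if "b \<noteq> 0" for a b
  proof -
    let ?f = "to_fract a / to_fract b"
    have "to_fract (numer ?f) * to_fract b = to_fract a * to_fract (denom ?f)"
      using numer_denom(1)[of ?f] that
      by (metis denom_neq_0 frac_eq_eq to_fract_eq_0_iff)
    then have "numer ?f * b = a * denom ?f"
      by (metis to_fract_eq_iff to_fract_mult)
    then have "poly_subst (numer ?f) Y X * poly_subst b Y X = poly_subst a Y X * poly_subst (denom ?f) Y X"
      by (metis poly_subst_mult)
    then show ?thesis using assms[OF that] assms[of "denom ?f"]
      by (simp add: subst_def frac_eq_eq)
  qed
  have pol: "subst (to_fract a) Y X = poly_subst a Y X" for a
    using eq[of 1 a] by simp
  show "subst y_fun Y X = Y" "subst xi_fun Y X = X"
    by (simp_all add: y_fun_def xi_fun_def pol)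
  have "subst (f + g) Y X = subst f Y X + subst g Y X \<and> subst (f * g) Y X = subst f Y X * subst g Y X"
    for f g
  proof -
    obtain a b where f: "f = to_fract a / to_fract b" "b \<noteq> 0" by (rule ratfun_cases)
    obtain c d where g: "g = to_fract c / to_fract d" "d \<noteq> 0" by (rule ratfun_cases)
    have 1: "f + g = to_fract (a * d + b * c) / to_fract (b * d)"
      using f g by (simp add: add_frac_eq mult.commute)
    have 2: "f * g = to_fract (a * c) / to_fract (b * d)" using f g by simp
    show ?thesis
      unfolding 1 2 unfolding f(1) g(1) using f(2) g(2) assms[of b] assms[of d]
      by (simp add: eq field_simps del: to_fract_add to_fract_mult)
  qed
  then show "chom (\<lambda>f. subst f Y X)"
    by (auto simp: chom_def const_fun_def pol)
qed

subsection \<open>Coordinate lines\<close>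

definition line_y :: "complex \<Rightarrow> poly_yxi" where "line_y a = [:[:- a, 1:]:]"
definition line_xi :: "complex \<Rightarrow> poly_yxi" where "line_xi a = [:[:- a:], 1:]"

lemma coeff_at_1 [simp]: "coeff_at Y 1 = 1"
  by (simp add: one_pCons)

lemma y_poly_eq: "y_poly = line_y 0" by (simp add: y_poly_def line_y_def)
lemma xi_poly_eq: "xi_poly = line_xi 0" by (simp add: xi_poly_def line_xi_def)

lemma to_fract_line_y: "to_fract (line_y a) = y_fun - const_fun a"
  by (simp add: line_y_def to_fract_conv_subst const_fun_minus)

lemma to_fract_line_xi: "to_fract (line_xi a) = xi_fun - const_fun a"
  by (simp add: line_xi_def to_fract_conv_subst const_fun_minus)

lemma line_neq: "line_y a \<noteq> line_xi b" "line_y a = line_y b \<longleftrightarrow> a = b" "line_xi a = line_xi b \<longleftrightarrow> a = b"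
  by (auto simp: line_y_def line_xi_def)

lemma prime_line_y: "prime (line_y a)"
proof -
  have "prime_elem [:- a, 1:]" by (rule prime_elem_linear_field_poly) simp
  then have "prime_elem (line_y a)"
    by (simp add: line_y_def prime_elem_const_poly_iff)
  moreover have "normalize (line_y a) = line_y a"
    by (simp add: line_y_def normalize_const_poly normalize_poly_eq_map_poly map_poly_pCons one_pCons)
  ultimately show ?thesis by (simp add: prime_def)
qed

text \<open>Divisibility by \<open>\<xi> - a\<close> means vanishing at the constant polynomial
  \<open>a\<close>, so primality comes from the absence of zero divisors in the coefficient
  ring.\<close>

lemma prime_line_xi: "prime (line_xi a)"
proof -
  have dvd: "line_xi a dvd P \<longleftrightarrow> poly P [:a:] = 0" for P
    using poly_eq_0_iff_dvd[of P "[:a:]"] by (simp add: line_xi_def)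
  have "prime_elem (line_xi a)"
    by (rule prime_elemI) (auto simp: dvd, simp add: line_xi_def)
  moreover have "normalize (line_xi a) = line_xi a"
    by (simp add: line_xi_def normalize_poly_eq_map_poly map_poly_pCons unit_factor_poly_def flip: one_pCons)
  ultimately show ?thesis by (simp add: prime_def)
qed

lemma prime_y_poly: "prime y_poly" and prime_xi_poly: "prime xi_poly"
  by (simp_all add: y_poly_eq xi_poly_eq prime_line_y prime_line_xi)

lemma y_minus_neq_0: "y_fun - const_fun a \<noteq> 0" and xi_minus_neq_0: "xi_fun - const_fun a \<noteq> 0"
  using prime_line_y[of a] prime_line_xi[of a]
  by (auto simp flip: to_fract_line_y to_fract_line_xi)

lemma neq_const_fun [simp]: "y_fun \<noteq> const_fun a" "xi_fun \<noteq> const_fun a"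
  using y_minus_neq_0[of a] xi_minus_neq_0[of a] by auto

lemma y_fun_neq_0 [simp]: "y_fun \<noteq> 0" and xi_fun_neq_0 [simp]: "xi_fun \<noteq> 0"
  using y_minus_neq_0[of 0] xi_minus_neq_0[of 0] by auto

lemma ord_curve_prime:
  assumes "prime P" "prime Q"
  shows "ord_curve P (to_fract Q) = (if P = Q then 1 else 0)"
  using assms by (auto simp: ord_curve_to_fract prime_multiplicity_other)

lemma ord_line:
  "ord_curve (line_y a) (y_fun - const_fun b) = (if a = b then 1 else 0)"
  "ord_curve (line_y a) (xi_fun - const_fun b) = 0"
  "ord_curve (line_xi a) (xi_fun - const_fun b) = (if a = b then 1 else 0)"
  "ord_curve (line_xi a) (y_fun - const_fun b) = 0"
  by (simp_all add: ord_curve_prime prime_line_y prime_line_xi line_neq line_neq(1)[symmetric]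
      flip: to_fract_line_y to_fract_line_xi)

lemma ord_line_0:
  "ord_curve (line_y a) y_fun = (if a = 0 then 1 else 0)" "ord_curve (line_y a) xi_fun = 0"
  "ord_curve (line_xi a) xi_fun = (if a = 0 then 1 else 0)" "ord_curve (line_xi a) y_fun = 0"
  using ord_line[of a 0] by simp_all

lemma valuation_line: "valuation (ord_curve (line_y a))" "valuation (ord_curve (line_xi a))"
  using prime_line_y prime_line_xi valuation_ord_curve by auto


subsection \<open>Transversal pairs\<close>

text \<open>The functions \<open>s\<close> and \<open>t\<close> are local coordinates along the divisor of \<open>v\<close>: \<open>s\<close> is a uniformizer
  and \<open>t\<close> is not constant on the divisor. Such a pair determines \<open>v\<close> on \<open>\<complex>(s, t)\<close>.\<close>

definition transversal :: "(ratfun \<Rightarrow> int) \<Rightarrow> ratfun \<Rightarrow> ratfun \<Rightarrow> bool" where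
  "transversal v s t \<longleftrightarrow> valuation v \<and> s \<noteq> 0 \<and> v s = 1 \<and>
     (\<forall>c. t - const_fun c \<noteq> 0 \<and> v (t - const_fun c) = 0)"

text \<open>Over the complex numbers \<open>g\<close> splits into linear factors, and each
  \<open>t - z\<close> has value zero. A non-constant residue is therefore transcendental.\<close>

lemma transversal_coeff_at:
  assumes "transversal v s t" and "g \<noteq> 0"
  shows "coeff_at t g \<noteq> 0 \<and> v (coeff_at t g) = 0"
  using \<open>g \<noteq> 0\<close>
proof (induction "degree g" arbitrary: g rule: less_induct)
  case less
  have v: "valuation v" using assms by (simp add: transversal_def)
  show ?case
  proof (cases "degree g = 0")
    case True
    then obtain c where "g = [:c:]" by (rule degree_eq_zeroE)
    then show ?thesis using less.prems v by (simp add: valuationD_const)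
  next
    case False
    then have "\<not> constant (poly g)" by (simp add: constant_degree)
    then obtain z where "poly g z = 0" using fundamental_theorem_of_algebra by blast
    then obtain r where r: "g = [:- z, 1:] * r" by (auto simp: poly_eq_0_iff_dvd)
    have r0: "r \<noteq> 0" using r less.prems by auto
    have "degree g = degree [:- z, 1:] + degree r"
      unfolding r by (rule degree_mult_eq) (use r0 in auto)
    then have "degree r < degree g" by simp
    then have IH: "coeff_at t r \<noteq> 0 \<and> v (coeff_at t r) = 0" using less.hyps r0 by blast
    have "coeff_at t g = (t - const_fun z) * coeff_at t r"
      unfolding r coeff_at_simps by (simp add: const_fun_minus)
    then show ?thesis using IH assms(1) v by (simp add: transversal_def valuationD_mult)
  qed
qed

text \<open>Expansion \<open>P(s, t) = P(0, t) + s P1(s, t)\<close>. The order of the quantifiers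
  matters: one \<open>P1\<close> serves all pairs, so the identity can be used both at
  \<open>(y, \<xi>)\<close> and at a transversal pair.\<close>

lemma poly_subst_split:
  "\<exists>P1. \<forall>s t. poly_subst P s t = coeff_at t (map_poly (\<lambda>c. coeff c 0) P) + s * poly_subst P1 s t"
proof (induction P)
  case 0
  show ?case by (rule exI[of _ 0]) simp
next
  case (pCons c P)
  then obtain P1 where P1: "\<And>s t. poly_subst P s t = coeff_at t (map_poly (\<lambda>c. coeff c 0) P) + s * poly_subst P1 s t"
    by blast
  obtain c0 c' where c: "c = pCons c0 c'" by (cases c)
  have "poly_subst (pCons c P) s t =
      coeff_at t (map_poly (\<lambda>c. coeff c 0) (pCons c P)) + s * poly_subst (pCons c' P1) s t" for s t
    by (simp add: c P1 map_poly_pCons algebra_simps)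
  then show ?case by blast
qed

lemma transversal_nonneg:
  assumes "transversal v s t"
  shows "poly_subst P s t = 0 \<or> v (poly_subst P s t) \<ge> 0"
proof -
  have v: "valuation v" using assms by (simp add: transversal_def)
  \<comment> \<open>\<open>W\<close> is the valuation ring of \<open>v\<close>.\<close>
  define W where "W = {f. f = 0 \<or> v f \<ge> 0}"
  have add: "f + g \<in> W" if "f \<in> W" "g \<in> W" for f g
  proof (cases "f = 0 \<or> g = 0 \<or> f + g = 0")
    case False
    then show ?thesis using that valuationD_add[OF v, of f g] by (auto simp: W_def min_def split: if_splits)
  qed (use that in \<open>auto simp: W_def\<close>)
  have mult: "f * g \<in> W" if "f \<in> W" "g \<in> W" for f g
    using that valuationD_mult[OF v, of f g] by (cases "f = 0 \<or> g = 0") (auto simp: W_def)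
  have const: "const_fun c \<in> W" for c
    using valuationD_const[OF v, of c] by (cases "c = 0") (auto simp: W_def)
  have s: "s \<in> W" using assms by (simp add: W_def transversal_def)
  have "t - const_fun 0 \<noteq> 0 \<and> v (t - const_fun 0) = 0" using assms unfolding transversal_def by blast
  then have t: "t \<in> W" by (simp add: W_def)
  have "coeff_at s c \<in> W" for c
  proof (induction c)
    case 0
    show ?case by (simp add: W_def)
  qed (auto intro!: add mult const s)
  then have "poly_subst P s t \<in> W"
  proof (induction P)
    case 0
    show ?case by (simp add: W_def)
  qed (auto intro!: add mult t)
  then show ?thesis by (simp add: W_def)
qed

text \<open>Once the power of \<open>y\<close> is split off, the other factor \<open>Q\<close> has a
  nonzero restriction to \<open>y = 0\<close>; hence \<open>Q(0, t)\<close> has value zero and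
  dominates the remaining multiple of \<open>s\<close>. In particular \<open>s\<close> and
  \<open>t\<close> are algebraically independent.\<close>

lemma transversal_poly_subst:
  assumes tr: "transversal v s t" and "P \<noteq> 0"
  shows "poly_subst P s t \<noteq> 0 \<and> v (poly_subst P s t) = int (multiplicity y_poly P)"
proof -
  have v: "valuation v" and s: "s \<noteq> 0" "v s = 1" using tr by (auto simp: transversal_def)
  have y: "\<not> is_unit y_poly" using prime_y_poly by auto
  obtain Q where Q: "P = y_poly ^ multiplicity y_poly P * Q" "\<not> y_poly dvd Q"
    using multiplicity_decompose'[OF \<open>P \<noteq> 0\<close> y] by metis
  obtain Q1 where Q1: "\<And>s t. poly_subst Q s t = coeff_at t (map_poly (\<lambda>c. coeff c 0) Q) + s * poly_subst Q1 s t"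
    using poly_subst_split[of Q] by blast
  let ?g = "map_poly (\<lambda>c. coeff c 0) Q"
  \<comment> \<open>Were the restriction zero, the expansion at the pair \<open>(y, \<xi>)\<close>
    itself would exhibit \<open>y\<close> as a divisor of \<open>Q\<close>.\<close>
  have "?g \<noteq> 0"
  proof
    assume "?g = 0"
    then have "to_fract Q = to_fract (y_poly * Q1)"
      using Q1[of y_fun xi_fun] by (simp add: to_fract_conv_subst)
    then have "Q = y_poly * Q1" by (simp only: to_fract_eq_iff)
    then show False using Q(2) by simp
  qed
  then have g: "coeff_at t ?g \<noteq> 0" "v (coeff_at t ?g) = 0"
    using transversal_coeff_at[OF tr] by auto
  have "s * poly_subst Q1 s t = 0 \<or> v (coeff_at t ?g) < v (s * poly_subst Q1 s t)"
    using transversal_nonneg[OF tr, of Q1] s g valuationD_mult[OF v, of s "poly_subst Q1 s t"]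
    by (cases "poly_subst Q1 s t = 0") auto
  from valuation_dominant[OF v g(1) this] g(2)
  have Qv: "poly_subst Q s t \<noteq> 0" "v (poly_subst Q s t) = 0"
    by (simp_all add: Q1)
  have "poly_subst P s t = s ^ multiplicity y_poly P * poly_subst Q s t"
    by (subst Q(1)) simp
  then show ?thesis using Qv s v by (simp add: valuationD_mult valuation_power)
qed

lemma transversal_chom:
  assumes "transversal v s t"
  shows "chom (\<lambda>f. subst f s t)" "subst y_fun s t = s" "subst xi_fun s t = t"
  using chom_subst[of s t] transversal_poly_subst[OF assms] by auto

lemma transversal_eq_ord:
  assumes "chom \<rho>" "transversal v (\<rho> y_fun) (\<rho> xi_fun)" "f \<noteq> 0"
  shows "v (\<rho> f) = ord_curve y_poly f"
proof -
  obtain a b where f: "f = to_fract a / to_fract b" "b \<noteq> 0" by (rule ratfun_cases)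
  have a: "a \<noteq> 0" using f assms(3) by auto
  have v: "valuation v" using assms(2) by (simp add: transversal_def)
  have "prime_elem y_poly" using prime_y_poly by blast
  then show ?thesis
    using transversal_poly_subst[OF assms(2) a] transversal_poly_subst[OF assms(2) f(2)]
    by (simp add: f chom_divide[OF assms(1)] chom_to_fract[OF assms(1)] valuation_divide[OF v]
        ord_curve_fract a)
qed

lemma valuation_comp: "chom h \<Longrightarrow> valuation w \<Longrightarrow> valuation (\<lambda>f. w (h f))"
proof -
  assume h: "chom h" and w: "valuation w"
  have "min (w (h f)) (w (h g)) \<le> w (h (f + g))" if "f \<noteq> 0" "g \<noteq> 0" "f + g \<noteq> 0" for f g
    using valuationD_add[OF w, of "h f" "h g"] that chom_eq_0_iff[OF h] by (metis chom_add[OF h])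
  then show ?thesis using w h
    unfolding valuation_def[of "\<lambda>f. w (h f)"]
    by (auto simp: chom_mult chom_const chom_eq_0_iff valuationD_mult valuationD_const)
qed

lemma transversal_comp:
  "chom h \<Longrightarrow> transversal w (h s) (h t) \<Longrightarrow> transversal (\<lambda>f. w (h f)) s t"
proof -
  assume h: "chom h" and tr: "transversal w (h s) (h t)"
  have "h (t - const_fun c) = h t - const_fun c" for c by (simp add: h chom_diff chom_const)
  then show ?thesis using tr h chom_eq_0_iff[OF h] valuation_comp[OF h]
    unfolding transversal_def by metis
qed

lemma transversal_lines:
  "transversal (ord_curve (line_y a)) (y_fun - const_fun a) xi_fun"
  "transversal (ord_curve (line_xi a)) (xi_fun - const_fun a) y_fun"
  by (simp_all add: transversal_def valuation_line ord_line y_minus_neq_0 xi_minus_neq_0)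

section \<open>Endomorphisms given by elementary coordinate changes\<close>

lemma ex_chom_swap: "\<exists>h. chom h \<and> h y_fun = xi_fun \<and> h xi_fun = y_fun"
  using transversal_chom[OF transversal_lines(2)[of 0]] by auto

lemma ord_line_xi_inverse:
  assumes "c \<noteq> 0"
  shows "const_fun c / y_fun - const_fun d \<noteq> 0 \<and>
    ord_curve (line_xi 0) (const_fun c / y_fun - const_fun d) = 0"
proof -
  let ?v = "ord_curve (line_xi 0)"
  have v: "valuation ?v" by (rule valuation_line)
  have "const_fun c / y_fun - const_fun d = (const_fun c - const_fun d * y_fun) / y_fun"
    by (simp add: field_simps)
  moreover have "const_fun c - const_fun d * y_fun \<noteq> 0 \<and> ?v (const_fun c - const_fun d * y_fun) = 0"
  proof (cases "d = 0")
    case True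
    then show ?thesis using assms v by (simp add: valuationD_const)
  next
    case False
    have "const_fun c - const_fun d * y_fun = const_fun (- d) * (y_fun - const_fun (c / d))"
      using False by (simp add: const_fun_divide const_fun_minus field_simps)
    then show ?thesis using False v valuationD_mult[OF v, of "const_fun (- d)" "y_fun - const_fun (c / d)"]
      by (simp add: valuationD_const ord_line)
  qed
  ultimately show ?thesis using v by (simp add: valuation_divide ord_line_0)
qed

lemma ex_chom_rotation:
  assumes "c \<noteq> 0" shows "\<exists>h. chom h \<and> h y_fun = xi_fun \<and> h xi_fun = const_fun c / y_fun"
proof -
  have "transversal (ord_curve (line_xi 0)) xi_fun (const_fun c / y_fun)"
    using ord_line_xi_inverse[OF assms] by (simp add: transversal_def valuation_line ord_line_0)
  then show ?thesis using transversal_chom by metis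
qed

lemma ex_chom_inverse_y: "\<exists>h. chom h \<and> h y_fun = 1 / y_fun \<and> h xi_fun = xi_fun"
proof -
  obtain S where S: "chom S" "S y_fun = xi_fun" "S xi_fun = y_fun" using ex_chom_swap by blast
  obtain R where R: "chom R" "R y_fun = xi_fun" "R xi_fun = 1 / y_fun"
    using ex_chom_rotation[of 1] by auto
  show ?thesis
    by (rule exI[of _ "\<lambda>f. R (S f)"]) (use R S in \<open>simp add: chom_comp\<close>)
qed

lemma ex_chom_inverse_xi: "\<exists>h. chom h \<and> h y_fun = y_fun \<and> h xi_fun = 1 / xi_fun"
proof -
  obtain S where S: "chom S" "S y_fun = xi_fun" "S xi_fun = y_fun" using ex_chom_swap by blast
  obtain R where R: "chom R" "R y_fun = xi_fun" "R xi_fun = 1 / y_fun"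
    using ex_chom_rotation[of 1] by auto
  show ?thesis
    by (rule exI[of _ "\<lambda>f. S (R f)"]) (use R S in \<open>simp add: chom_comp chom_divide chom_1\<close>)
qed

lemma ex_chom_shift_y: "\<exists>h. chom h \<and> h y_fun = const_fun a + y_fun \<and> h xi_fun = xi_fun"
  using transversal_chom[OF transversal_lines(1)[of "- a"]] by (auto simp: const_fun_minus add.commute)

lemma ex_chom_shift_xi: "\<exists>h. chom h \<and> h y_fun = y_fun \<and> h xi_fun = const_fun a + xi_fun"
proof -
  obtain S where S: "chom S" "S y_fun = xi_fun" "S xi_fun = y_fun" using ex_chom_swap by blast
  obtain R where R: "chom R" "R y_fun = const_fun a + y_fun" "R xi_fun = xi_fun"
    using ex_chom_shift_y by blast
  show ?thesis
    by (rule exI[of _ "\<lambda>f. S (R (S f))"])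
      (use R S chom_comp[OF S(1) chom_comp[OF R(1) S(1)]] in \<open>simp add: chom_add chom_const\<close>)
qed

lemma ex_chom_local_y: "\<exists>h. chom h \<and> h y_fun = in_local_parameter A y_fun \<and> h xi_fun = xi_fun"
  by (cases A) (simp_all add: ex_chom_shift_y ex_chom_inverse_y)

lemma ex_chom_local_xi: "\<exists>h. chom h \<and> h y_fun = y_fun \<and> h xi_fun = in_local_parameter A xi_fun"
  by (cases A) (simp_all add: ex_chom_shift_xi ex_chom_inverse_xi)

lemma chom_in_local_parameter:
  "chom h \<Longrightarrow> h (in_local_parameter A f) = in_local_parameter A (h f)"
  by (cases A) (simp_all add: chom_simps)

lemma ex_chom_local:
  "\<exists>h. chom h \<and> h y_fun = in_local_parameter A y_fun \<and> h xi_fun = in_local_parameter B xi_fun"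
proof -
  obtain S where S: "chom S" "S y_fun = in_local_parameter A y_fun" "S xi_fun = xi_fun"
    using ex_chom_local_y by blast
  obtain R where R: "chom R" "R y_fun = y_fun" "R xi_fun = in_local_parameter B xi_fun"
    using ex_chom_local_xi by blast
  show ?thesis
    by (rule exI[of _ "\<lambda>f. S (R f)"]) (use R S in \<open>simp add: chom_comp chom_in_local_parameter\<close>)
qed

lemma ex_chom_blowup: "\<exists>h. chom h \<and> h y_fun = y_fun \<and> h xi_fun = y_fun * xi_fun"
proof -
  obtain S where S: "chom S" "S y_fun = xi_fun" "S xi_fun = y_fun" using ex_chom_swap by blast
  have "transversal (ord_curve (line_xi 0)) (y_fun * xi_fun) y_fun"
    using ord_line[of 0]
    by (simp add: transversal_def valuation_line valuationD_mult ord_line_0 y_minus_neq_0)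
  then obtain R where R: "chom R" "R y_fun = y_fun * xi_fun" "R xi_fun = y_fun"
    using transversal_chom by metis
  show ?thesis
    by (rule exI[of _ "\<lambda>f. R (S f)"]) (use R S in \<open>simp add: chom_comp\<close>)
qed

subsection \<open>Orders along prime divisors\<close>

text \<open>Replacing \<open>\<xi>\<close> by \<open>y \<xi>\<close> multiplies the coefficient of
  the i-th power of \<open>\<xi>\<close> by the i-th power of \<open>y\<close>, so the y-adic order
  of the result is the least total degree of a monomial of \<open>P\<close>. Multiplicity at a
  blown-up point thus becomes the order along the exceptional line of the blow-up chart.\<close>

lemma mult_at_origin_eq:
  fixes P :: poly_yxi
  assumes "P \<noteq> 0"
  shows "mult_at_origin P = multiplicity y_poly (pcompose P (monom (monom 1 1) 1))"
proof -
  let ?B = "pcompose P (monom (monom 1 1) 1)"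
  have coeffB: "coeff ?B i = monom 1 i * coeff P i" for i
    by (simp add: monom_power)
  have dvd: "y_poly ^ n dvd ?B \<longleftrightarrow> (\<forall>i j. i + j < n \<longrightarrow> coeff (coeff P i) j = 0)" for n
  proof -
    have "y_poly ^ n = [:monom 1 n:]"
      by (simp add: y_poly_def monom_altdef poly_const_pow)
    then have "y_poly ^ n dvd ?B \<longleftrightarrow> (\<forall>i. \<forall>k<n. coeff (monom 1 i * coeff P i) k = 0)"
      by (simp only: const_poly_dvd_iff coeffB monom_1_dvd_iff')
    also have "\<dots> \<longleftrightarrow> (\<forall>i j. i + j < n \<longrightarrow> coeff (coeff P i) j = 0)"
    proof (intro iffI allI impI)
      fix i j assume H: "\<forall>i. \<forall>k<n. coeff (monom 1 i * coeff P i) k = 0" "i + j < n"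
      then have "coeff (monom 1 i * coeff P i) (i + j) = 0" by blast
      then show "coeff (coeff P i) j = 0" by (simp add: coeff_monom_mult)
    next
      fix i k assume H: "\<forall>i j. i + j < n \<longrightarrow> coeff (coeff P i) j = 0" "k < n"
      show "coeff (monom 1 i * coeff P i) k = 0"
        using H(1)[rule_format, of i "k - i"] H(2) by (simp add: coeff_monom_mult)
    qed
    finally show ?thesis .
  qed
  let ?Q = "\<lambda>n. \<exists>i j. i + j = n \<and> coeff (coeff P i) j \<noteq> 0"
  obtain i where "coeff P i \<noteq> 0" using assms by (metis leading_coeff_0_iff)
  then obtain j where "coeff (coeff P i) j \<noteq> 0" by (metis leading_coeff_0_iff)
  then have ex: "?Q (i + j)" by blast
  have 1: "?Q (mult_at_origin P)" unfolding mult_at_origin_def by (rule LeastI[of ?Q, OF ex])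
  have 2: "\<not> ?Q n" if "n < mult_at_origin P" for n
    using that unfolding mult_at_origin_def by (rule not_less_Least)
  have "y_poly ^ mult_at_origin P dvd ?B" unfolding dvd using 2 by blast
  moreover have "\<not> y_poly ^ Suc (mult_at_origin P) dvd ?B" unfolding dvd using 1 lessI by metis
  ultimately show ?thesis by (rule multiplicity_eqI[symmetric])
qed

lemma poly_subst_blowup:
  fixes P :: poly_yxi
  shows "poly_subst P y_fun (y_fun * xi_fun) = to_fract (pcompose P (monom (monom 1 1) 1))"
proof (induction P)
  case (pCons c P)
  have m: "monom (monom 1 1) 1 = y_poly * xi_poly"
    by (simp add: y_poly_def xi_poly_def monom_altdef)
  have "to_fract (pcompose (pCons c P) (monom (monom 1 1) 1)) =
      to_fract [:c:] + y_fun * xi_fun * to_fract (pcompose P (monom (monom 1 1) 1))"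
    unfolding pcompose_pCons to_fract_add to_fract_mult unfolding m by (simp add: y_fun_def xi_fun_def)
  then show ?case by (simp add: pCons.IH to_fract_coeff_at)
qed simp

lemma ord_origin_eq:
  assumes h: "chom h" "h y_fun = y_fun" "h xi_fun = y_fun * xi_fun" and "f \<noteq> 0"
  shows "ord_origin f = ord_curve y_poly (h f)"
proof -
  let ?B = "\<lambda>P :: poly_yxi. pcompose P (monom (monom 1 1) 1)"
  have hP: "h (to_fract P) = to_fract (?B P)" for P
    by (simp add: chom_to_fract h poly_subst_blowup)
  have nz: "?B P \<noteq> 0" if "P \<noteq> 0" for P
    using hP[of P] chom_eq_0_iff[OF h(1), of "to_fract P"] that by auto
  have "f = to_fract (numer f) / to_fract (denom f)" by (simp add: numer_denom)
  then have "h f = to_fract (?B (numer f)) / to_fract (?B (denom f))"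
    by (metis hP chom_divide[OF h(1)])
  moreover have "prime_elem y_poly" using prime_y_poly by blast
  moreover have "?B (numer f) \<noteq> 0" "?B (denom f) \<noteq> 0"
    using nz[of "numer f"] nz[of "denom f"] assms(4) by simp_all
  ultimately have "ord_curve y_poly (h f) =
      int (multiplicity y_poly (?B (numer f))) - int (multiplicity y_poly (?B (denom f)))"
    using ord_curve_fract by metis
  moreover have "numer f \<noteq> 0" using assms(4) by simp
  ultimately show ?thesis unfolding ord_origin_def
    using mult_at_origin_eq[of "numer f"] mult_at_origin_eq[of "denom f"] denom_neq_0 by metis
qed

text \<open>The eight centres are a parameter because the factorization passes through surfaces
  whose blown-up points are not of the form \<open>center q p\<close>.\<close>

fun ord_at :: "(nat \<Rightarrow> P1 \<times> P1) \<Rightarrow> pdiv \<Rightarrow> ratfun \<Rightarrow> int" where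
  "ord_at cs (Curve P) f = ord_curve P f"
| "ord_at cs Line_y_inf f = ord_curve y_poly (subst f (1 / y_fun) xi_fun)"
| "ord_at cs Line_xi_inf f = ord_curve xi_poly (subst f y_fun (1 / xi_fun))"
| "ord_at cs (Exc k) f = ord_origin
     (subst f (in_local_parameter (fst (cs k)) y_fun) (in_local_parameter (snd (cs k)) xi_fun))"

lemma ord_along_eq: "ord_along q p D f = ord_at (center q p) D f"
  by (cases D) simp_all

fun local_parameter :: "P1 \<Rightarrow> ratfun \<Rightarrow> ratfun" where
  "local_parameter (Fin a) f = f - const_fun a"
| "local_parameter Infty f = 1 / f"

lemma local_parameter_inverse [simp]:
  "local_parameter A (in_local_parameter A f) = f"
  by (cases A) simp_all

lemma chom_local_parameter:
  "chom h \<Longrightarrow> h (local_parameter A f) = local_parameter A (h f)"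
  by (cases A) (simp_all add: chom_simps)

lemma local_parameter_neq_0: "local_parameter A y_fun \<noteq> 0" "local_parameter A xi_fun \<noteq> 0"
  by (cases A; simp)+

text \<open>The second clause says that the pair identifies the divisor: to see that \<sigma> pulls
  it back to the divisor of \<open>v\<close>, it is enough that the images of \<open>s\<close> and
  \<open>t\<close> are transversal for \<open>v\<close>. Transversality alone controls
  \<open>v\<close> only on the field generated by \<open>s\<close> and \<open>t\<close>.\<close>

definition chart :: "(nat \<Rightarrow> P1 \<times> P1) \<Rightarrow> pdiv \<Rightarrow> ratfun \<Rightarrow> ratfun \<Rightarrow> bool" where
  "chart cs D s t \<longleftrightarrow> transversal (ord_at cs D) s t \<and>
     (\<forall>v \<sigma> f. chom \<sigma> \<longrightarrow> transversal v (\<sigma> s) (\<sigma> t) \<longrightarrow> f \<noteq> 0 \<longrightarrow> v (\<sigma> f) = ord_at cs D f)"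

text \<open>The endomorphism \<open>h\<close> certifies that \<open>s\<close> and \<open>t\<close>
  generate the whole function field, because it is inverse to the substitution of
  \<open>(s, t)\<close>. The order is then the y-adic order of \<open>h f\<close>, and so is every
  other valuation with such a pair.\<close>

lemma chartI:
  assumes tr: "transversal (ord_at cs D) s t" and h: "chom h" "h s = y_fun" "h t = xi_fun"
  shows "chart cs D s t"
  unfolding chart_def
proof (intro conjI allI impI tr)
  have inv: "v (\<sigma> f) = ord_curve y_poly (h f)"
    if "chom \<sigma>" "transversal v (\<sigma> s) (\<sigma> t)" "f \<noteq> 0" for v \<sigma> f
  proof -
    note g = transversal_chom[OF tr]
    \<comment> \<open>\<open>h\<close> after the substitution fixes \<open>y\<close> and
      \<open>\<xi>\<close>; injectivity of \<open>h\<close> makes this one-sided inverse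
      two-sided.\<close>
    have "subst (h f') s t = f'" for f'
    proof -
      let ?g = "\<lambda>f. subst f s t"
      have "h (?g (h f')) = h f'"
        by (rule chom_eqI[of "\<lambda>f. h (?g f)" "\<lambda>f. f"])
          (use h g in \<open>simp_all add: chom_comp[OF h(1) g(1)] chom_id\<close>)
      then show ?thesis using chom_inj[OF h(1)] by blast
    qed
    then have "v (\<sigma> f) = v (\<sigma> (subst (h f) s t))" by simp
    also have "\<dots> = ord_curve y_poly (h f)"
      by (rule transversal_eq_ord[of "\<lambda>f. \<sigma> (subst f s t)"])
        (use that g h chom_eq_0_iff[OF h(1)] in \<open>simp_all add: chom_comp[OF that(1) g(1)]\<close>)
    finally show ?thesis .
  qed
  fix v \<sigma> f assume "chom \<sigma>" "transversal v (\<sigma> s) (\<sigma> t)" and f: "(f :: ratfun) \<noteq> 0"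
  then show "v (\<sigma> f) = ord_at cs D f"
    using inv[of \<sigma> v f] inv[OF chom_id tr f] by simp
qed

lemma chart_line_y: "chart cs (Curve (line_y a)) (y_fun - const_fun a) xi_fun"
proof -
  obtain h where "chom h" "h y_fun = const_fun a + y_fun" "h xi_fun = xi_fun"
    using ex_chom_shift_y by blast
  moreover have "ord_at cs (Curve (line_y a)) = ord_curve (line_y a)" by auto
  ultimately show ?thesis
    using transversal_lines by (intro chartI[of _ _ _ _ h]) (simp_all add: chom_simps)
qed

lemma chart_line_xi: "chart cs (Curve (line_xi a)) (xi_fun - const_fun a) y_fun"
proof -
  obtain g where g: "chom g" "g y_fun = const_fun a + y_fun" "g xi_fun = xi_fun"
    using ex_chom_shift_y by blast
  obtain S where S: "chom S" "S y_fun = xi_fun" "S xi_fun = y_fun" using ex_chom_swap by blast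
  have "ord_at cs (Curve (line_xi a)) = ord_curve (line_xi a)" by auto
  then show ?thesis
    using transversal_lines g S
    by (intro chartI[of _ _ _ _ "\<lambda>f. g (S f)"]) (simp_all add: chom_simps chom_comp)
qed

lemma chart_y_inf: "chart cs Line_y_inf (1 / y_fun) xi_fun"
proof -
  obtain h where h: "chom h" "h y_fun = 1 / y_fun" "h xi_fun = xi_fun"
    using ex_chom_inverse_y by blast
  have "ord_at cs Line_y_inf = (\<lambda>f. ord_curve y_poly (h f))"
    using chom_eq_subst[OF h(1)] h by (auto simp: fun_eq_iff)
  then have "transversal (ord_at cs Line_y_inf) (1 / y_fun) xi_fun"
    using transversal_comp[OF h(1), of "ord_curve y_poly" "1 / y_fun" xi_fun] transversal_lines(1)[of 0] h
    by (simp add: chom_divide chom_1 y_poly_eq)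
  then show ?thesis using h by (intro chartI[of _ _ _ _ h]) (simp_all add: chom_divide chom_1)
qed

lemma chart_xi_inf: "chart cs Line_xi_inf (1 / xi_fun) y_fun"
proof -
  obtain h where h: "chom h" "h y_fun = y_fun" "h xi_fun = 1 / xi_fun"
    using ex_chom_inverse_xi by blast
  obtain R where R: "chom R" "R y_fun = xi_fun" "R xi_fun = 1 / y_fun"
    using ex_chom_rotation[of 1] by auto
  have "ord_at cs Line_xi_inf = (\<lambda>f. ord_curve xi_poly (h f))"
    using chom_eq_subst[OF h(1)] h by (auto simp: fun_eq_iff)
  then have "transversal (ord_at cs Line_xi_inf) (1 / xi_fun) y_fun"
    using transversal_comp[OF h(1), of "ord_curve xi_poly" "1 / xi_fun" y_fun] transversal_lines(2)[of 0] h
    by (simp add: chom_divide chom_1 xi_poly_eq)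
  then show ?thesis using R by (intro chartI[of _ _ _ _ R]) (simp_all add: chom_divide chom_1)
qed

text \<open>In the affine chart of the blow-up where the first local parameter is a uniformizer, the
  ratio of the two parameters is the coordinate on the exceptional curve.\<close>

lemma chart_exc:
  "chart cs (Exc k) (local_parameter (fst (cs k)) y_fun)
     (local_parameter (snd (cs k)) xi_fun / local_parameter (fst (cs k)) y_fun)"
proof -
  let ?A = "fst (cs k)" and ?B = "snd (cs k)"
  obtain h where h: "chom h" "h y_fun = in_local_parameter ?A y_fun" "h xi_fun = in_local_parameter ?B xi_fun"
    using ex_chom_local by blast
  obtain b where b: "chom b" "b y_fun = y_fun" "b xi_fun = y_fun * xi_fun"
    using ex_chom_blowup by blast
  have bh: "chom (\<lambda>f. b (h f))" using b h chom_comp by blast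
  let ?s = "local_parameter ?A y_fun" and ?t = "local_parameter ?B xi_fun / local_parameter ?A y_fun"
  have st: "b (h ?s) = y_fun" "b (h ?t) = xi_fun"
    using b h by (simp_all add: chom_local_parameter chom_divide)
  have eq: "ord_at cs (Exc k) f = ord_curve y_poly (b (h f))" if "f \<noteq> 0" for f
  proof -
    have "h f = subst f (in_local_parameter ?A y_fun) (in_local_parameter ?B xi_fun)"
      using chom_eq_subst[OF h(1), of f] h by simp
    moreover have "h f \<noteq> 0" using that chom_eq_0_iff[OF h(1)] by simp
    ultimately show ?thesis using ord_origin_eq[OF b, of "h f"] by simp
  qed
  have tr: "transversal (\<lambda>f. ord_curve y_poly (b (h f))) ?s ?t"
    using transversal_comp[OF bh, of "ord_curve y_poly" ?s ?t] transversal_lines(1)[of 0] st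
    by (simp add: y_poly_eq)
  then have "transversal (ord_at cs (Exc k)) ?s ?t"
    unfolding transversal_def valuation_def by (simp add: eq del: ord_at.simps)
  then show ?thesis using bh st by (intro chartI[of _ _ _ _ "\<lambda>f. b (h f)"]) simp_all
qed

lemma chartD:
  "chart cs D s t \<Longrightarrow> transversal (ord_at cs D) s t"
  "chart cs D s t \<Longrightarrow> chom \<sigma> \<Longrightarrow> transversal v (\<sigma> s) (\<sigma> t) \<Longrightarrow> f \<noteq> 0 \<Longrightarrow> v (\<sigma> f) = ord_at cs D f"
  by (auto simp: chart_def)

lemma valuation_ord_at:
  assumes "D \<in> prime_divisors" shows "valuation (ord_at cs D)"
proof (cases D)
  case (Curve P)
  then have "prime P" using assms by (auto simp: prime_divisors_def)
  moreover have "ord_at cs (Curve P) = ord_curve P" by auto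
  ultimately show ?thesis using Curve valuation_ord_curve by auto
qed (use chart_y_inf chart_xi_inf chart_exc in \<open>auto simp: chart_def transversal_def\<close>)

subsection \<open>Automorphisms that are isomorphisms outside finitely many curves\<close>

text \<open>By unique factorization this is the localization of the polynomial ring at the primes in
  \<open>S\<close>; stating it through orders makes it closed under ring operations without handling
  fractions. Likewise \<open>unit_off\<close> describes the units of that ring.\<close>

definition regular_off :: "poly_yxi set \<Rightarrow> ratfun \<Rightarrow> bool" where
  "regular_off S f \<longleftrightarrow> f = 0 \<or> (\<forall>P. prime P \<longrightarrow> P \<notin> S \<longrightarrow> 0 \<le> ord_curve P f)"

definition unit_off :: "poly_yxi set \<Rightarrow> ratfun \<Rightarrow> bool" where
  "unit_off S f \<longleftrightarrow> f \<noteq> 0 \<and> (\<forall>P. prime P \<longrightarrow> P \<notin> S \<longrightarrow> ord_curve P f = 0)"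

lemma unit_off_regular: "unit_off S f \<Longrightarrow> regular_off S f"
  by (simp add: unit_off_def regular_off_def)

lemma valuation_ord_prime: "prime P \<Longrightarrow> valuation (ord_curve P)"
  using valuation_ord_curve by blast

lemma regular_off_add:
  assumes "regular_off S f" "regular_off S g" shows "regular_off S (f + g)"
proof (cases "f = 0 \<or> g = 0 \<or> f + g = 0")
  case False
  have "0 \<le> ord_curve P (f + g)" if "prime P" "P \<notin> S" for P
    using valuationD_add[OF valuation_ord_prime[OF that(1)], of f g] assms that False
    unfolding regular_off_def by fastforce
  then show ?thesis by (simp add: regular_off_def)
qed (use assms in \<open>auto simp: regular_off_def\<close>)

lemma regular_off_mult:
  assumes "regular_off S f" "regular_off S g" shows "regular_off S (f * g)"
proof (cases "f = 0 \<or> g = 0")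
  case False
  have "0 \<le> ord_curve P (f * g)" if "prime P" "P \<notin> S" for P
    using valuationD_mult[OF valuation_ord_prime[OF that(1)], of f g] assms that False
    unfolding regular_off_def by fastforce
  then show ?thesis by (simp add: regular_off_def)
qed (auto simp: regular_off_def)

lemma unit_off_mult:
  assumes "unit_off S f" "unit_off S g" shows "unit_off S (f * g)"
  using assms valuationD_mult[OF valuation_ord_prime, of _ f g] by (auto simp: unit_off_def)

lemma unit_off_inverse:
  assumes "unit_off S f" shows "unit_off S (inverse f)"
  using assms valuation_inverse[OF valuation_ord_prime, of _ f] by (auto simp: unit_off_def)

lemma unit_off_const: "c \<noteq> 0 \<Longrightarrow> unit_off S (const_fun c)"
  using valuationD_const[OF valuation_ord_prime] by (auto simp: unit_off_def)

lemma unit_off_prime: "prime P \<Longrightarrow> P \<in> S \<Longrightarrow> unit_off S (to_fract P)"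
  by (auto simp: unit_off_def ord_curve_prime)

lemma regular_off_to_fract: "regular_off S (to_fract P)"
  by (simp add: regular_off_def ord_curve_to_fract)

lemma regular_off_const: "regular_off S (const_fun c)"
  by (simp add: const_fun_def regular_off_to_fract)

lemma regular_off_poly_subst:
  assumes "regular_off S Y" "regular_off S X" shows "regular_off S (poly_subst P Y X)"
proof -
  have "regular_off S (coeff_at Y c)" for c
  proof (induction c)
    case 0
    show ?case by (simp add: regular_off_def)
  qed (auto intro!: regular_off_add regular_off_mult regular_off_const assms)
  then show ?thesis
  proof (induction P)
    case 0
    show ?case by (simp add: regular_off_def)
  qed (auto intro!: regular_off_add regular_off_mult assms)
qed

text \<open>\<sigma> and \<tau> restrict to inverse isomorphisms between the polynomial ring
  localized at \<open>S'\<close> and the one localized at \<open>S\<close>. It is enough to test the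
  two generators and the inverted primes.\<close>

definition localizes ::
  "(ratfun \<Rightarrow> ratfun) \<Rightarrow> (ratfun \<Rightarrow> ratfun) \<Rightarrow> poly_yxi set \<Rightarrow> poly_yxi set \<Rightarrow> bool" where
  "localizes \<sigma> \<tau> S S' \<longleftrightarrow> chom \<sigma> \<and> chom \<tau> \<and> (\<forall>f. \<sigma> (\<tau> f) = f) \<and> (\<forall>f. \<tau> (\<sigma> f) = f) \<and>
     regular_off S (\<sigma> y_fun) \<and> regular_off S (\<sigma> xi_fun) \<and>
     regular_off S' (\<tau> y_fun) \<and> regular_off S' (\<tau> xi_fun) \<and>
     (\<forall>Q\<in>S'. prime Q \<and> unit_off S (\<sigma> (to_fract Q))) \<and>
     (\<forall>Q\<in>S. prime Q \<and> unit_off S' (\<tau> (to_fract Q)))"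

lemma localizes_sym: "localizes \<sigma> \<tau> S S' \<Longrightarrow> localizes \<tau> \<sigma> S' S"
  by (auto simp: localizes_def)

lemma localizes_unit:
  assumes L: "localizes \<sigma> \<tau> S S'" and "m \<noteq> 0" and "\<And>P. prime P \<Longrightarrow> P dvd m \<Longrightarrow> P \<in> S'"
  shows "unit_off S (\<sigma> (to_fract m))"
  using assms(2,3)
proof (induction m rule: prime_divisors_induct)
  case (unit m)
  then obtain p where p: "m = [:p:]" "is_unit p" by (auto simp: is_unit_poly_iff)
  then obtain c where "p = [:c:]" "is_unit c" by (auto simp: is_unit_poly_iff)
  moreover from this have "c \<noteq> 0" by auto
  ultimately have "to_fract m = const_fun c" by (simp add: p const_fun_def)
  then show ?case using L \<open>c \<noteq> 0\<close> unit_off_const by (simp add: localizes_def chom_const)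
next
  case (factor P m)
  have "unit_off S (\<sigma> (to_fract P))"
    using factor.prems(2)[OF factor.hyps(1)] L by (simp add: localizes_def)
  moreover have "unit_off S (\<sigma> (to_fract m))"
    using factor.prems by (intro factor.IH) auto
  ultimately show ?case using L by (simp add: localizes_def chom_mult unit_off_mult)
qed simp

lemma localizes_regular_poly:
  assumes "localizes \<sigma> \<tau> S S'" shows "regular_off S (\<sigma> (to_fract P))"
  using assms by (simp add: localizes_def chom_to_fract regular_off_poly_subst)

lemma denom_prime_factor:
  assumes "regular_off S f" "f \<noteq> 0" "prime P" "P dvd denom f" shows "P \<in> S"
proof (rule ccontr)
  assume "P \<notin> S"
  then have "0 \<le> ord_curve P f" using assms by (simp add: regular_off_def)
  moreover have "\<not> P dvd numer f"
    using assms(3,4) numer_denom(3)[of f] by (meson coprime_common_divisor not_prime_unit)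
  then have "multiplicity P (numer f) = 0" by (rule not_dvd_imp_multiplicity_0)
  moreover have "0 < multiplicity P (denom f)"
    using assms(3,4) by (simp add: prime_multiplicity_gt_zero_iff)
  ultimately show False by (simp add: ord_curve_def)
qed

lemma localizes_regular:
  assumes L: "localizes \<sigma> \<tau> S S'" and f: "regular_off S' f"
  shows "regular_off S (\<sigma> f)"
proof (cases "f = 0")
  case False
  have \<sigma>: "chom \<sigma>" using L by (simp add: localizes_def)
  have "unit_off S (\<sigma> (to_fract (denom f)))"
    by (rule localizes_unit[OF L]) (use denom_prime_factor[OF f False] in auto)
  moreover have "\<sigma> f = \<sigma> (to_fract (numer f)) * inverse (\<sigma> (to_fract (denom f)))"
    by (metis \<sigma> chom_divide divide_inverse numer_denom(1))
  ultimately show ?thesis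
    using localizes_regular_poly[OF L] by (simp add: regular_off_mult unit_off_inverse unit_off_regular)
qed (use L in \<open>simp add: localizes_def chom_0 regular_off_def\<close>)

text \<open>An isomorphism of unique factorization domains carries primes to primes up to units.
  Here \<open>Q\<close> is found as a prime factor of the numerator of \<open>\<tau> P\<close> on
  which the pulled-back valuation \<open>w\<close> is positive, and \<open>w\<close> turns out to be
  the order along \<open>Q\<close>.\<close>

lemma localizes_curve:
  assumes L: "localizes \<sigma> \<tau> S S'" and P: "prime P" "P \<notin> S"
  shows "\<exists>Q. prime Q \<and> Q \<notin> S' \<and> (\<forall>f. f \<noteq> 0 \<longrightarrow> ord_curve P (\<sigma> f) = ord_curve Q f)"
proof -
  have \<sigma>: "chom \<sigma>" and \<tau>: "chom \<tau>" and inv: "\<And>f. \<sigma> (\<tau> f) = f" "\<And>f. \<tau> (\<sigma> f) = f"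
    using L by (auto simp: localizes_def)
  have vP: "valuation (ord_curve P)" using P valuation_ord_prime by blast
  define w where "w = (\<lambda>f. ord_curve P (\<sigma> f))"
  have w: "valuation w" unfolding w_def by (rule valuation_comp[OF \<sigma> vP])
  have w_poly: "0 \<le> w (to_fract m)" if "m \<noteq> 0" for m
    using localizes_regular_poly[OF L, of m] P that chom_eq_0_iff[OF \<sigma>]
    by (auto simp: regular_off_def w_def)
  have w_unit: "w (to_fract m) = 0" if "m \<noteq> 0" "\<And>Q. prime Q \<Longrightarrow> Q dvd m \<Longrightarrow> Q \<in> S'" for m
    using localizes_unit[OF L that] P by (auto simp: unit_off_def w_def)
  define g where "g = \<tau> (to_fract P)"
  have g0: "g \<noteq> 0" using P chom_eq_0_iff[OF \<tau>] by (auto simp: g_def)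
  have g_reg: "regular_off S' g"
    unfolding g_def by (rule localizes_regular_poly[OF localizes_sym[OF L]])
  have wg: "w g = 1" using P by (simp add: w_def g_def inv ord_curve_prime)
  have "w (to_fract (denom g)) = 0"
    by (rule w_unit) (use denom_prime_factor[OF g_reg g0] in auto)
  moreover have "w g = w (to_fract (numer g)) - w (to_fract (denom g))"
    using valuation_divide[OF w, of "to_fract (numer g)" "to_fract (denom g)"] g0 by (simp add: numer_denom)
  ultimately have w_numer: "0 < w (to_fract (numer g))" using wg by simp
  have "\<exists>Q. prime Q \<and> Q dvd m \<and> 0 < w (to_fract Q)" if "m \<noteq> 0" "0 < w (to_fract m)" for m
    using that
  proof (induction m rule: prime_divisors_induct)
    case (unit m)
    then have "w (to_fract m) = 0"
      by (intro w_unit) (auto dest: dvd_trans[of _ m 1] not_prime_unit)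
    then show ?case using unit by simp
  next
    case (factor Q m)
    then have "w (to_fract (Q * m)) = w (to_fract Q) + w (to_fract m)"
      using valuationD_mult[OF w, of "to_fract Q" "to_fract m"] by auto
    then consider "0 < w (to_fract Q)" | "0 < w (to_fract m)" using factor.prems by linarith
    then show ?case
      by cases (use factor in \<open>auto intro: dvd_mult\<close>)
  qed simp
  then obtain Q where Q: "prime Q" "Q dvd numer g" "0 < w (to_fract Q)"
    using w_numer g0 numer_eq_0_iff by blast
  have "Q \<notin> S'"
  proof
    assume "Q \<in> S'"
    then have "w (to_fract Q) = 0"
      using Q(1) by (intro w_unit) (auto dest: primes_dvd_imp_eq)
    then show False using Q(3) by simp
  qed
  have vQ: "valuation (ord_curve Q)" using Q valuation_ord_prime by blast
  have Qg: "0 < ord_curve Q g"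
  proof -
    have "\<not> Q dvd denom g"
      using denom_prime_factor[OF g_reg g0 Q(1)] \<open>Q \<notin> S'\<close> by blast
    then have "multiplicity Q (denom g) = 0" by (rule not_dvd_imp_multiplicity_0)
    then show ?thesis using Q g0 by (simp add: ord_curve_def prime_multiplicity_gt_zero_iff)
  qed
  \<comment> \<open>If \<open>w\<close> were positive on \<open>m\<close>, then \<open>P\<close>
    would divide \<open>\<sigma> m\<close> in the localization. Applying \<tau> writes
    \<open>m\<close> as \<open>g\<close> times a function regular along \<open>Q\<close>, and
    \<open>Q\<close> divides \<open>g\<close>; so \<open>Q\<close> would divide
    \<open>m\<close>.\<close>
  have w0: "w (to_fract m) = 0" if m: "m \<noteq> 0" "\<not> Q dvd m" for m
  proof (rule ccontr)
    assume "w (to_fract m) \<noteq> 0"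
    then have pos: "0 < w (to_fract m)" using w_poly[OF m(1)] by linarith
    define r where "r = \<sigma> (to_fract m) / to_fract P"
    have r0: "r \<noteq> 0" using m P chom_eq_0_iff[OF \<sigma>] by (auto simp: r_def)
    have "0 \<le> ord_curve P' r" if "prime P'" "P' \<notin> S" for P'
    proof -
      have "ord_curve P' r = ord_curve P' (\<sigma> (to_fract m)) - ord_curve P' (to_fract P)"
        unfolding r_def using m P chom_eq_0_iff[OF \<sigma>]
        by (intro valuation_divide valuation_ord_prime that) auto
      moreover have "0 \<le> ord_curve P' (\<sigma> (to_fract m))"
        using localizes_regular_poly[OF L, of m] that m chom_eq_0_iff[OF \<sigma>]
        by (auto simp: regular_off_def)
      ultimately show ?thesis using that P pos by (auto simp: ord_curve_prime w_def)
    qed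
    then have "regular_off S r" by (simp add: regular_off_def)
    then have reg: "regular_off S' (\<tau> r)" by (rule localizes_regular[OF localizes_sym[OF L]])
    have "\<sigma> (to_fract m) = to_fract P * r" using P by (auto simp: r_def)
    then have "to_fract m = g * \<tau> r" by (metis \<tau> chom_mult g_def inv(2))
    moreover have "\<tau> r \<noteq> 0" using r0 chom_eq_0_iff[OF \<tau>] by simp
    ultimately have "ord_curve Q (to_fract m) = ord_curve Q g + ord_curve Q (\<tau> r)"
      using valuationD_mult[OF vQ g0] by simp
    moreover have "0 \<le> ord_curve Q (\<tau> r)"
      using reg \<open>\<tau> r \<noteq> 0\<close> Q(1) \<open>Q \<notin> S'\<close> by (simp add: regular_off_def)
    ultimately have "0 < multiplicity Q m" using Qg by (simp add: ord_curve_to_fract)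
    then show False using not_dvd_imp_multiplicity_0[OF m(2)] by simp
  qed
  have w_eq_poly: "w (to_fract m) = int (multiplicity Q m) * w (to_fract Q)" if m: "m \<noteq> 0" for m
  proof -
    obtain n where n: "m = Q ^ multiplicity Q m * n" "\<not> Q dvd n"
      using multiplicity_decompose'[OF m, of Q] Q not_prime_unit by metis
    have "n \<noteq> 0" using n m by auto
    have "to_fract (Q ^ k) = to_fract Q ^ k" for k by (induction k) simp_all
    then have eq: "to_fract m = to_fract Q ^ multiplicity Q m * to_fract n" by (metis n(1) to_fract_mult)
    have "Q \<noteq> 0" using Q by auto
    then show ?thesis
      using \<open>n \<noteq> 0\<close> valuationD_mult[OF w, of "to_fract Q ^ multiplicity Q m" "to_fract n"]
      by (simp add: eq valuation_power[OF w] w0[OF \<open>n \<noteq> 0\<close> n(2)])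
  qed
  have w_eq: "w f = ord_curve Q f * w (to_fract Q)" if "f \<noteq> 0" for f
  proof -
    have "w f = w (to_fract (numer f)) - w (to_fract (denom f))"
      using valuation_divide[OF w, of "to_fract (numer f)" "to_fract (denom f)"] that
      by (simp add: numer_denom)
    then show ?thesis using that by (simp add: w_eq_poly ord_curve_def algebra_simps)
  qed
  \<comment> \<open>So far \<open>w\<close> is a positive multiple of the order along
    \<open>Q\<close>; the value one at \<open>g\<close> forces the factor to be one.\<close>
  then have "ord_curve Q g * w (to_fract Q) = 1" using wg g0 by metis
  then have "w (to_fract Q) = 1" using Q(3) zmult_eq_1_iff by fastforce
  then show ?thesis using Q(1) \<open>Q \<notin> S'\<close> w_eq by (auto simp: w_def)
qed

lemma ord_curve_inj:
  assumes "prime P" "prime Q" "\<And>f. f \<noteq> 0 \<Longrightarrow> ord_curve P f = ord_curve Q f"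
  shows "P = Q"
  using assms(3)[of "to_fract P"] assms(1,2) by (auto simp: ord_curve_prime split: if_splits)


subsection \<open>Isomorphisms of marked surfaces\<close>

text \<open>\<open>\<sigma>\<close> is the pullback of a birational map between the blow-ups of \<open>\<bbbP>\<^sup>1 \<times> \<bbbP>\<^sup>1\<close> in \<open>cs\<close> and in
  \<open>cs'\<close> that maps prime divisors bijectively to prime divisors, as described by \<open>\<beta>\<close>.\<close>

definition divisor_iso ::
  "(nat \<Rightarrow> P1 \<times> P1) \<Rightarrow> (nat \<Rightarrow> P1 \<times> P1) \<Rightarrow> (ratfun \<Rightarrow> ratfun) \<Rightarrow> (pdiv \<Rightarrow> pdiv) \<Rightarrow> bool" where
  "divisor_iso cs cs' \<sigma> \<beta> \<longleftrightarrow> chom \<sigma> \<and> surj \<sigma> \<and> bij \<beta> \<and> (\<forall>D. \<beta> D \<in> prime_divisors \<longleftrightarrow> D \<in> prime_divisors) \<and>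
     (\<forall>D\<in>prime_divisors. \<forall>f. f \<noteq> 0 \<longrightarrow> ord_at cs D (\<sigma> f) = ord_at cs' (\<beta> D) f)"

lemma divisor_iso_comp:
  assumes "divisor_iso cs cs' \<sigma> \<beta>" "divisor_iso cs' cs'' \<sigma>' \<beta>'"
  shows "divisor_iso cs cs'' (\<lambda>f. \<sigma> (\<sigma>' f)) (\<lambda>D. \<beta>' (\<beta> D))"
proof -
  have "surj (\<lambda>f. \<sigma> (\<sigma>' f))" using assms comp_surj[of \<sigma>' \<sigma>] by (simp add: divisor_iso_def comp_def)
  moreover have "bij (\<lambda>D. \<beta>' (\<beta> D))" using assms bij_comp[of \<beta> \<beta>'] by (simp add: divisor_iso_def comp_def)
  moreover have "chom (\<lambda>f. \<sigma> (\<sigma>' f))" using assms chom_comp by (simp add: divisor_iso_def)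
  ultimately show ?thesis using assms by (auto simp: divisor_iso_def chom_eq_0_iff)
qed

definition special_divisors :: "poly_yxi set \<Rightarrow> pdiv set" where
  "special_divisors S = Curve ` S \<union> {Line_y_inf, Line_xi_inf} \<union> Exc ` {1..8}"

text \<open>Only the inverted curves, the two lines at infinity and the exceptional curves need to
  be matched by hand. All other curves are matched by the localization argument, applied to \<sigma>
  and to \<tau>; since a prime is determined by its order function, the two choices are inverse to
  each other.\<close>

lemma divisor_iso_extend:
  assumes L: "localizes \<sigma> \<tau> S S'"
    and \<beta>0: "bij_betw \<beta>0 (special_divisors S) (special_divisors S')"
    and special: "\<And>D f. D \<in> special_divisors S \<Longrightarrow> f \<noteq> 0 \<Longrightarrow> ord_at cs D (\<sigma> f) = ord_at cs' (\<beta>0 D) f"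
  shows "\<exists>\<beta>. divisor_iso cs cs' \<sigma> \<beta> \<and> (\<forall>D\<in>special_divisors S. \<beta> D = \<beta>0 D)"
proof -
  have \<sigma>: "chom \<sigma>" and \<tau>: "chom \<tau>" and inv: "\<And>f. \<sigma> (\<tau> f) = f" "\<And>f. \<tau> (\<sigma> f) = f"
    using L by (auto simp: localizes_def)
  have primes: "\<And>P. P \<in> S \<Longrightarrow> prime P" "\<And>P. P \<in> S' \<Longrightarrow> prime P"
    using L by (auto simp: localizes_def)
  define G where "G = {P. prime P \<and> P \<notin> S}"
  define G' where "G' = {P. prime P \<and> P \<notin> S'}"
  have "\<forall>P. \<exists>Q. P \<in> G \<longrightarrow> Q \<in> G' \<and> (\<forall>f. f \<noteq> 0 \<longrightarrow> ord_curve P (\<sigma> f) = ord_curve Q f)"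
    unfolding G_def G'_def mem_Collect_eq by (meson localizes_curve[OF L])
  from choice[OF this] obtain c
    where c: "\<And>P. P \<in> G \<Longrightarrow> c P \<in> G' \<and> (\<forall>f. f \<noteq> 0 \<longrightarrow> ord_curve P (\<sigma> f) = ord_curve (c P) f)"
    by blast
  have "\<forall>P. \<exists>Q. P \<in> G' \<longrightarrow> Q \<in> G \<and> (\<forall>f. f \<noteq> 0 \<longrightarrow> ord_curve P (\<tau> f) = ord_curve Q f)"
    unfolding G_def G'_def mem_Collect_eq by (meson localizes_curve[OF localizes_sym[OF L]])
  from choice[OF this] obtain c'
    where c': "\<And>P. P \<in> G' \<Longrightarrow> c' P \<in> G \<and> (\<forall>f. f \<noteq> 0 \<longrightarrow> ord_curve P (\<tau> f) = ord_curve (c' P) f)"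
    by blast
  have "c' (c P) = P" if "P \<in> G" for P
  proof (rule ord_curve_inj)
    show "ord_curve (c' (c P)) f = ord_curve P f" if "f \<noteq> 0" for f
      using c[OF \<open>P \<in> G\<close>] c'[of "c P"] that chom_eq_0_iff[OF \<tau>] by (metis inv(1))
  qed (use c[OF that] c'[of "c P"] that in \<open>auto simp: G_def\<close>)
  moreover have "c (c' P) = P" if "P \<in> G'" for P
  proof (rule ord_curve_inj)
    show "ord_curve (c (c' P)) f = ord_curve P f" if "f \<noteq> 0" for f
      using c'[OF \<open>P \<in> G'\<close>] c[of "c' P"] that chom_eq_0_iff[OF \<sigma>] by (metis inv(2))
  qed (use c'[OF that] c[of "c' P"] that in \<open>auto simp: G'_def\<close>)
  ultimately have bij_c: "bij_betw c G G'"
    using c c' by (intro bij_betw_byWitness[where f' = c']) auto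
  \<comment> \<open>Outside the prime divisors \<beta> is the identity, so it is a bijection of the
    whole type, which is convenient for relabelling divisors.\<close>
  define \<beta> where "\<beta> D = (if D \<in> special_divisors S then \<beta>0 D else if D \<in> Curve ` G
      then (case D of Curve P \<Rightarrow> Curve (c P) | _ \<Rightarrow> D) else D)" for D
  have pd: "prime_divisors = special_divisors S \<union> Curve ` G" "prime_divisors = special_divisors S' \<union> Curve ` G'"
    using primes by (auto simp: prime_divisors_def special_divisors_def G_def G'_def)
  have disj: "special_divisors S \<inter> Curve ` G = {}" "special_divisors S' \<inter> Curve ` G' = {}"
    by (auto simp: special_divisors_def G_def G'_def)
  have \<beta>1: "\<beta> D = \<beta>0 D" if "D \<in> special_divisors S" for D using that by (simp add: \<beta>_def)
  have \<beta>2: "\<beta> (Curve P) = Curve (c P)" if "P \<in> G" for P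
    using that disj(1) by (auto simp: \<beta>_def)
  have \<beta>3: "\<beta> D = D" if "D \<notin> prime_divisors" for D using that pd by (auto simp: \<beta>_def)
  have b1: "bij_betw \<beta> (special_divisors S) (special_divisors S')"
    using \<beta>0 bij_betw_cong[of "special_divisors S" \<beta> \<beta>0] \<beta>1 by blast
  have b2: "bij_betw \<beta> (Curve ` G) (Curve ` G')"
  proof (rule bij_betw_imageI)
    show "inj_on \<beta> (Curve ` G)"
      using bij_c by (auto simp: inj_on_def \<beta>2 bij_betw_def)
    have "\<beta> ` Curve ` G = Curve ` c ` G" by (force simp: \<beta>2 image_image)
    then show "\<beta> ` Curve ` G = Curve ` G'" using bij_c by (simp add: bij_betw_def)
  qed
  have b3: "bij_betw \<beta> prime_divisors prime_divisors"
    using bij_betw_combine[OF b1 b2 disj(2)] pd by simp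
  have b4: "bij_betw \<beta> (- prime_divisors) (- prime_divisors)"
    using bij_betw_cong[of "- prime_divisors" \<beta> id] \<beta>3 by simp
  have "bij_betw \<beta> (prime_divisors \<union> - prime_divisors) (prime_divisors \<union> - prime_divisors)"
    using bij_betw_combine[OF b3 b4] by simp
  then have "bij \<beta>" by simp
  moreover have "\<beta> D \<in> prime_divisors \<longleftrightarrow> D \<in> prime_divisors" for D
    using b3 \<beta>3[of D] by (metis bij_betwE)
  moreover have "surj \<sigma>" using inv(1) by (metis surjI)
  moreover have "ord_at cs D (\<sigma> f) = ord_at cs' (\<beta> D) f" if D: "D \<in> prime_divisors" and f: "f \<noteq> 0" for D f
  proof (cases "D \<in> special_divisors S")
    case True
    then show ?thesis using special f by (simp add: \<beta>1)
  next
    case False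
    then obtain P where "D = Curve P" "P \<in> G" using D pd(1) by blast
    then show ?thesis using c f by (simp add: \<beta>2)
  qed
  ultimately show ?thesis using \<sigma> \<beta>1 by (intro exI[of _ \<beta>]) (simp add: divisor_iso_def)
qed

subsection \<open>Residues along a divisor\<close>

text \<open>The residue of \<open>f\<close> along the divisor of \<open>v\<close> is the rational function \<open>N / M\<close> of \<open>t\<close>.\<close>

definition positive_along :: "(ratfun \<Rightarrow> int) \<Rightarrow> ratfun \<Rightarrow> bool" where
  "positive_along v f \<longleftrightarrow> f = 0 \<or> 0 < v f"

definition nonneg_along :: "(ratfun \<Rightarrow> int) \<Rightarrow> ratfun \<Rightarrow> bool" where
  "nonneg_along v f \<longleftrightarrow> f = 0 \<or> 0 \<le> v f"

definition has_residue ::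
  "(ratfun \<Rightarrow> int) \<Rightarrow> ratfun \<Rightarrow> ratfun \<Rightarrow> complex poly \<Rightarrow> complex poly \<Rightarrow> bool" where
  "has_residue v t f N M \<longleftrightarrow> M \<noteq> 0 \<and> positive_along v (f * coeff_at t M - coeff_at t N)"

lemma positive_add: "valuation v \<Longrightarrow> positive_along v f \<Longrightarrow> positive_along v g \<Longrightarrow> positive_along v (f + g)"
  using valuationD_add[of v f g]
  by (cases "f = 0 \<or> g = 0 \<or> f + g = 0") (auto simp: positive_along_def min_def split: if_splits)

lemma nonneg_add: "valuation v \<Longrightarrow> nonneg_along v f \<Longrightarrow> nonneg_along v g \<Longrightarrow> nonneg_along v (f + g)"
  using valuationD_add[of v f g]
  by (cases "f = 0 \<or> g = 0 \<or> f + g = 0") (auto simp: nonneg_along_def min_def split: if_splits)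

lemma positive_mult: "valuation v \<Longrightarrow> positive_along v f \<Longrightarrow> nonneg_along v g \<Longrightarrow> positive_along v (f * g)"
  using valuationD_mult[of v f g] by (cases "f = 0 \<or> g = 0") (auto simp: positive_along_def nonneg_along_def)

lemma positive_nonneg: "positive_along v f \<Longrightarrow> nonneg_along v f"
  by (auto simp: positive_along_def nonneg_along_def)

lemma nonneg_coeff_at: "transversal v s t \<Longrightarrow> nonneg_along v (coeff_at t M)"
  using transversal_coeff_at[of v s t M] by (cases "M = 0") (auto simp: nonneg_along_def)

lemma transversal_valuation: "transversal v s t \<Longrightarrow> valuation v"
  by (simp add: transversal_def)

lemma residue_t: "has_residue v t t [:0, 1:] 1"
  by (simp add: has_residue_def positive_along_def)

lemma residue_const: "has_residue v t (const_fun c) [:c:] 1"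
  by (simp add: has_residue_def positive_along_def)

lemma residue_1: "has_residue v t 1 1 1"
  by (simp add: has_residue_def positive_along_def)

lemma residue_s: "transversal v s t \<Longrightarrow> has_residue v t s 0 1"
  by (simp add: has_residue_def positive_along_def transversal_def)

lemma residue_add:
  assumes tr: "transversal v s t" and "has_residue v t f N M" "has_residue v t g N' M'"
  shows "has_residue v t (f + g) (N * M' + N' * M) (M * M')"
proof -
  have "positive_along v ((f * coeff_at t M - coeff_at t N) * coeff_at t M' + (g * coeff_at t M' - coeff_at t N') * coeff_at t M)"
    using assms transversal_valuation[OF tr] nonneg_coeff_at[OF tr]
    by (intro positive_add positive_mult) (auto simp: has_residue_def)
  then show ?thesis using assms by (simp add: has_residue_def algebra_simps)
qed

lemma residue_mult:
  assumes tr: "transversal v s t" and "has_residue v t f N M" "has_residue v t g N' M'"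
  shows "has_residue v t (f * g) (N * N') (M * M')"
proof -
  note v = transversal_valuation[OF tr] and nn = nonneg_coeff_at[OF tr]
  have "nonneg_along v ((g * coeff_at t M' - coeff_at t N') + coeff_at t N')"
    using assms by (intro nonneg_add[OF v positive_nonneg nn]) (auto simp: has_residue_def)
  then have "nonneg_along v (g * coeff_at t M')" by simp
  then have "positive_along v ((f * coeff_at t M - coeff_at t N) * (g * coeff_at t M') + (g * coeff_at t M' - coeff_at t N') * coeff_at t N)"
    using assms v nn by (intro positive_add positive_mult) (auto simp: has_residue_def)
  then show ?thesis using assms by (simp add: has_residue_def algebra_simps)
qed

lemma residue_uminus:
  assumes tr: "transversal v s t" and "has_residue v t f N M"
  shows "has_residue v t (- f) (- N) M"
  using residue_mult[OF tr residue_const[of v t "-1"] assms(2)] by (simp add: const_fun_minus)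

lemma residue_diff:
  assumes tr: "transversal v s t" and "has_residue v t f N M" "has_residue v t g N' M'"
  shows "has_residue v t (f - g) (N * M' - N' * M) (M * M')"
  using residue_add[OF tr assms(2) residue_uminus[OF tr assms(3)]] by simp

lemma residue_unit:
  assumes tr: "transversal v s t" and r: "has_residue v t f N M" and "N \<noteq> 0"
  shows "f \<noteq> 0" "v f = 0"
proof -
  note v = transversal_valuation[OF tr]
  have N: "coeff_at t N \<noteq> 0" "v (coeff_at t N) = 0" using transversal_coeff_at[OF tr \<open>N \<noteq> 0\<close>] by auto
  have M: "coeff_at t M \<noteq> 0" "v (coeff_at t M) = 0"
    using transversal_coeff_at[OF tr, of M] r by (auto simp: has_residue_def)
  have "f * coeff_at t M - coeff_at t N = 0 \<or> v (coeff_at t N) < v (f * coeff_at t M - coeff_at t N)"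
    using r N by (auto simp: has_residue_def positive_along_def)
  from valuation_dominant[OF v N(1) this] have "f * coeff_at t M \<noteq> 0" "v (f * coeff_at t M) = 0"
    using N by simp_all
  then show "f \<noteq> 0" "v f = 0" using M valuationD_mult[OF v, of f "coeff_at t M"] by auto
qed

lemma residue_inverse:
  assumes tr: "transversal v s t" and r: "has_residue v t f N M" and "N \<noteq> 0"
  shows "has_residue v t (inverse f) M N"
proof -
  note v = transversal_valuation[OF tr] and u = residue_unit[OF assms]
  have "nonneg_along v (- inverse f)"
    using u by (simp add: nonneg_along_def valuation_uminus[OF v] valuation_inverse[OF v])
  then have "positive_along v ((f * coeff_at t M - coeff_at t N) * (- inverse f))"
    using r by (intro positive_mult v) (auto simp: has_residue_def)
  moreover have "(f * coeff_at t M - coeff_at t N) * (- inverse f) = inverse f * coeff_at t N - coeff_at t M"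
    using u by (simp add: field_simps)
  ultimately show ?thesis using \<open>N \<noteq> 0\<close> by (simp add: has_residue_def)
qed

lemma residue_divide:
  assumes tr: "transversal v s t" and "has_residue v t f N M" "has_residue v t g N' M'" and "N' \<noteq> 0"
  shows "has_residue v t (f / g) (N * M') (M * N')"
  unfolding divide_inverse by (intro residue_mult[OF tr] residue_inverse[OF tr] assms)

text \<open>The criterion behind all local computations: a nonzero residue of \<open>u\<close> keeps
  \<open>s * u\<close> a uniformizer, and \<open>t1\<close> is a coordinate as soon as its residue
  \<open>N1 / M1\<close> is not constant.\<close>

lemma transversal_residue:
  assumes tr: "transversal v s t" and "has_residue v t u N M" and "has_residue v t t1 N1 M1"
    and "N \<noteq> 0" and "\<And>c. N1 \<noteq> smult c M1"
  shows "transversal v (s * u) t1"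
  unfolding transversal_def
proof (intro conjI allI)
  note v = transversal_valuation[OF tr] and u = residue_unit[OF tr assms(2,4)]
  show "valuation v" by (fact v)
  show "s * u \<noteq> 0" using tr u by (simp add: transversal_def)
  show "v (s * u) = 1" using tr u by (simp add: transversal_def valuationD_mult)
  fix c
  have "has_residue v t (t1 - const_fun c) (N1 * 1 - [:c:] * M1) (M1 * 1)"
    by (intro residue_diff[OF tr] assms residue_const)
  moreover have "N1 * 1 - [:c:] * M1 \<noteq> 0" using assms(5)[of c] by simp
  ultimately show "t1 - const_fun c \<noteq> 0" "v (t1 - const_fun c) = 0"
    using residue_unit[OF tr] by blast+
qed

lemma chart_match:
  assumes "chart cs D s t" "chart cs' D' s' t'" "chom \<sigma>"
    and "\<And>v. transversal v s t \<Longrightarrow> transversal v (\<sigma> s') (\<sigma> t')" and "f \<noteq> 0"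
  shows "ord_at cs D (\<sigma> f) = ord_at cs' D' f"
  using assms chartD by blast

text \<open>Items 1 and 4 to 11 are the changes of local coordinates met by twists, items 2, 3, 12
  and 13 those met by rotations. The residue rules synthesise the numerators and denominators,
  leaving only inequalities between polynomials in one variable.\<close>

lemma transversal_change:
  assumes tr: "transversal v s t"
  shows "a \<noteq> b \<Longrightarrow> transversal v (s * ((t - const_fun a) / (t - const_fun b))) t"
    and "k \<noteq> 0 \<Longrightarrow> transversal v (s * const_fun k) t"
    and "k \<noteq> 0 \<Longrightarrow> transversal v s (const_fun k / t)"
    and "k \<noteq> 0 \<Longrightarrow> transversal v (s * t) ((s * t + const_fun k) / t)"
    and "k \<noteq> 0 \<Longrightarrow> transversal v (s * t) (t / (s * t + const_fun k))"
    and "k \<noteq> 0 \<Longrightarrow> transversal v (s * (1 / (t * (s + const_fun k)))) (t * (s + const_fun k))"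
    and "k \<noteq> 0 \<Longrightarrow> transversal v (s * (t / (s + const_fun k))) ((s + const_fun k) / t)"
    and "transversal v s (t * ((1 - const_fun a * s) / (1 - const_fun b * s)))"
    and "p \<noteq> 0 \<Longrightarrow> r \<noteq> 0 \<Longrightarrow> transversal v (s * ((s * t + const_fun p + const_fun k * t) / (s * t + const_fun r)))
           (t / ((s * t + const_fun p + const_fun k * t) / (s * t + const_fun r)))"
    and "transversal v (s * ((1 - const_fun a * (s * t) + const_fun k * t) / (1 - const_fun b * (s * t))))
           (t / ((1 - const_fun a * (s * t) + const_fun k * t) / (1 - const_fun b * (s * t))))"
    and "p \<noteq> 0 \<Longrightarrow> r \<noteq> 0 \<Longrightarrow> transversal v (s * ((s * t + const_fun r) / (s * t + const_fun p)))
           (t * ((s * t + const_fun p) / (s * t + const_fun r)))"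
    and "k \<noteq> 0 \<Longrightarrow> transversal v (s * t) (const_fun k / t)"
    and "c \<noteq> 0 \<Longrightarrow> k \<noteq> 0 \<Longrightarrow> transversal v (s * t) (const_fun k / (s + const_fun c) / t)"
proof -
  note R = residue_s[OF tr] residue_t residue_const residue_1 residue_divide[OF tr] residue_diff[OF tr]
    residue_add[OF tr] residue_mult[OF tr]
  note T = transversal_residue[OF tr]
  show "transversal v (s * ((t - const_fun a) / (t - const_fun b))) t" if "a \<noteq> b"
    by (rule T) (rule R | (use that in \<open>auto; fail\<close>))+
  show "transversal v (s * const_fun k) t" if "k \<noteq> 0"
    by (rule T) (rule R | (use that in \<open>auto; fail\<close>))+
  \<comment> \<open>The criterion expects a product in the first place, so a factor 1 is inserted
    and simplified away afterwards.\<close>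
  have "transversal v (s * 1) (const_fun k / t)" if "k \<noteq> 0"
    by (rule T) (rule R | (use that in \<open>auto; fail\<close>))+
  then show "transversal v s (const_fun k / t)" if "k \<noteq> 0" using that by simp
  show "transversal v (s * t) ((s * t + const_fun k) / t)" if "k \<noteq> 0"
    by (rule T) (rule R | (use that in \<open>auto; fail\<close>))+
  show "transversal v (s * t) (t / (s * t + const_fun k))" if "k \<noteq> 0"
    by (rule T) (rule R | (use that in \<open>auto; fail\<close>))+
  show "transversal v (s * (1 / (t * (s + const_fun k)))) (t * (s + const_fun k))" if "k \<noteq> 0"
    by (rule T) (rule R | (use that in \<open>auto; fail\<close>))+
  show "transversal v (s * (t / (s + const_fun k))) ((s + const_fun k) / t)" if "k \<noteq> 0"
    by (rule T) (rule R | (use that in \<open>auto; fail\<close>))+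
  have "transversal v (s * 1) (t * ((1 - const_fun a * s) / (1 - const_fun b * s)))"
    by (rule T) (rule R | (auto; fail))+
  then show "transversal v s (t * ((1 - const_fun a * s) / (1 - const_fun b * s)))" by simp
  show "transversal v (s * ((s * t + const_fun p + const_fun k * t) / (s * t + const_fun r)))
           (t / ((s * t + const_fun p + const_fun k * t) / (s * t + const_fun r)))" if "p \<noteq> 0" "r \<noteq> 0"
    by (rule T) (rule R | (use that in \<open>auto; fail\<close>))+
  show "transversal v (s * ((1 - const_fun a * (s * t) + const_fun k * t) / (1 - const_fun b * (s * t))))
           (t / ((1 - const_fun a * (s * t) + const_fun k * t) / (1 - const_fun b * (s * t))))"
    by (rule T) (rule R | (auto simp: one_pCons; fail))+
  show "transversal v (s * ((s * t + const_fun r) / (s * t + const_fun p)))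
           (t * ((s * t + const_fun p) / (s * t + const_fun r)))" if "p \<noteq> 0" "r \<noteq> 0"
    by (rule T) (rule R | (use that in \<open>auto; fail\<close>))+
  show "transversal v (s * t) (const_fun k / t)" if "k \<noteq> 0"
    by (rule T) (rule R | (use that in \<open>auto; fail\<close>))+
  show "transversal v (s * t) (const_fun k / (s + const_fun c) / t)" if "c \<noteq> 0" "k \<noteq> 0"
    by (rule T) (rule R | (use that in \<open>auto; fail\<close>))+
qed


subsection \<open>Elementary transformations\<close>

text \<open>The factor \<open>(\<xi> - a) / (\<xi> - b)\<close> equals 1 at
  \<open>\<xi> = \<infinity>\<close>, and \<open>y = \<infinity>\<close> stays infinite. The formula
  is meant for points off the rows \<open>\<xi> = a\<close> and \<open>\<xi> = b\<close>, whose
  marked points are exchanged with contracted lines.\<close>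

fun twist_point :: "complex \<Rightarrow> complex \<Rightarrow> P1 \<times> P1 \<Rightarrow> P1 \<times> P1" where
  "twist_point a b (Fin c, Fin d) = (Fin (c * (d - a) / (d - b)), Fin d)"
| "twist_point a b (Fin c, Infty) = (Fin c, Infty)"
| "twist_point a b (Infty, B) = (Infty, B)"

lemma ex_twist:
  assumes "a \<noteq> b"
  shows "\<exists>\<sigma>. chom \<sigma> \<and> \<sigma> y_fun = y_fun * ((xi_fun - const_fun a) / (xi_fun - const_fun b)) \<and> \<sigma> xi_fun = xi_fun"
proof -
  have "transversal (ord_curve (line_y 0)) ((y_fun - const_fun 0) * ((xi_fun - const_fun a) / (xi_fun - const_fun b))) xi_fun"
    by (rule transversal_change(1)[OF transversal_lines(1) assms])
  from transversal_chom[OF this] show ?thesis by auto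
qed

text \<open>The inverse twist exchanges \<open>a\<close> and \<open>b\<close>. Both maps fix
  \<open>\<xi>\<close>, hence the two inverted primes, and their only denominators are these
  primes.\<close>

lemma twist_localizes:
  assumes "a \<noteq> b" and \<sigma>: "chom \<sigma>" "\<sigma> y_fun = y_fun * ((xi_fun - const_fun a) / (xi_fun - const_fun b))" "\<sigma> xi_fun = xi_fun"
  shows "\<exists>\<tau>. localizes \<sigma> \<tau> {line_xi a, line_xi b} {line_xi a, line_xi b}"
proof -
  obtain \<tau> where \<tau>: "chom \<tau>" "\<tau> y_fun = y_fun * ((xi_fun - const_fun b) / (xi_fun - const_fun a))" "\<tau> xi_fun = xi_fun"
    using ex_twist[of b a] assms(1) by auto
  let ?S = "{line_xi a, line_xi b}"
  have 1: "\<sigma> (\<tau> f) = f" for f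
    by (rule chom_eqI[OF chom_comp[OF \<sigma>(1) \<tau>(1)] chom_id]) (simp_all add: \<sigma> \<tau> chom_simps)
  have 2: "\<tau> (\<sigma> f) = f" for f
    by (rule chom_eqI[OF chom_comp[OF \<tau>(1) \<sigma>(1)] chom_id]) (simp_all add: \<sigma> \<tau> chom_simps)
  have u: "unit_off ?S (xi_fun - const_fun c)" if "c \<in> {a, b}" for c
    using unit_off_prime[OF prime_line_xi, of c ?S] that by (auto simp: to_fract_line_xi)
  have xi: "regular_off ?S xi_fun" and y: "regular_off ?S y_fun"
    using regular_off_to_fract[of ?S xi_poly] regular_off_to_fract[of ?S y_poly]
    by (simp_all add: xi_fun_def y_fun_def)
  have s: "regular_off ?S (\<sigma> y_fun)" "regular_off ?S (\<tau> y_fun)"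
    unfolding \<sigma> \<tau> divide_inverse
    by (intro regular_off_mult y unit_off_regular unit_off_mult unit_off_inverse u; simp)+
  have "\<sigma> (to_fract (line_xi c)) = xi_fun - const_fun c" "\<tau> (to_fract (line_xi c)) = xi_fun - const_fun c" for c
    by (simp_all add: to_fract_line_xi \<sigma> \<tau> chom_simps)
  then have "localizes \<sigma> \<tau> ?S ?S"
    unfolding localizes_def using \<sigma> \<tau> 1 2 s xi u prime_line_xi by auto
  then show ?thesis by blast
qed

lemma chart_exc_at:
  "cs k = (A, B) \<Longrightarrow> chart cs (Exc k) (local_parameter A y_fun) (local_parameter B xi_fun / local_parameter A y_fun)"
  using chart_exc[of cs k] by simp

lemmas [simp] = xi_minus_neq_0 y_minus_neq_0

text \<open>The exceptional curve consists of the directions at the point, so the linear part of the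
  twist decides: the residue of the new slope is a non-constant Moebius function of the residue of
  the old one.\<close>

lemma twist_exc_match:
  assumes "a \<noteq> b" and \<sigma>: "chom \<sigma>" "\<sigma> y_fun = y_fun * ((xi_fun - const_fun a) / (xi_fun - const_fun b))" "\<sigma> xi_fun = xi_fun"
    and j: "snd (cs j) \<notin> {Fin a, Fin b}" "cs j \<noteq> (Infty, Infty)" "cs' j = twist_point a b (cs j)" and f: "f \<noteq> 0"
  shows "ord_at cs (Exc j) (\<sigma> f) = ord_at cs' (Exc j) f"
proof -
  consider c d where "cs j = (Fin c, Fin d)" | c where "cs j = (Fin c, Infty)" | d where "cs j = (Infty, Fin d)"
    using j(2) by (metis P1.exhaust surj_pair)
  then show ?thesis
  proof cases
    case 1
    have p: "d - a \<noteq> 0" "d - b \<noteq> 0" using 1 j by auto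
    define c' where "c' = c * (d - a) / (d - b)"
    have cs': "cs' j = (Fin c', Fin d)" using 1 j by (simp add: c'_def)
    let ?s = "y_fun - const_fun c" and ?t = "(xi_fun - const_fun d) / (y_fun - const_fun c)"
    \<comment> \<open>\<open>?U\<close> is the quotient of the new uniformizer by the old one. The
      coefficient of \<open>?t\<close> is \<open>d - b\<close> times the derivative of
      \<open>c (\<xi> - a) / (\<xi> - b)\<close> at \<open>\<xi> = d\<close>.\<close>
    let ?U = "(?s * ?t + const_fun (d - a) + const_fun (c * (a - b) / (d - b)) * ?t) / (?s * ?t + const_fun (d - b))"
    have st: "?s * ?t = xi_fun - const_fun d" by simp
    have p': "const_fun d - const_fun b \<noteq> 0" using p by simp
    have eq1: "\<sigma> (y_fun - const_fun c') = ?s * ?U"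
    proof -
      have "?s * (?s * ?t + const_fun (d - a) + const_fun (c * (a - b) / (d - b)) * ?t) =
          ?s * (?s * ?t + const_fun (d - a)) + const_fun (c * (a - b) / (d - b)) * (?s * ?t)"
        by (simp only: distrib_left mult.left_commute)
      also have "\<dots> = ?s * (xi_fun - const_fun a) + const_fun (c * (a - b) / (d - b)) * (xi_fun - const_fun d)"
        unfolding st by (simp add: const_fun_diff)
      finally have "?s * (?s * ?t + const_fun (d - a) + const_fun (c * (a - b) / (d - b)) * ?t) = \<dots>" .
      then have "?s * ?U = (?s * (xi_fun - const_fun a) + const_fun (c * (a - b) / (d - b)) * (xi_fun - const_fun d)) / (xi_fun - const_fun b)"
        unfolding st times_divide_eq_right by (simp add: const_fun_diff)
      also have "\<dots> = y_fun * ((xi_fun - const_fun a) / (xi_fun - const_fun b)) - const_fun c'"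
        using p' unfolding c'_def const_fun_diff const_fun_mult const_fun_divide
        by (simp add: divide_simps) (simp add: algebra_simps)
      finally show ?thesis by (simp add: \<sigma> chom_simps)
    qed
    have eq2: "\<sigma> ((xi_fun - const_fun d) / (y_fun - const_fun c')) = ?t / ?U"
      using eq1 by (simp add: \<sigma> chom_simps)
    show ?thesis
    proof (rule chart_match[OF _ _ \<sigma>(1) _ f])
      show "chart cs (Exc j) ?s ?t" using chart_exc_at[of cs j, OF 1] by simp
      show "chart cs' (Exc j) (y_fun - const_fun c') ((xi_fun - const_fun d) / (y_fun - const_fun c'))"
        using chart_exc_at[of cs' j, OF cs'] by simp
    qed (simp only: eq1 eq2, rule transversal_change(9)[OF _ p])
  next
    case 2
    have cs': "cs' j = (Fin c, Infty)" using 2 j by simp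
    let ?s = "y_fun - const_fun c" and ?t = "1 / xi_fun / (y_fun - const_fun c)"
    \<comment> \<open>The same expansion in the parameter \<open>1 / \<xi>\<close>, in which the
      twisting factor is \<open>1 + (b - a) / \<xi>\<close> to first order.\<close>
    let ?U = "(1 - const_fun a * (?s * ?t) + const_fun (c * (b - a)) * ?t) / (1 - const_fun b * (?s * ?t))"
    have st: "?s * ?t = 1 / xi_fun" by simp
    have eq1: "\<sigma> (y_fun - const_fun c) = ?s * ?U"
    proof -
      have "?s * (1 - const_fun a * (?s * ?t) + const_fun (c * (b - a)) * ?t) =
          ?s * (1 - const_fun a * (?s * ?t)) + const_fun (c * (b - a)) * (?s * ?t)"
        by (simp only: distrib_left mult.left_commute)
      also have "\<dots> = (?s * (xi_fun - const_fun a) + const_fun (c * (b - a))) / xi_fun"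
        unfolding st by (simp add: field_simps)
      finally have "?s * ?U = ((?s * (xi_fun - const_fun a) + const_fun (c * (b - a))) / xi_fun) / (1 - const_fun b * (1 / xi_fun))"
        unfolding st times_divide_eq_right by simp
      also have "1 - const_fun b * (1 / xi_fun) = (xi_fun - const_fun b) / xi_fun"
        by (simp add: field_simps)
      also have "((?s * (xi_fun - const_fun a) + const_fun (c * (b - a))) / xi_fun) / ((xi_fun - const_fun b) / xi_fun)
          = y_fun * ((xi_fun - const_fun a) / (xi_fun - const_fun b)) - const_fun c"
        unfolding const_fun_diff const_fun_mult
        by (simp add: divide_simps) (simp add: algebra_simps)
      finally show ?thesis by (simp add: \<sigma> chom_simps)
    qed
    have eq2: "\<sigma> (1 / xi_fun / (y_fun - const_fun c)) = ?t / ?U"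
      using eq1 by (simp add: \<sigma> chom_simps)
    show ?thesis
    proof (rule chart_match[OF _ _ \<sigma>(1) _ f])
      show "chart cs (Exc j) ?s ?t" using chart_exc_at[of cs j, OF 2] by simp
      show "chart cs' (Exc j) (y_fun - const_fun c) (1 / xi_fun / (y_fun - const_fun c))"
        using chart_exc_at[of cs' j, OF cs'] by simp
    qed (simp only: eq1 eq2, rule transversal_change(10))
  next
    case 3
    have p: "d - a \<noteq> 0" "d - b \<noteq> 0" using 3 j by auto
    have cs': "cs' j = (Infty, Fin d)" using 3 j by simp
    let ?s = "1 / y_fun" and ?t = "(xi_fun - const_fun d) / (1 / y_fun)"
    have st: "?s * ?t + const_fun (d - e) = xi_fun - const_fun e" for e by (simp add: const_fun_diff)
    have eq: "\<sigma> (1 / y_fun) = ?s * ((?s * ?t + const_fun (d - b)) / (?s * ?t + const_fun (d - a)))"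
       "\<sigma> ((xi_fun - const_fun d) / (1 / y_fun)) = ?t * ((?s * ?t + const_fun (d - a)) / (?s * ?t + const_fun (d - b)))"
      unfolding st by (simp_all add: \<sigma> chom_simps)
    show ?thesis
    proof (rule chart_match[OF _ _ \<sigma>(1) _ f])
      show "chart cs (Exc j) ?s ?t" using chart_exc_at[of cs j, OF 3] by simp
      show "chart cs' (Exc j) (1 / y_fun) ((xi_fun - const_fun d) / (1 / y_fun))"
        using chart_exc_at[of cs' j, OF cs'] by simp
    qed (simp only: eq, rule transversal_change(11)[OF _ p])
  qed
qed

text \<open>The line \<open>\<xi> = b\<close> is contracted to \<open>(\<infinity>, b)\<close> while
  the exceptional curve over \<open>(0, b)\<close> opens up to become that line; the same happens
  for \<open>a\<close> with \<open>0\<close> and \<open>\<infinity>\<close> interchanged. This is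
  why the labels \<open>k\<close> and \<open>l\<close> change their centres.\<close>

lemma twist_step:
  assumes ab: "a \<noteq> b" and kl: "k \<in> {1..8}" "l \<in> {1..8}" "k \<noteq> l"
    and k: "cs k = (Fin 0, Fin b)" "cs' k = (Infty, Fin b)"
    and l: "cs l = (Infty, Fin a)" "cs' l = (Fin 0, Fin a)"
    and others: "\<And>j. j \<in> {1..8} \<Longrightarrow> j \<noteq> k \<Longrightarrow> j \<noteq> l \<Longrightarrow>
      snd (cs j) \<notin> {Fin a, Fin b} \<and> cs j \<noteq> (Infty, Infty) \<and> cs' j = twist_point a b (cs j)"
  obtains \<sigma> \<beta> where "divisor_iso cs cs' \<sigma> \<beta>"
    "\<sigma> y_fun = y_fun * ((xi_fun - const_fun a) / (xi_fun - const_fun b))" "\<sigma> xi_fun = xi_fun"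
    "\<beta> (Exc k) = Curve (line_xi b)" "\<beta> (Exc l) = Curve (line_xi a)"
    "\<And>j. j \<in> {1..8} \<Longrightarrow> j \<noteq> k \<Longrightarrow> j \<noteq> l \<Longrightarrow> \<beta> (Exc j) = Exc j"
    "\<beta> Line_y_inf = Line_y_inf" "\<beta> Line_xi_inf = Line_xi_inf"
proof -
  obtain \<sigma> where \<sigma>: "chom \<sigma>" "\<sigma> y_fun = y_fun * ((xi_fun - const_fun a) / (xi_fun - const_fun b))" "\<sigma> xi_fun = xi_fun"
    using ex_twist[OF ab] by blast
  let ?S = "{line_xi a, line_xi b}"
  obtain \<tau> where \<tau>: "localizes \<sigma> \<tau> ?S ?S" using twist_localizes[OF ab \<sigma>] by blast
  \<comment> \<open>With the labels reused on the target, the correspondence of special divisors is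
    an involution, which proves bijectivity below.\<close>
  define \<beta>0 where "\<beta>0 = id(Exc k := Curve (line_xi b), Curve (line_xi b) := Exc k,
    Exc l := Curve (line_xi a), Curve (line_xi a) := Exc l)"
  have lab: "line_xi a \<noteq> line_xi b" using ab by (simp add: line_neq)
  have \<beta>0: "\<beta>0 (Exc k) = Curve (line_xi b)" "\<beta>0 (Exc l) = Curve (line_xi a)"
    "\<beta>0 (Curve (line_xi b)) = Exc k" "\<beta>0 (Curve (line_xi a)) = Exc l"
    "\<beta>0 Line_y_inf = Line_y_inf" "\<beta>0 Line_xi_inf = Line_xi_inf"
    "\<And>j. j \<noteq> k \<Longrightarrow> j \<noteq> l \<Longrightarrow> \<beta>0 (Exc j) = Exc j"
    using kl lab by (auto simp: \<beta>0_def)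
  have sp: "D \<in> {Curve (line_xi a), Curve (line_xi b), Line_y_inf, Line_xi_inf, Exc k, Exc l} \<union> Exc ` ({1..8} - {k, l})"
    if "D \<in> special_divisors ?S" for D
    using that by (auto simp: special_divisors_def)
  have inv: "\<beta>0 (\<beta>0 D) = D \<and> \<beta>0 D \<in> special_divisors ?S" if "D \<in> special_divisors ?S" for D
    using sp[OF that] kl by (auto simp: \<beta>0 special_divisors_def)
  have "bij_betw \<beta>0 (special_divisors ?S) (special_divisors ?S)"
    by (rule bij_betw_byWitness[where f' = \<beta>0]) (use inv in auto)
  moreover have "ord_at cs D (\<sigma> f) = ord_at cs' (\<beta>0 D) f"
    if D: "D \<in> special_divisors ?S" and f: "f \<noteq> 0" for D f
  proof -
    have ab': "a - b \<noteq> 0" "b - a \<noteq> 0" using ab by auto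
    consider "D = Exc k" | "D = Curve (line_xi b)" | "D = Exc l" | "D = Curve (line_xi a)"
      | "D = Line_y_inf" | "D = Line_xi_inf" | j where "D = Exc j" "j \<in> {1..8}" "j \<noteq> k" "j \<noteq> l"
      using sp[OF D] by blast
    then show ?thesis
    proof cases
      case 1
      have ch: "chart cs (Exc k) y_fun ((xi_fun - const_fun b) / y_fun)"
        using chart_exc_at[of cs k, OF k(1)] by simp
      have eq: "\<sigma> (xi_fun - const_fun b) = y_fun * ((xi_fun - const_fun b) / y_fun)"
        "\<sigma> y_fun = (y_fun * ((xi_fun - const_fun b) / y_fun) + const_fun (b - a)) / ((xi_fun - const_fun b) / y_fun)"
        by (simp_all add: \<sigma> chom_simps const_fun_diff)
      show ?thesis unfolding 1 \<beta>0
        by (rule chart_match[OF ch chart_line_xi \<sigma>(1) _ f])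
          (simp only: eq, rule transversal_change(4)[OF _ ab'(2)])
    next
      case 2
      have ch: "chart cs' (Exc k) (1 / y_fun) ((xi_fun - const_fun b) / (1 / y_fun))"
        using chart_exc_at[of cs' k, OF k(2)] by simp
      have eq: "\<sigma> (1 / y_fun) = (xi_fun - const_fun b) * (1 / (y_fun * ((xi_fun - const_fun b) + const_fun (b - a))))"
        "\<sigma> ((xi_fun - const_fun b) / (1 / y_fun)) = y_fun * ((xi_fun - const_fun b) + const_fun (b - a))"
        by (simp_all add: \<sigma> chom_simps const_fun_diff)
      show ?thesis unfolding 2 \<beta>0
        by (rule chart_match[OF chart_line_xi ch \<sigma>(1) _ f])
          (simp only: eq, rule transversal_change(6)[OF _ ab'(2)])
    next
      case 3
      have ch: "chart cs (Exc l) (1 / y_fun) ((xi_fun - const_fun a) / (1 / y_fun))"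
        using chart_exc_at[of cs l, OF l(1)] by simp
      have eq: "\<sigma> (xi_fun - const_fun a) = 1 / y_fun * ((xi_fun - const_fun a) / (1 / y_fun))"
        "\<sigma> y_fun = ((xi_fun - const_fun a) / (1 / y_fun)) / (1 / y_fun * ((xi_fun - const_fun a) / (1 / y_fun)) + const_fun (a - b))"
        by (simp_all add: \<sigma> chom_simps const_fun_diff)
      show ?thesis unfolding 3 \<beta>0
        by (rule chart_match[OF ch chart_line_xi \<sigma>(1) _ f])
          (simp only: eq, rule transversal_change(5)[OF _ ab'(1)])
    next
      case 4
      have ch: "chart cs' (Exc l) y_fun ((xi_fun - const_fun a) / y_fun)"
        using chart_exc_at[of cs' l, OF l(2)] by simp
      have eq: "\<sigma> y_fun = (xi_fun - const_fun a) * (y_fun / ((xi_fun - const_fun a) + const_fun (a - b)))"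
        "\<sigma> ((xi_fun - const_fun a) / y_fun) = ((xi_fun - const_fun a) + const_fun (a - b)) / y_fun"
        by (simp_all add: \<sigma> chom_simps const_fun_diff)
      show ?thesis unfolding 4 \<beta>0
        by (rule chart_match[OF chart_line_xi ch \<sigma>(1) _ f])
          (simp only: eq, rule transversal_change(7)[OF _ ab'(1)])
    next
      case 5
      have eq: "\<sigma> (1 / y_fun) = 1 / y_fun * ((xi_fun - const_fun b) / (xi_fun - const_fun a))"
        by (simp add: \<sigma> chom_simps)
      show ?thesis unfolding 5 \<beta>0
        by (rule chart_match[OF chart_y_inf chart_y_inf \<sigma>(1) _ f])
          (simp only: eq \<sigma>, rule transversal_change(1), use ab in auto)
    next
      case 6
      have "1 - const_fun c * (1 / xi_fun) = (xi_fun - const_fun c) / xi_fun" for c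
        by (simp add: field_simps)
      then have eq: "\<sigma> (1 / xi_fun) = 1 / xi_fun"
         "\<sigma> y_fun = y_fun * ((1 - const_fun a * (1 / xi_fun)) / (1 - const_fun b * (1 / xi_fun)))"
        by (simp_all add: \<sigma> chom_simps)
      show ?thesis unfolding 6 \<beta>0
        by (rule chart_match[OF chart_xi_inf chart_xi_inf \<sigma>(1) _ f])
          (simp only: eq, rule transversal_change(8))
    next
      case (7 j)
      show ?thesis unfolding 7(1) \<beta>0(7)[OF 7(3,4)]
        using others[OF 7(2,3,4)] by (elim conjE) (rule twist_exc_match[OF ab \<sigma> _ _ _ f])
    qed
  qed
  ultimately have "\<exists>\<beta>. divisor_iso cs cs' \<sigma> \<beta> \<and> (\<forall>D\<in>special_divisors ?S. \<beta> D = \<beta>0 D)"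
    by (rule divisor_iso_extend[OF \<tau>])
  then obtain \<beta> where \<beta>: "divisor_iso cs cs' \<sigma> \<beta>" "\<And>D. D \<in> special_divisors ?S \<Longrightarrow> \<beta> D = \<beta>0 D"
    by blast
  show thesis
  proof (rule that[OF \<beta>(1) \<sigma>(2,3)])
    show "\<beta> (Exc k) = Curve (line_xi b)" "\<beta> (Exc l) = Curve (line_xi a)"
      "\<beta> Line_y_inf = Line_y_inf" "\<beta> Line_xi_inf = Line_xi_inf"
      using \<beta>(2) \<beta>0 kl by (simp_all add: special_divisors_def)
    show "\<beta> (Exc j) = Exc j" if "j \<in> {1..8}" "j \<noteq> k" "j \<noteq> l" for j
      using \<beta>(2)[of "Exc j"] \<beta>0 that by (simp add: special_divisors_def)
  qed
qed

fun rotate_point :: "complex \<Rightarrow> P1 \<times> P1 \<Rightarrow> P1 \<times> P1" where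
  "rotate_point C (Fin c, B) = (B, if c = 0 then Infty else Fin (C / c))"
| "rotate_point C (Infty, B) = (B, Fin 0)"

text \<open>A rotation is an automorphism of the product of lines and permutes the coordinate lines
  cyclically: \<open>y = 0\<close>, \<open>\<xi> = \<infinity>\<close>,
  \<open>y = \<infinity>\<close>, \<open>\<xi> = 0\<close>. Only two of them are affine curves, so
  those are the ones to be inverted.\<close>

lemma rotation_step:
  assumes C: "C \<noteq> 0" and cs': "\<And>j. j \<in> {1..8} \<Longrightarrow> cs' j = rotate_point C (cs j)"
  obtains \<sigma> \<beta> where "divisor_iso cs cs' \<sigma> \<beta>"
    "\<sigma> y_fun = xi_fun" "\<sigma> xi_fun = const_fun C / y_fun"
    "\<And>j. j \<in> {1..8} \<Longrightarrow> \<beta> (Exc j) = Exc j"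
    "\<beta> Line_y_inf = Curve (line_xi 0)" "\<beta> Line_xi_inf = Line_y_inf"
proof -
  obtain \<sigma> where \<sigma>: "chom \<sigma>" "\<sigma> y_fun = xi_fun" "\<sigma> xi_fun = const_fun C / y_fun"
    using ex_chom_rotation[OF C] by blast
  \<comment> \<open>The fourth power of \<sigma> is the identity, so its cube is the
    inverse.\<close>
  define \<tau> where "\<tau> = (\<lambda>f. \<sigma> (\<sigma> (\<sigma> f)))"
  have \<tau>: "chom \<tau>" "\<tau> y_fun = const_fun C / xi_fun" "\<tau> xi_fun = y_fun"
    using C by (simp_all add: \<tau>_def \<sigma> chom_simps chom_comp[OF \<sigma>(1) chom_comp[OF \<sigma>(1) \<sigma>(1)]])
  have 1: "\<sigma> (\<tau> f) = f" for f
    by (rule chom_eqI[OF chom_comp[OF \<sigma>(1) \<tau>(1)] chom_id]) (use C in \<open>simp_all add: \<sigma> \<tau> chom_simps\<close>)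
  have 2: "\<tau> (\<sigma> f) = f" for f
    by (rule chom_eqI[OF chom_comp[OF \<tau>(1) \<sigma>(1)] chom_id]) (use C in \<open>simp_all add: \<sigma> \<tau> chom_simps\<close>)
  let ?S = "{line_y 0, line_xi 0}"
  have u: "unit_off ?S xi_fun" "unit_off ?S y_fun"
    using unit_off_prime[OF prime_line_xi, of 0 ?S] unit_off_prime[OF prime_line_y, of 0 ?S]
    by (simp_all add: to_fract_line_xi to_fract_line_y)
  have u': "unit_off ?S (const_fun C / xi_fun)" "unit_off ?S (const_fun C / y_fun)"
    unfolding divide_inverse by (intro unit_off_mult unit_off_const unit_off_inverse u C)+
  have L: "localizes \<sigma> \<tau> ?S ?S"
    unfolding localizes_def using \<sigma> \<tau> 1 2 u u' prime_line_xi prime_line_y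
    by (auto simp: unit_off_regular to_fract_line_xi to_fract_line_y)
  define \<beta>0 where "\<beta>0 = id(Line_y_inf := Curve (line_xi 0), Line_xi_inf := Line_y_inf,
     Curve (line_xi 0) := Curve (line_y 0), Curve (line_y 0) := Line_xi_inf)"
  have \<beta>0: "\<beta>0 Line_y_inf = Curve (line_xi 0)" "\<beta>0 Line_xi_inf = Line_y_inf"
    "\<beta>0 (Curve (line_xi 0)) = Curve (line_y 0)" "\<beta>0 (Curve (line_y 0)) = Line_xi_inf"
    "\<And>j. \<beta>0 (Exc j) = Exc j"
    using line_neq(1)[of 0 0] by (auto simp: \<beta>0_def)
  have sp: "special_divisors ?S = {Curve (line_y 0), Curve (line_xi 0), Line_y_inf, Line_xi_inf} \<union> Exc ` {1..8}"
    by (auto simp: special_divisors_def)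
  have "\<beta>0 ` special_divisors ?S = special_divisors ?S"
    unfolding sp by (auto simp: \<beta>0 image_Un image_image)
  moreover have "finite (special_divisors ?S)" unfolding sp by simp
  ultimately have "bij_betw \<beta>0 (special_divisors ?S) (special_divisors ?S)"
    by (metis bij_betw_def finite_surj_inj subset_refl)
  moreover have "ord_at cs D (\<sigma> f) = ord_at cs' (\<beta>0 D) f"
    if D: "D \<in> special_divisors ?S" and f: "f \<noteq> 0" for D f
  proof -
    have L0: "chart cs (Curve (line_y 0)) y_fun xi_fun" "chart cs (Curve (line_xi 0)) xi_fun y_fun" for cs
      using chart_line_y[of cs 0] chart_line_xi[of cs 0] by simp_all
    consider "D = Curve (line_y 0)" | "D = Curve (line_xi 0)"
      | "D = Line_y_inf" | "D = Line_xi_inf" | j where "D = Exc j" "j \<in> {1..8}"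
      using D unfolding sp by blast
    then show ?thesis
    proof cases
      case 1
      have eq: "\<sigma> (1 / xi_fun) = y_fun * const_fun (1 / C)" "\<sigma> y_fun = xi_fun"
        using C by (simp_all add: \<sigma> chom_simps const_fun_divide)
      show ?thesis unfolding 1 \<beta>0
        by (rule chart_match[OF L0(1) chart_xi_inf \<sigma>(1) _ f])
          (simp only: eq, rule transversal_change(2), use C in auto)
    next
      case 2
      show ?thesis unfolding 2 \<beta>0
        by (rule chart_match[OF L0(2) L0(1) \<sigma>(1) _ f])
          (simp only: \<sigma>, rule transversal_change(3)[OF _ C])
    next
      case 3
      have eq: "\<sigma> xi_fun = 1 / y_fun * const_fun C" "\<sigma> y_fun = xi_fun"
        by (simp_all add: \<sigma> chom_simps)
      show ?thesis unfolding 3 \<beta>0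
        by (rule chart_match[OF chart_y_inf L0(2) \<sigma>(1) _ f])
          (simp only: eq, rule transversal_change(2)[OF _ C])
    next
      case 4
      have eq: "\<sigma> (1 / y_fun) = 1 / xi_fun" by (simp add: \<sigma> chom_simps)
      show ?thesis unfolding 4 \<beta>0
        by (rule chart_match[OF chart_xi_inf chart_y_inf \<sigma>(1) _ f])
          (simp only: eq \<sigma>, rule transversal_change(3)[OF _ C])
    next
      case (5 j)
      obtain A B where AB: "cs j = (A, B)" by fastforce
      define w where "w = local_parameter B xi_fun"
      have w: "w \<noteq> 0" by (simp add: w_def local_parameter_neq_0)
      have \<sigma>w: "\<sigma> (local_parameter B y_fun) = w"
        by (simp add: chom_local_parameter \<sigma> w_def)
      consider "A = Fin 0" | "A = Infty" | c where "A = Fin c" "c \<noteq> 0" by (metis P1.exhaust)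
      then show ?thesis
      proof cases
        case 1
        have ch: "chart cs (Exc j) y_fun (w / y_fun)" using chart_exc_at[of cs j, OF AB] 1 by (simp add: w_def)
        have "cs' j = (B, Infty)" using cs'[of j] 5 AB 1 by simp
        note ch' = chart_exc_at[of cs' j, OF this]
        have eq: "\<sigma> (local_parameter B y_fun) = y_fun * (w / y_fun)"
          "\<sigma> (local_parameter Infty xi_fun / local_parameter B y_fun) = const_fun (1 / C) / (w / y_fun)"
          using C w by (simp_all add: chom_divide[OF \<sigma>(1)] \<sigma>w \<sigma> chom_simps const_fun_divide)
        show ?thesis unfolding 5 \<beta>0
          by (rule chart_match[OF ch ch' \<sigma>(1) _ f])
            (simp only: eq, rule transversal_change(12), use C in auto)
      next
        case 2
        have ch: "chart cs (Exc j) (1 / y_fun) (w / (1 / y_fun))" using chart_exc_at[of cs j, OF AB] 2 by (simp add: w_def)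
        have "cs' j = (B, Fin 0)" using cs'[of j] 5 AB 2 by simp
        note ch' = chart_exc_at[of cs' j, OF this]
        have eq: "\<sigma> (local_parameter B y_fun) = 1 / y_fun * (w / (1 / y_fun))"
          "\<sigma> (local_parameter (Fin 0) xi_fun / local_parameter B y_fun) = const_fun C / (w / (1 / y_fun))"
          using C w by (simp_all add: chom_divide[OF \<sigma>(1)] \<sigma>w \<sigma> chom_simps const_fun_divide)
        show ?thesis unfolding 5 \<beta>0
          by (rule chart_match[OF ch ch' \<sigma>(1) _ f])
            (simp only: eq, rule transversal_change(12), use C in auto)
      next
        case 3
        let ?s = "y_fun - const_fun c"
        have ch: "chart cs (Exc j) ?s (w / ?s)" using chart_exc_at[of cs j, OF AB] 3 by (simp add: w_def)
        have "cs' j = (B, Fin (C / c))" using cs'[of j] 5 AB 3 by simp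
        note ch' = chart_exc_at[of cs' j, OF this]
        have "\<sigma> (xi_fun - const_fun (C / c)) = const_fun (- C / c) * ?s / y_fun"
          using 3 by (simp add: \<sigma> chom_simps const_fun_divide const_fun_minus field_simps)
        then have eq: "\<sigma> (local_parameter B y_fun) = ?s * (w / ?s)"
          "\<sigma> (local_parameter (Fin (C / c)) xi_fun / local_parameter B y_fun) = const_fun (- C / c) / (?s + const_fun c) / (w / ?s)"
          using C w by (simp_all add: chom_divide[OF \<sigma>(1)] \<sigma>w)
        show ?thesis unfolding 5 \<beta>0
          by (rule chart_match[OF ch ch' \<sigma>(1) _ f])
            (simp only: eq, rule transversal_change(13), use C 3 in auto)
      qed
    qed
  qed
  ultimately have "\<exists>\<beta>. divisor_iso cs cs' \<sigma> \<beta> \<and> (\<forall>D\<in>special_divisors ?S. \<beta> D = \<beta>0 D)"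
    by (rule divisor_iso_extend[OF L])
  then obtain \<beta> where \<beta>: "divisor_iso cs cs' \<sigma> \<beta>" "\<And>D. D \<in> special_divisors ?S \<Longrightarrow> \<beta> D = \<beta>0 D"
    by blast
  show thesis
    by (rule that[OF \<beta>(1) \<sigma>(2,3)]) (use \<beta>(2) \<beta>0 in \<open>simp_all add: sp\<close>)
qed

lemma relabel_step:
  assumes \<pi>: "\<pi> permutes {1..8}" and cs': "\<And>k. k \<in> {1..8} \<Longrightarrow> cs' (\<pi> k) = cs k"
  shows "divisor_iso cs cs' (\<lambda>f. f) (\<lambda>D. case D of Exc k \<Rightarrow> Exc (\<pi> k) | _ \<Rightarrow> D)"
    (is "divisor_iso _ _ _ ?\<beta>")
proof -
  have inj: "\<pi> k = \<pi> l \<longleftrightarrow> k = l" for k l using \<pi> by (metis permutes_inj injD)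
  have "inj ?\<beta>" by (rule injI) (auto split: pdiv.splits simp: inj)
  moreover have "\<exists>D'. D = ?\<beta> D'" for D
  proof (cases D)
    case (Exc k)
    then have "D = ?\<beta> (Exc (inv_into UNIV \<pi> k))" using \<pi> by (simp add: permutes_inverses)
    then show ?thesis by blast
  qed (auto intro: exI[of _ D])
  ultimately have "bij ?\<beta>" unfolding bij_def surj_def by blast
  moreover have "\<pi> k \<in> {1..8} \<longleftrightarrow> k \<in> {1..8}" for k using permutes_in_image[OF \<pi>] .
  then have "?\<beta> D \<in> prime_divisors \<longleftrightarrow> D \<in> prime_divisors" for D
    by (cases D) (auto simp: prime_divisors_def)
  moreover have "ord_at cs D f = ord_at cs' (?\<beta> D) f" if "D \<in> prime_divisors" for D f
    using that cs' by (cases D) (auto simp: prime_divisors_def)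
  ultimately show ?thesis by (simp add: divisor_iso_def chom_id)
qed

subsection \<open>Divisors and linear equivalence\<close>

definition scale :: "int \<Rightarrow> divisor \<Rightarrow> divisor" where
  "scale n D = Poly_Mapping.map (\<lambda>m. n * m) D"

lemma lookup_scale [simp]: "Poly_Mapping.lookup (scale n D) C = n * Poly_Mapping.lookup D C"
  by (simp add: scale_def Poly_Mapping.map.rep_eq when_def)

lemma scale_simps:
  "scale n (D + E) = scale n D + scale n E" "scale (m + n) D = scale m D + scale n D"
  "scale (- n) D = - scale n D" "scale 1 D = D" "scale 0 D = 0" "scale n 0 = 0"
  "scale n (- D) = - scale n D" "scale n (D - E) = scale n D - scale n E" "scale (m - n) D = scale m D - scale n D"
  by (rule poly_mapping_eqI; simp add: lookup_add lookup_minus lookup_uminus algebra_simps)+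

lemma scale_sum: "scale n (sum f A) = (\<Sum>i\<in>A. scale n (f i))"
  by (induction A rule: infinite_finite_induct) (simp_all add: scale_simps)

lemma lookup_prime_div [simp]: "Poly_Mapping.lookup (prime_div D) C = (if D = C then 1 else 0)"
  by (simp add: prime_div_def lookup_single when_def)

definition principal :: "(nat \<Rightarrow> P1 \<times> P1) \<Rightarrow> divisor set" where
  "principal cs = {D. Poly_Mapping.keys D \<subseteq> prime_divisors \<and>
     (\<exists>f. f \<noteq> 0 \<and> (\<forall>C\<in>prime_divisors. Poly_Mapping.lookup D C = ord_at cs C f))}"

lemma principal_divisors_eq: "principal_divisors q p = principal (center q p)"
  by (auto simp: principal_divisors_def principal_def divisor_group_def ord_along_eq)

lemma principal_0: "0 \<in> principal cs"
  unfolding principal_def using valuation_1[OF valuation_ord_at]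
  by (auto intro!: exI[of _ "1 :: ratfun"])

lemma principal_add:
  assumes "D \<in> principal cs" "E \<in> principal cs" shows "D + E \<in> principal cs"
proof -
  obtain f g where f: "f \<noteq> 0" "\<And>C. C \<in> prime_divisors \<Longrightarrow> Poly_Mapping.lookup D C = ord_at cs C f"
    and g: "g \<noteq> 0" "\<And>C. C \<in> prime_divisors \<Longrightarrow> Poly_Mapping.lookup E C = ord_at cs C g"
    using assms by (auto simp: principal_def)
  have "Poly_Mapping.lookup (D + E) C = ord_at cs C (f * g)" if "C \<in> prime_divisors" for C
    using valuationD_mult[OF valuation_ord_at[OF that] f(1) g(1)] f g that by (simp add: lookup_add)
  moreover have "Poly_Mapping.keys (D + E) \<subseteq> prime_divisors"
    using assms Poly_Mapping.keys_add[of D E] by (auto simp: principal_def)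
  ultimately show ?thesis using f g by (auto simp: principal_def intro!: exI[of _ "f * g"])
qed

lemma principal_uminus:
  assumes "D \<in> principal cs" shows "- D \<in> principal cs"
proof -
  obtain f where f: "f \<noteq> 0" "\<And>C. C \<in> prime_divisors \<Longrightarrow> Poly_Mapping.lookup D C = ord_at cs C f"
    using assms by (auto simp: principal_def)
  have "Poly_Mapping.lookup (- D) C = ord_at cs C (inverse f)" if "C \<in> prime_divisors" for C
    using valuation_inverse[OF valuation_ord_at[OF that] f(1)] f that by (simp add: lookup_uminus)
  moreover have "Poly_Mapping.keys (- D) \<subseteq> prime_divisors"
    using assms by (auto simp: principal_def keys_eq_empty in_keys_iff)
  ultimately show ?thesis using f by (auto simp: principal_def intro!: exI[of _ "inverse f"])
qed

definition lin_eq :: "(nat \<Rightarrow> P1 \<times> P1) \<Rightarrow> divisor \<Rightarrow> divisor \<Rightarrow> bool" where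
  "lin_eq cs D E \<longleftrightarrow> D - E \<in> principal cs"

lemma lin_eq_refl: "lin_eq cs D D"
  by (simp add: lin_eq_def principal_0)

lemma lin_eq_sym: "lin_eq cs D E \<Longrightarrow> lin_eq cs E D"
  using principal_uminus[of "D - E" cs] by (simp add: lin_eq_def)

lemma lin_eq_trans [trans]: "lin_eq cs D E \<Longrightarrow> lin_eq cs E F \<Longrightarrow> lin_eq cs D F"
  using principal_add[of "D - E" cs "E - F"] by (simp add: lin_eq_def)

lemma lin_eq_add: "lin_eq cs D E \<Longrightarrow> lin_eq cs D' E' \<Longrightarrow> lin_eq cs (D + D') (E + E')"
  using principal_add[of "D - E" cs "D' - E'"] by (simp add: lin_eq_def algebra_simps)

lemma lin_eq_uminus: "lin_eq cs D E \<Longrightarrow> lin_eq cs (- D) (- E)"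
  using principal_uminus[of "D - E" cs] by (simp add: lin_eq_def)

lemma lin_eq_diff: "lin_eq cs D E \<Longrightarrow> lin_eq cs D' E' \<Longrightarrow> lin_eq cs (D - D') (E - E')"
  using lin_eq_add[of cs D E "- D'" "- E'"] lin_eq_uminus by simp

lemma lin_eq_sum: "(\<And>i. i \<in> A \<Longrightarrow> lin_eq cs (f i) (g i)) \<Longrightarrow> lin_eq cs (sum f A) (sum g A)"
  by (induction A rule: infinite_finite_induct) (auto simp: lin_eq_refl lin_eq_add)

lemma lin_eq_scale:
  assumes "lin_eq cs D E" shows "lin_eq cs (scale n D) (scale n E)"
proof -
  have nat: "lin_eq cs (scale (int m) D) (scale (int m) E)" for m
    by (induction m) (simp_all add: scale_simps lin_eq_refl lin_eq_add assms)
  then show ?thesis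
    by (cases n rule: int_cases2) (auto simp: scale_simps lin_eq_uminus)
qed

lemma divisor_principal:
  assumes "finite S" "S \<subseteq> prime_divisors" "f \<noteq> 0"
    "\<And>C. C \<in> prime_divisors \<Longrightarrow> C \<notin> S \<Longrightarrow> ord_at cs C f = 0"
  shows "(\<Sum>C\<in>S. scale (ord_at cs C f) (prime_div C)) \<in> principal cs"
proof -
  let ?D = "\<Sum>C\<in>S. scale (ord_at cs C f) (prime_div C)"
  have l: "Poly_Mapping.lookup ?D C = (if C \<in> S then ord_at cs C f else 0)" for C
    using \<open>finite S\<close> by (simp add: lookup_sum if_distrib[of "\<lambda>x. _ * x"] cong: if_cong)
  then have "Poly_Mapping.keys ?D \<subseteq> prime_divisors"
    using assms(2) by (auto simp: in_keys_iff split: if_splits)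
  then show ?thesis using assms l by (auto simp: principal_def)
qed


subsection \<open>Orders of the coordinate functions\<close>

text \<open>Order of \<open>f - a\<close> along a divisor on which the coordinate \<open>f\<close>
  takes the value \<open>A\<close> to first order; at infinity this is a simple pole for every
  \<open>a\<close>.\<close>

definition order_at_point :: "P1 \<Rightarrow> complex \<Rightarrow> int" where
  "order_at_point A a = (case A of Infty \<Rightarrow> - 1 | Fin c \<Rightarrow> if c = a then 1 else 0)"

lemma order_local_parameter:
  assumes v: "valuation v" and "local_parameter A f \<noteq> 0" "v (local_parameter A f) = 1" and "\<And>c. f \<noteq> const_fun c"
  shows "v (f - const_fun a) = order_at_point A a"
proof (cases A)
  case Infty
  have f: "f \<noteq> 0" using assms(4)[of 0] by simp
  then have "v f = - 1" using assms Infty valuation_divide[OF v, of 1 f] valuation_1[OF v] by simp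
  moreover have "v (- const_fun a) = 0" if "a \<noteq> 0"
    using that valuationD_const[OF v] valuation_uminus[OF v] by simp
  ultimately have "v (f + - const_fun a) = v f"
    using \<open>v f = - 1\<close> by (intro valuation_dominant(2)[OF v f]) (cases "a = 0"; simp)
  then show ?thesis using Infty \<open>v f = - 1\<close> by (simp add: order_at_point_def)
next
  case (Fin c)
  show ?thesis
  proof (cases "c = a")
    case True
    then show ?thesis using assms Fin by (simp add: order_at_point_def)
  next
    case False
    have "v (const_fun (c - a) + (f - const_fun c)) = v (const_fun (c - a))"
      by (rule valuation_dominant(2)[OF v]) (use assms Fin False valuationD_const[OF v, of "c - a"] in auto)
    then show ?thesis using False Fin valuationD_const[OF v, of "c - a"]
      by (simp add: order_at_point_def const_fun_diff)
  qed
qed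

lemma order_lines:
  "ord_at cs Line_y_inf (y_fun - const_fun a) = - 1" "ord_at cs Line_y_inf (xi_fun - const_fun a) = 0"
  "ord_at cs Line_xi_inf (xi_fun - const_fun a) = - 1" "ord_at cs Line_xi_inf (y_fun - const_fun a) = 0"
  using order_local_parameter[of "ord_at cs Line_y_inf" Infty y_fun a]
    order_local_parameter[of "ord_at cs Line_xi_inf" Infty xi_fun a]
    chartD(1)[OF chart_y_inf, of cs] chartD(1)[OF chart_xi_inf, of cs]
  by (simp_all add: transversal_def order_at_point_def del: ord_at.simps)

lemma order_exc:
  "ord_at cs (Exc k) (y_fun - const_fun a) = order_at_point (fst (cs k)) a"
  "ord_at cs (Exc k) (xi_fun - const_fun a) = order_at_point (snd (cs k)) a"
proof -
  let ?v = "ord_at cs (Exc k)" and ?s = "local_parameter (fst (cs k)) y_fun"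
    and ?w = "local_parameter (snd (cs k)) xi_fun"
  note tr = chartD(1)[OF chart_exc, of cs k]
  have v: "valuation ?v" and s: "?s \<noteq> 0" "?v ?s = 1"
    using tr by (auto simp: transversal_def simp del: ord_at.simps)
  have "?w / ?s - const_fun 0 \<noteq> 0 \<and> ?v (?w / ?s - const_fun 0) = 0"
    using tr unfolding transversal_def by blast
  then have w: "?w \<noteq> 0" "?v ?w = 1"
    using valuation_divide[OF v, of ?w ?s] s by (auto simp del: ord_at.simps)
  show "?v (y_fun - const_fun a) = order_at_point (fst (cs k)) a"
    by (rule order_local_parameter[OF v s]) simp
  show "?v (xi_fun - const_fun a) = order_at_point (snd (cs k)) a"
    by (rule order_local_parameter[OF v w]) simp
qed

lemma exc_prime: "k \<in> {1..8} \<Longrightarrow> Exc k \<in> prime_divisors"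
  and lines_prime: "Line_y_inf \<in> prime_divisors" "Line_xi_inf \<in> prime_divisors"
  and curve_prime: "Curve P \<in> prime_divisors \<longleftrightarrow> prime P"
  by (auto simp: prime_divisors_def)

lemma sum_exc: "(\<Sum>C\<in>Exc ` {1..8}. g C) = (\<Sum>k\<in>{1..8}. g (Exc k))"
  by (rule sum.reindex_cong[of Exc]) (auto simp: inj_on_def)

text \<open>The equation \<open>P\<close> vanishes along no other affine curve, so its divisor
  expresses the class of the curve through the lines at infinity and the exceptional curves.\<close>

lemma curve_lin_eq:
  assumes "prime P"
  shows "lin_eq cs (prime_div (Curve P))
    (- scale (ord_at cs Line_y_inf (to_fract P)) (prime_div Line_y_inf)
     - scale (ord_at cs Line_xi_inf (to_fract P)) (prime_div Line_xi_inf)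
     - (\<Sum>k\<in>{1..8}. scale (ord_at cs (Exc k) (to_fract P)) (prime_div (Exc k))))"
proof -
  let ?S = "{Curve P, Line_y_inf, Line_xi_inf} \<union> Exc ` {1..8}"
  have "(\<Sum>C\<in>?S. scale (ord_at cs C (to_fract P)) (prime_div C)) \<in> principal cs"
  proof (rule divisor_principal)
    show "?S \<subseteq> prime_divisors" using assms by (auto simp: prime_divisors_def)
    show "to_fract P \<noteq> 0" using assms by auto
    show "ord_at cs C (to_fract P) = 0" if "C \<in> prime_divisors" "C \<notin> ?S" for C
      using that assms by (auto simp: prime_divisors_def ord_curve_prime)
  qed simp
  moreover have "(\<Sum>C\<in>?S. g C) = g (Curve P) + g Line_y_inf + g Line_xi_inf + (\<Sum>k\<in>{1..8}. g (Exc k))"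
    for g :: "pdiv \<Rightarrow> divisor"
    by (subst sum.union_disjoint) (auto simp: sum_exc[simplified] add.assoc)
  moreover have "scale (ord_at cs (Curve P) (to_fract P)) D = D" for D
    using assms by (simp add: ord_curve_prime scale_simps)
  ultimately show ?thesis by (simp add: lin_eq_def algebra_simps del: ord_at.simps)
qed

text \<open>Total transform of \<open>y = \<infinity>\<close>. It represents the class of a fibre of
  \<open>y\<close> without any choice of a generic constant.\<close>

definition y_fibre :: "(nat \<Rightarrow> P1 \<times> P1) \<Rightarrow> divisor" where
  "y_fibre cs = prime_div Line_y_inf + (\<Sum>k\<in>{1..8}. if fst (cs k) = Infty then prime_div (Exc k) else 0)"

definition xi_fibre :: "(nat \<Rightarrow> P1 \<times> P1) \<Rightarrow> divisor" where
  "xi_fibre cs = prime_div Line_xi_inf + (\<Sum>k\<in>{1..8}. if snd (cs k) = Infty then prime_div (Exc k) else 0)"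

lemma scale_order_at_point:
  "scale (order_at_point A a) D = (if A = Fin a then D else 0) - (if A = Infty then D else 0)"
  by (cases A) (auto simp: order_at_point_def scale_simps)

lemma line_y_lin_eq:
  "lin_eq cs (prime_div (Curve (line_y a))) (y_fibre cs - (\<Sum>k\<in>{1..8}. if fst (cs k) = Fin a then prime_div (Exc k) else 0))"
  using curve_lin_eq[OF prime_line_y, of cs a]
  by (simp add: to_fract_line_y order_lines order_exc scale_simps scale_order_at_point sum_subtractf
      y_fibre_def algebra_simps del: ord_at.simps)

lemma line_xi_lin_eq:
  "lin_eq cs (prime_div (Curve (line_xi a))) (xi_fibre cs - (\<Sum>k\<in>{1..8}. if snd (cs k) = Fin a then prime_div (Exc k) else 0))"
  using curve_lin_eq[OF prime_line_xi, of cs a]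
  by (simp add: to_fract_line_xi order_lines order_exc scale_simps scale_order_at_point sum_subtractf
      xi_fibre_def algebra_simps del: ord_at.simps)

text \<open>The divisor \<open>a \<H>\<^sub>y + b \<H>\<^sub>\<xi> + \<Sum> c\<^sub>k \<F>\<^sub>k\<close>, with both fibres taken at infinity.\<close>

definition combination :: "(nat \<Rightarrow> P1 \<times> P1) \<Rightarrow> int \<Rightarrow> int \<Rightarrow> (nat \<Rightarrow> int) \<Rightarrow> divisor" where
  "combination cs a b c = scale a (y_fibre cs) + scale b (xi_fibre cs) +
     (\<Sum>k\<in>{1..8}. scale (c k) (prime_div (Exc k)))"

lemma combination_add:
  "combination cs a b c + combination cs a' b' c' = combination cs (a + a') (b + b') (\<lambda>k. c k + c' k)"
  by (simp add: combination_def scale_simps sum.distrib algebra_simps)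

lemma combination_uminus: "- combination cs a b c = combination cs (- a) (- b) (\<lambda>k. - c k)"
  by (simp add: combination_def scale_simps sum_negf algebra_simps)

lemma combination_scale: "scale n (combination cs a b c) = combination cs (n * a) (n * b) (\<lambda>k. n * c k)"
proof -
  have "scale n (scale m D) = scale (n * m) D" for m D
    by (rule poly_mapping_eqI) simp
  then show ?thesis by (simp add: combination_def scale_simps scale_sum)
qed

lemma combination_exc: "j \<in> {1..8} \<Longrightarrow> combination cs 0 0 (\<lambda>k. if k = j then 1 else 0) = prime_div (Exc j)"
  by (simp add: combination_def scale_simps if_distrib[of "\<lambda>n. scale n _"] cong: if_cong)

lemma combination_cong:
  "(\<And>k. k \<in> {1..8} \<Longrightarrow> c k = c' k) \<Longrightarrow> combination cs a b c = combination cs a b c'"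
  by (simp add: combination_def)

lemma combination_fibres:
  "combination cs 1 0 (\<lambda>k. if fst (cs k) = Infty then -1 else 0) = prime_div Line_y_inf"
  "combination cs 0 1 (\<lambda>k. if snd (cs k) = Infty then -1 else 0) = prime_div Line_xi_inf"
  by (simp_all add: combination_def y_fibre_def xi_fibre_def scale_simps if_distrib[of "\<lambda>n. scale n _"]
      flip: sum.distrib cong: if_cong) (auto intro!: sum.neutral)

section \<open>Fibres and exceptional curves generate the divisor classes freely\<close>

definition spanned :: "(nat \<Rightarrow> P1 \<times> P1) \<Rightarrow> divisor \<Rightarrow> bool" where
  "spanned cs D \<longleftrightarrow> (\<exists>a b c. lin_eq cs D (combination cs a b c))"

lemma spanned_add: "spanned cs D \<Longrightarrow> spanned cs E \<Longrightarrow> spanned cs (D + E)"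
  unfolding spanned_def using lin_eq_add combination_add by metis

lemma spanned_uminus: "spanned cs D \<Longrightarrow> spanned cs (- D)"
  unfolding spanned_def using lin_eq_uminus combination_uminus by metis

lemma spanned_diff: "spanned cs D \<Longrightarrow> spanned cs E \<Longrightarrow> spanned cs (D - E)"
  using spanned_add[of cs D "- E"] spanned_uminus by simp

lemma spanned_scale: "spanned cs D \<Longrightarrow> spanned cs (scale n D)"
  unfolding spanned_def using lin_eq_scale combination_scale by metis

lemma spanned_0: "spanned cs 0"
proof -
  have "combination cs 0 0 (\<lambda>k. 0) = 0" by (simp add: combination_def scale_simps)
  then show ?thesis unfolding spanned_def using lin_eq_refl by metis
qed

lemma spanned_sum: "(\<And>i. i \<in> A \<Longrightarrow> spanned cs (f i)) \<Longrightarrow> spanned cs (sum f A)"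
  by (induction A rule: infinite_finite_induct) (auto simp: spanned_0 spanned_add)

lemma spanned_lin_eq: "lin_eq cs D E \<Longrightarrow> spanned cs E \<Longrightarrow> spanned cs D"
  unfolding spanned_def using lin_eq_trans by blast

lemma spanned_prime_div:
  assumes "C \<in> prime_divisors" shows "spanned cs (prime_div C)"
proof -
  have lines: "spanned cs (prime_div Line_y_inf)" "spanned cs (prime_div Line_xi_inf)"
    unfolding spanned_def by (metis combination_fibres lin_eq_refl)+
  have exc: "spanned cs (prime_div (Exc k))" if "k \<in> {1..8}" for k
    unfolding spanned_def by (metis combination_exc[OF that] lin_eq_refl)
  consider "C = Line_y_inf" | "C = Line_xi_inf" | k where "C = Exc k" "k \<in> {1..8}"
    | P where "C = Curve P" "prime P"
    using assms by (auto simp: prime_divisors_def)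
  then show ?thesis
  proof cases
    case (4 P)
    show ?thesis unfolding 4
      by (rule spanned_lin_eq[OF curve_lin_eq[OF 4(2)]])
        (intro spanned_diff spanned_uminus spanned_scale spanned_sum lines exc)
  qed (use lines exc in auto)
qed

lemma spanned_carrier:
  assumes "Poly_Mapping.keys D \<subseteq> prime_divisors" shows "spanned cs D"
proof -
  have "D = (\<Sum>C\<in>Poly_Mapping.keys D. scale (Poly_Mapping.lookup D C) (prime_div C))"
    by (rule poly_mapping_eqI)
      (simp add: lookup_sum in_keys_iff if_distrib[of "\<lambda>x. _ * x"] cong: if_cong)
  moreover have "spanned cs (\<Sum>C\<in>Poly_Mapping.keys D. scale (Poly_Mapping.lookup D C) (prime_div C))"
    using assms by (intro spanned_sum spanned_scale spanned_prime_div) auto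
  ultimately show ?thesis by metis
qed

lemma unit_off_empty:
  assumes "unit_off {} f" shows "\<exists>c. c \<noteq> 0 \<and> f = const_fun c"
proof -
  have const: "\<exists>c. c \<noteq> 0 \<and> to_fract m = const_fun c" if "m \<noteq> 0" "\<And>P. prime P \<Longrightarrow> \<not> P dvd m" for m
  proof -
    have "is_unit m" using that prime_divisor_exists[of m] by blast
    then obtain p where p: "m = [:p:]" "is_unit p" by (auto simp: is_unit_poly_iff)
    then obtain c where "p = [:c:]" "is_unit c" by (auto simp: is_unit_poly_iff)
    then show ?thesis by (intro exI[of _ c]) (auto simp: p const_fun_def)
  qed
  have f: "f \<noteq> 0" using assms by (simp add: unit_off_def)
  have d: "\<not> P dvd denom f" if "prime P" for P
    using denom_prime_factor[OF unit_off_regular[OF assms] f that] by auto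
  have n: "\<not> P dvd numer f" if "prime P" for P
  proof -
    have "multiplicity P (numer f) = 0"
      using assms that not_dvd_imp_multiplicity_0[OF d[OF that]] by (simp add: unit_off_def ord_curve_def)
    then show ?thesis using that f prime_multiplicity_gt_zero_iff[of P "numer f"] by auto
  qed
  obtain a where a: "a \<noteq> 0" "to_fract (numer f) = const_fun a"
    using const[of "numer f"] n f by auto
  obtain b where b: "b \<noteq> 0" "to_fract (denom f) = const_fun b"
    using const[of "denom f"] d by auto
  have "f = const_fun (a / b)" using a b by (metis const_fun_divide numer_denom(1))
  then show ?thesis using a b by (intro exI[of _ "a / b"]) simp
qed

text \<open>The combination has no affine curve in its support, so a function with this divisor is a
  unit of the polynomial ring, hence constant, and the divisor is zero. The lines at infinity give
  \<open>a\<close> and \<open>b\<close> first, because exceptional curves may also occur inside the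
  fibres.\<close>

lemma combination_independent:
  assumes "combination cs a b c \<in> principal cs"
  shows "a = 0" "b = 0" "\<And>k. k \<in> {1..8} \<Longrightarrow> c k = 0"
proof -
  let ?D = "combination cs a b c"
  obtain f where f: "f \<noteq> 0" "\<And>C. C \<in> prime_divisors \<Longrightarrow> Poly_Mapping.lookup ?D C = ord_at cs C f"
    using assms by (auto simp: principal_def)
  have curve: "Poly_Mapping.lookup ?D (Curve P) = 0" for P
    by (simp add: combination_def y_fibre_def xi_fibre_def lookup_add lookup_sum if_distrib[of "\<lambda>D. Poly_Mapping.lookup D _"] cong: if_cong)
  have lines: "Poly_Mapping.lookup ?D Line_y_inf = a" "Poly_Mapping.lookup ?D Line_xi_inf = b"
    by (simp_all add: combination_def y_fibre_def xi_fibre_def lookup_add lookup_sum if_distrib[of "\<lambda>D. Poly_Mapping.lookup D _"] cong: if_cong)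
  have "ord_curve P f = 0" if "prime P" for P
    using f(2)[of "Curve P"] curve[of P] that by (simp add: curve_prime)
  then have "unit_off {} f" using f(1) by (simp add: unit_off_def)
  then obtain u where u: "u \<noteq> 0" "f = const_fun u" using unit_off_empty by blast
  have 0: "Poly_Mapping.lookup ?D C = 0" if "C \<in> prime_divisors" for C
    using f(2)[OF that] valuationD_const[OF valuation_ord_at[OF that] u(1)] u(2) by simp
  show ab: "a = 0" "b = 0" using 0 lines lines_prime by metis+
  show "c k = 0" if "k \<in> {1..8}" for k
  proof -
    have "Poly_Mapping.lookup ?D (Exc k) = c k"
      using that by (simp add: combination_def ab scale_simps lookup_sum if_distrib[of "\<lambda>x. _ * x"] cong: if_cong)
    then show ?thesis using 0[OF exc_prime[OF that]] by simp
  qed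
qed

subsection \<open>The Picard group\<close>

definition divisor_coset :: "(nat \<Rightarrow> P1 \<times> P1) \<Rightarrow> divisor \<Rightarrow> divisor set" where
  "divisor_coset cs D = {E. lin_eq cs E D}"

lemma div_class_eq: "div_class q p D = divisor_coset (center q p) D"
proof -
  have "x \<in> div_class q p D \<longleftrightarrow> lin_eq (center q p) x D" for x
  proof
    assume "x \<in> div_class q p D"
    then obtain h where "h \<in> principal (center q p)" "x = h + D"
      by (auto simp: div_class_def r_coset_def divisor_group_def principal_divisors_eq)
    then show "lin_eq (center q p) x D" by (simp add: lin_eq_def)
  next
    assume "lin_eq (center q p) x D"
    then have "x - D \<in> principal (center q p)" by (simp add: lin_eq_def)
    then have "\<exists>h\<in>principal (center q p). x = h + D" by (intro bexI[of _ "x - D"]) simp_all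
    then show "x \<in> div_class q p D"
      by (auto simp: div_class_def r_coset_def divisor_group_def principal_divisors_eq)
  qed
  then show ?thesis by (auto simp: divisor_coset_def)
qed

lemma divisor_coset_eq_iff: "divisor_coset cs D = divisor_coset cs E \<longleftrightarrow> lin_eq cs D E"
proof
  assume "divisor_coset cs D = divisor_coset cs E"
  moreover have "D \<in> divisor_coset cs D" by (simp add: divisor_coset_def lin_eq_refl)
  ultimately show "lin_eq cs D E" by (simp add: divisor_coset_def)
next
  assume DE: "lin_eq cs D E"
  show "divisor_coset cs D = divisor_coset cs E"
    unfolding divisor_coset_def using lin_eq_trans[OF _ DE] lin_eq_trans[OF _ lin_eq_sym[OF DE]] by blast
qed

lemma carrier_Pic:
  "carrier (Pic q p) = divisor_coset (center q p) ` {D. Poly_Mapping.keys D \<subseteq> prime_divisors}"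
  by (auto simp: Pic_def FactGroup_def RCOSETS_def divisor_group_def
      simp flip: div_class_eq simp: div_class_def)

lemma mult_Pic:
  "divisor_coset (center q p) D \<otimes>\<^bsub>Pic q p\<^esub> divisor_coset (center q p) E = divisor_coset (center q p) (D + E)"
proof -
  let ?c = "divisor_coset (center q p)"
  have "?c D \<otimes>\<^bsub>Pic q p\<^esub> ?c E = {x + y |x y. x \<in> ?c D \<and> y \<in> ?c E}"
    by (auto simp: Pic_def FactGroup_def set_mult_def divisor_group_def)
  also have "\<dots> = ?c (D + E)"
  proof (intro equalityI subsetI)
    fix z assume "z \<in> ?c (D + E)"
    then have "lin_eq (center q p) (z - E) D"
      unfolding divisor_coset_def using lin_eq_diff[OF _ lin_eq_refl[of _ E], of _ z "D + E"] by simp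
    then have "z = (z - E) + E \<and> z - E \<in> ?c D \<and> E \<in> ?c E"
      by (simp add: divisor_coset_def lin_eq_refl)
    then show "z \<in> {x + y |x y. x \<in> ?c D \<and> y \<in> ?c E}" by blast
  qed (auto simp: divisor_coset_def lin_eq_add)
  finally show ?thesis .
qed

lemma exhaust_10: "i \<in> {0, 1, 2, 3, 4, 5, 6, 7, 8, 9}" for i :: 10
proof (induct i)
  case (of_int z)
  then have "0 \<le> z" "z < 10" by simp_all
  then have "z = 0 \<or> z = 1 \<or> z = 2 \<or> z = 3 \<or> z = 4 \<or> z = 5 \<or> z = 6 \<or> z = 7 \<or> z = 8 \<or> z = 9" by arith
  then show ?case by auto
qed

lemma UNIV_10: "(UNIV :: 10 set) = {0, 1, 2, 3, 4, 5, 6, 7, 8, 9}" using exhaust_10 by auto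

lemma sum_10: "sum f (UNIV :: 10 set) = f 0 + f 1 + f 2 + f 3 + f 4 + f 5 + f 6 + f 7 + f 8 + f 9"
  unfolding UNIV_10 by (simp add: ac_simps)

lemma exhaust_6: "i \<in> {0, 1, 2, 3, 4, 5}" for i :: 6
proof (induct i)
  case (of_int z)
  then have "0 \<le> z" "z < 6" by simp_all
  then have "z = 0 \<or> z = 1 \<or> z = 2 \<or> z = 3 \<or> z = 4 \<or> z = 5" by arith
  then show ?case by auto
qed

lemma UNIV_6: "(UNIV :: 6 set) = {0, 1, 2, 3, 4, 5}" using exhaust_6 by auto

lemma sum_6: "sum f (UNIV :: 6 set) = f 0 + f 1 + f 2 + f 3 + f 4 + f 5"
  unfolding UNIV_6 by (simp add: ac_simps)

text \<open>The eight centres exclude only finitely many constants, so the choice in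
  \<open>generic_y_line\<close> has the intended property; a fibre through no centre carries no
  exceptional correction.\<close>

lemma generic_y_line_lin_eq: "lin_eq (center q p) (generic_y_line q p) (y_fibre (center q p))"
proof -
  have "finite {a. fst (center q p k) = Fin a}" for k
    by (cases "fst (center q p k)") auto
  then have "finite (\<Union>k\<in>{1..8}. {a. fst (center q p k) = Fin a})" by blast
  from ex_new_if_finite[OF infinite_UNIV_char_0 this]
  have "\<exists>a. \<forall>k\<in>{1..8}. fst (center q p k) \<noteq> Fin a" by auto
  from someI_ex[OF this] obtain a where a: "\<forall>k\<in>{1..8}. fst (center q p k) \<noteq> Fin a"
    and eq: "generic_y_line q p = prime_div (Curve (line_y a))"
    unfolding generic_y_line_def Let_def line_y_def by blast
  have "(\<Sum>k\<in>{1..8}. if fst (center q p k) = Fin a then prime_div (Exc k) else 0) = 0"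
    using a by (intro sum.neutral) auto
  then show ?thesis unfolding eq using line_y_lin_eq[of "center q p" a] by simp
qed

lemma generic_xi_line_lin_eq: "lin_eq (center q p) (generic_xi_line q p) (xi_fibre (center q p))"
proof -
  have "finite {a. snd (center q p k) = Fin a}" for k
    by (cases "snd (center q p k)") auto
  then have "finite (\<Union>k\<in>{1..8}. {a. snd (center q p k) = Fin a})" by blast
  from ex_new_if_finite[OF infinite_UNIV_char_0 this]
  have "\<exists>a. \<forall>k\<in>{1..8}. snd (center q p k) \<noteq> Fin a" by auto
  from someI_ex[OF this] obtain a where a: "\<forall>k\<in>{1..8}. snd (center q p k) \<noteq> Fin a"
    and eq: "generic_xi_line q p = prime_div (Curve (line_xi a))"
    unfolding generic_xi_line_def Let_def line_xi_def by blast
  have "(\<Sum>k\<in>{1..8}. if snd (center q p k) = Fin a then prime_div (Exc k) else 0) = 0"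
    using a by (intro sum.neutral) auto
  then show ?thesis unfolding eq using line_xi_lin_eq[of "center q p" a] by simp
qed

text \<open>Result of expanding the ten basis classes: those with index 0, 1 and 8 each contain the
  third exceptional curve with coefficient -1, whence the third entry.\<close>

definition exc_coefficients :: "lattice10 \<Rightarrow> nat \<Rightarrow> int" where
  "exc_coefficients x k =
    [x $ 2, x $ 3, - x $ 0 - x $ 1 - x $ 8, x $ 9, x $ 4, x $ 5, x $ 6, x $ 7] ! (k - 1)"

definition lattice_divisor :: "(nat \<Rightarrow> P1 \<times> P1) \<Rightarrow> lattice10 \<Rightarrow> divisor" where
  "lattice_divisor cs x = combination cs (x $ 0 + x $ 1) (x $ 0 + x $ 8) (exc_coefficients x)"

lemma sum_8: "(\<Sum>k\<in>{1..8}. g k) = g 1 + g 2 + g 3 + g 4 + g 5 + g 6 + g 7 + g (8 :: nat)"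
  by (simp add: eval_nat_numeral)

lemma lattice_class_eq: "lattice_class q p x = divisor_coset (center q p) (lattice_divisor (center q p) x)"
proof -
  let ?cs = "center q p"
  let ?Hy = "generic_y_line q p" and ?Hxi = "generic_xi_line q p" and ?F = "\<lambda>k. prime_div (Exc k)"
  have basis: "basis_divisor q p 0 = ?Hy + ?Hxi - ?F 3" "basis_divisor q p 1 = ?Hy - ?F 3"
    "basis_divisor q p 2 = ?F 1" "basis_divisor q p 3 = ?F 2" "basis_divisor q p 4 = ?F 5"
    "basis_divisor q p 5 = ?F 6" "basis_divisor q p 6 = ?F 7" "basis_divisor q p 7 = ?F 8"
    "basis_divisor q p 8 = ?Hxi - ?F 3" "basis_divisor q p 9 = ?F 4"
    by (simp_all add: basis_divisor_def Let_def)
  have "(\<Sum>i\<in>UNIV. Poly_Mapping.map (\<lambda>n. x $ i * n) (basis_divisor q p i)) =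
      scale (x $ 0 + x $ 1) ?Hy + scale (x $ 0 + x $ 8) ?Hxi + (\<Sum>k\<in>{1..8}. scale (exc_coefficients x k) (?F k))"
    unfolding scale_def[symmetric] sum_10 sum_8
    by (simp add: basis scale_simps exc_coefficients_def)
  moreover have "lin_eq ?cs \<dots> (lattice_divisor ?cs x)"
    unfolding lattice_divisor_def combination_def
    by (intro lin_eq_add lin_eq_scale lin_eq_refl generic_y_line_lin_eq generic_xi_line_lin_eq)
  ultimately show ?thesis
    unfolding lattice_class_def div_class_eq by (simp add: divisor_coset_eq_iff)
qed

lemma in_1_8: "k \<in> {1..8} \<longleftrightarrow> k = 1 \<or> k = 2 \<or> k = 3 \<or> k = 4 \<or> k = 5 \<or> k = 6 \<or> k = 7 \<or> k = (8::nat)"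
  by auto

lemma keys_combination: "Poly_Mapping.keys (combination cs a b c) \<subseteq> prime_divisors"
proof
  fix C assume "C \<in> Poly_Mapping.keys (combination cs a b c)"
  then have "Poly_Mapping.lookup (combination cs a b c) C \<noteq> 0" by (simp add: in_keys_iff)
  then show "C \<in> prime_divisors"
    by (cases C)
      (auto simp: prime_divisors_def combination_def y_fibre_def xi_fibre_def lookup_add lookup_sum
        if_distrib[of "\<lambda>D. Poly_Mapping.lookup D _"] if_distrib[of "\<lambda>n. _ * n"] cong: if_cong split: if_splits)
qed

text \<open>Injectivity is the independence of fibres and exceptional curves, surjectivity their
  generation; the passage between the two bases is unimodular.\<close>

lemma bij_lattice_class: "bij_betw (lattice_class q p) UNIV (carrier (Pic q p))"
proof (rule bij_betw_imageI)
  let ?cs = "center q p"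
  show "inj (lattice_class q p)"
  proof (rule injI)
    fix x y assume "lattice_class q p x = lattice_class q p y"
    then have "lattice_divisor ?cs x - lattice_divisor ?cs y \<in> principal ?cs"
      by (simp add: lattice_class_eq divisor_coset_eq_iff lin_eq_def)
    moreover have "lattice_divisor ?cs x - lattice_divisor ?cs y =
        combination ?cs (x $ 0 + x $ 1 - y $ 0 - y $ 1) (x $ 0 + x $ 8 - y $ 0 - y $ 8)
          (\<lambda>k. exc_coefficients x k - exc_coefficients y k)"
      using combination_add combination_uminus unfolding lattice_divisor_def diff_conv_add_uminus
      by (simp add: algebra_simps)
    ultimately have c: "combination ?cs (x $ 0 + x $ 1 - y $ 0 - y $ 1) (x $ 0 + x $ 8 - y $ 0 - y $ 8)
          (\<lambda>k. exc_coefficients x k - exc_coefficients y k) \<in> principal ?cs" by simp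
    note i = combination_independent[OF c]
    have "x $ i = y $ i" for i
      using exhaust_10[of i] i(1,2) i(3)[of 1] i(3)[of 2] i(3)[of 3] i(3)[of 4] i(3)[of 5] i(3)[of 6] i(3)[of 7] i(3)[of 8]
      by (auto simp: exc_coefficients_def)
    then show "x = y" by (simp add: vec_eq_iff)
  qed
  show "range (lattice_class q p) = carrier (Pic q p)"
  proof (intro equalityI subsetI)
    fix C assume "C \<in> range (lattice_class q p)"
    then show "C \<in> carrier (Pic q p)"
      unfolding carrier_Pic using keys_combination by (auto simp: lattice_class_eq lattice_divisor_def)
  next
    fix C assume "C \<in> carrier (Pic q p)"
    then obtain D where D: "C = divisor_coset ?cs D" "Poly_Mapping.keys D \<subseteq> prime_divisors"
      unfolding carrier_Pic by auto
    obtain a b c where abc: "lin_eq ?cs D (combination ?cs a b c)"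
      using spanned_carrier[OF D(2), of ?cs] by (auto simp: spanned_def)
    \<comment> \<open>Entries 0, 1 and 8 solve \<open>x0 + x1 = a\<close>,
      \<open>x0 + x8 = b\<close>, \<open>- x0 - x1 - x8 = c 3\<close>; the others are
      copied.\<close>
    define x :: lattice10 where "x = (\<chi> i. if i = 0 then a + b + c 3 else if i = 1 then - b - c 3
      else if i = 2 then c 1 else if i = 3 then c 2 else if i = 4 then c 5 else if i = 5 then c 6
      else if i = 6 then c 7 else if i = 7 then c 8 else if i = 8 then - a - c 3 else c 4)"
    have "lattice_divisor ?cs x = combination ?cs a b c"
    proof -
      have "x $ 0 + x $ 1 = a" "x $ 0 + x $ 8 = b" by (simp_all add: x_def)
      moreover have "exc_coefficients x k = c k" if "k \<in> {1..8}" for k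
        using that unfolding in_1_8 by (auto simp: exc_coefficients_def x_def)
      ultimately show ?thesis
        unfolding lattice_divisor_def using combination_cong[of "exc_coefficients x" c ?cs a b] by simp
    qed
    then have "C = lattice_class q p x" using D(1) abc by (simp add: lattice_class_eq divisor_coset_eq_iff)
    then show "C \<in> range (lattice_class q p)" by blast
  qed
qed


subsection \<open>The action of an isomorphism of marked surfaces\<close>

text \<open>\<open>map_key\<close> pulls coefficients back along a map of keys, so moving each
  divisor forward by \<beta> requires its inverse.\<close>

definition push :: "(pdiv \<Rightarrow> pdiv) \<Rightarrow> divisor \<Rightarrow> divisor" where
  "push \<beta> D = Poly_Mapping.map_key (inv_into UNIV \<beta>) D"

lemma lookup_push:
  assumes "bij \<beta>" shows "Poly_Mapping.lookup (push \<beta> D) C = Poly_Mapping.lookup D (inv_into UNIV \<beta> C)"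
  using bij_imp_bij_inv[OF assms] by (simp add: push_def map_key.rep_eq bij_is_inj)

lemma lookup_push': "bij \<beta> \<Longrightarrow> Poly_Mapping.lookup (push \<beta> D) (\<beta> C) = Poly_Mapping.lookup D C"
  by (simp add: lookup_push bij_is_inj)

lemma push_simps:
  assumes "bij \<beta>"
  shows "push \<beta> (D + E) = push \<beta> D + push \<beta> E" "push \<beta> (D - E) = push \<beta> D - push \<beta> E" "push \<beta> 0 = 0"
    "push \<beta> (scale n D) = scale n (push \<beta> D)"
  by (rule poly_mapping_eqI; simp add: lookup_push[OF assms] lookup_add lookup_minus)+

lemma push_sum: "bij \<beta> \<Longrightarrow> push \<beta> (sum f A) = (\<Sum>i\<in>A. push \<beta> (f i))"
  by (induction A rule: infinite_finite_induct) (simp_all add: push_simps)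

lemma push_prime_div: "bij \<beta> \<Longrightarrow> push \<beta> (prime_div D) = prime_div (\<beta> D)"
  by (rule poly_mapping_eqI) (auto simp: lookup_push bij_is_surj surj_f_inv_f bij_is_inj)

lemma push_comp: "bij \<beta> \<Longrightarrow> bij \<beta>' \<Longrightarrow> push \<beta>' (push \<beta> D) = push (\<lambda>D. \<beta>' (\<beta> D)) D"
proof (rule poly_mapping_eqI)
  fix C assume b: "bij \<beta>" "bij \<beta>'"
  then have b': "bij (\<lambda>D. \<beta>' (\<beta> D))" using bij_comp[of \<beta> \<beta>'] by (simp add: comp_def)
  obtain C' where "C = \<beta>' (\<beta> C')" using b by (metis bij_pointE)
  then show "Poly_Mapping.lookup (push \<beta>' (push \<beta> D)) C = Poly_Mapping.lookup (push (\<lambda>D. \<beta>' (\<beta> D)) D) C"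
    using lookup_push'[OF b', of D C'] by (simp add: lookup_push' b)
qed

lemma push_inv: "bij \<beta> \<Longrightarrow> push \<beta> (push (inv_into UNIV \<beta>) D) = D"
  by (rule poly_mapping_eqI) (simp add: lookup_push bij_imp_bij_inv inv_inv_eq bij_is_surj surj_f_inv_f)

context
  fixes cs cs' \<sigma> \<beta> assumes iso: "divisor_iso cs cs' \<sigma> \<beta>"
begin

lemma bij_\<beta>: "bij \<beta>" using iso by (simp add: divisor_iso_def)

lemma push_keys_iff:
  "Poly_Mapping.keys (push \<beta> D) \<subseteq> prime_divisors \<longleftrightarrow> Poly_Mapping.keys D \<subseteq> prime_divisors"
proof -
  have "Poly_Mapping.keys (push \<beta> D) = \<beta> ` Poly_Mapping.keys D"
  proof (rule Set.set_eqI)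
    fix C
    obtain C' where C: "C = \<beta> C'" using bij_\<beta> by (metis bij_pointE)
    show "C \<in> Poly_Mapping.keys (push \<beta> D) \<longleftrightarrow> C \<in> \<beta> ` Poly_Mapping.keys D"
      unfolding C using bij_\<beta> by (simp add: in_keys_iff lookup_push' inj_image_mem_iff bij_is_inj)
  qed
  then show ?thesis using iso by (auto simp: divisor_iso_def)
qed

text \<open>Orders along matched divisors agree for \<open>\<sigma> g\<close> and \<open>g\<close>.
  Surjectivity of \<sigma> is needed for one direction: a function on the source has to be a
  pullback.\<close>

lemma push_principal_iff: "push \<beta> D \<in> principal cs' \<longleftrightarrow> D \<in> principal cs"
proof -
  have \<sigma>: "chom \<sigma>" "surj \<sigma>" using iso by (auto simp: divisor_iso_def)
  have all: "(\<forall>C\<in>prime_divisors. Q C) \<longleftrightarrow> (\<forall>C\<in>prime_divisors. Q (\<beta> C))" for Q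
  proof -
    have "\<beta> ` prime_divisors = prime_divisors"
    proof (rule Set.set_eqI)
      fix C
      obtain C' where C: "C = \<beta> C'" using bij_\<beta> by (metis bij_pointE)
      show "C \<in> \<beta> ` prime_divisors \<longleftrightarrow> C \<in> prime_divisors"
        unfolding C using iso bij_\<beta> by (simp add: divisor_iso_def inj_image_mem_iff bij_is_inj)
    qed
    then show ?thesis by (metis (mono_tags, lifting) ball_imageD imageE)
  qed
  have "(\<forall>C\<in>prime_divisors. Poly_Mapping.lookup (push \<beta> D) C = ord_at cs' C f) \<longleftrightarrow>
      (\<forall>C\<in>prime_divisors. Poly_Mapping.lookup D C = ord_at cs C (\<sigma> f))" if "f \<noteq> 0" for f
    using iso that unfolding all[of "\<lambda>C. Poly_Mapping.lookup (push \<beta> D) C = ord_at cs' C f"] lookup_push'[OF bij_\<beta>]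
    by (auto simp: divisor_iso_def)
  then have "(\<exists>f. f \<noteq> 0 \<and> (\<forall>C\<in>prime_divisors. Poly_Mapping.lookup (push \<beta> D) C = ord_at cs' C f)) \<longleftrightarrow>
      (\<exists>f. f \<noteq> 0 \<and> (\<forall>C\<in>prime_divisors. Poly_Mapping.lookup D C = ord_at cs C (\<sigma> f)))" by blast
  also have "\<dots> \<longleftrightarrow> (\<exists>f. f \<noteq> 0 \<and> (\<forall>C\<in>prime_divisors. Poly_Mapping.lookup D C = ord_at cs C f))"
  proof
    assume "\<exists>f. f \<noteq> 0 \<and> (\<forall>C\<in>prime_divisors. Poly_Mapping.lookup D C = ord_at cs C f)"
    then obtain f where f: "f \<noteq> 0" "\<forall>C\<in>prime_divisors. Poly_Mapping.lookup D C = ord_at cs C f" by blast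
    obtain g where "f = \<sigma> g" using \<sigma>(2) by blast
    then show "\<exists>f. f \<noteq> 0 \<and> (\<forall>C\<in>prime_divisors. Poly_Mapping.lookup D C = ord_at cs C (\<sigma> f))"
      using f chom_0[OF \<sigma>(1)] by (intro exI[of _ g]) auto
  qed (use chom_eq_0_iff[OF \<sigma>(1)] in blast)
  finally show ?thesis by (simp add: principal_def push_keys_iff)
qed

lemma push_lin_eq_iff: "lin_eq cs' (push \<beta> D) (push \<beta> E) \<longleftrightarrow> lin_eq cs D E"
  by (simp add: lin_eq_def push_principal_iff flip: push_simps(2)[OF bij_\<beta>])

lemma push_coset: "push \<beta> ` divisor_coset cs D = divisor_coset cs' (push \<beta> D)"
proof (intro equalityI subsetI)
  fix E assume "E \<in> divisor_coset cs' (push \<beta> D)"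
  then have "push (inv_into UNIV \<beta>) E \<in> divisor_coset cs D"
    using push_lin_eq_iff[of "push (inv_into UNIV \<beta>) E" D] by (simp add: divisor_coset_def push_inv bij_\<beta>)
  then show "E \<in> push \<beta> ` divisor_coset cs D" using push_inv[OF bij_\<beta>] by (metis imageI)
qed (auto simp: divisor_coset_def push_lin_eq_iff)

end

lemma push_iso:
  assumes iso: "divisor_iso (center q p) (center q' p') \<sigma> \<beta>"
  shows "(\<lambda>C. push \<beta> ` C) \<in> Group.iso (Pic q p) (Pic q' p')"
proof -
  let ?cs = "center q p" and ?cs' = "center q' p'"
  note c = push_coset[OF iso] and b = bij_\<beta>[OF iso]
  have keys: "Poly_Mapping.keys (push \<beta> D) \<subseteq> prime_divisors \<longleftrightarrow> Poly_Mapping.keys D \<subseteq> prime_divisors" for D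
    by (rule push_keys_iff[OF iso])
  have "(\<lambda>C. push \<beta> ` C) \<in> hom (Pic q p) (Pic q' p')"
  proof (rule homI)
    fix C assume "C \<in> carrier (Pic q p)"
    then show "push \<beta> ` C \<in> carrier (Pic q' p')"
      unfolding carrier_Pic using keys by (auto simp: c)
  next
    fix C C' assume "C \<in> carrier (Pic q p)" "C' \<in> carrier (Pic q p)"
    then obtain D D' where "C = divisor_coset ?cs D" "C' = divisor_coset ?cs D'"
      unfolding carrier_Pic by auto
    then show "push \<beta> ` (C \<otimes>\<^bsub>Pic q p\<^esub> C') = push \<beta> ` C \<otimes>\<^bsub>Pic q' p'\<^esub> push \<beta> ` C'"
      by (simp only: c mult_Pic push_simps[OF b])
  qed
  moreover have "bij_betw (\<lambda>C. push \<beta> ` C) (carrier (Pic q p)) (carrier (Pic q' p'))"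
  proof (rule bij_betw_imageI)
    have "inj (push \<beta>)"
      by (rule injI, rule poly_mapping_eqI) (metis lookup_push' b)
    then show "inj_on (\<lambda>C. push \<beta> ` C) (carrier (Pic q p))"
      by (auto simp: inj_on_def inj_image_eq_iff)
    show "(\<lambda>C. push \<beta> ` C) ` carrier (Pic q p) = carrier (Pic q' p')"
    proof (intro equalityI subsetI)
      fix C assume "C \<in> carrier (Pic q' p')"
      then obtain D where D: "C = divisor_coset ?cs' D" "Poly_Mapping.keys D \<subseteq> prime_divisors"
        unfolding carrier_Pic by auto
      let ?E = "push (inv_into UNIV \<beta>) D"
      have "C = push \<beta> ` divisor_coset ?cs ?E" by (simp add: c push_inv[OF b] D)
      moreover have "Poly_Mapping.keys ?E \<subseteq> prime_divisors" using keys[of ?E] D by (simp add: push_inv[OF b])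
      ultimately show "C \<in> (\<lambda>C. push \<beta> ` C) ` carrier (Pic q p)" unfolding carrier_Pic by blast
    next
      fix C assume "C \<in> (\<lambda>C. push \<beta> ` C) ` carrier (Pic q p)"
      then show "C \<in> carrier (Pic q' p')" unfolding carrier_Pic using keys by (auto simp: c)
    qed
  qed
  ultimately show ?thesis by (simp add: Group.iso_def)
qed

lemma push_acts_by_images:
  assumes iso: "divisor_iso (center q p) (center q p') \<sigma> \<beta>" and Y: "\<sigma> y_fun = Y" and X: "\<sigma> xi_fun = X"
  shows "acts_by_images q p p' Y X (\<lambda>C. push \<beta> ` C)"
  unfolding acts_by_images_def
proof
  fix D assume D: "D \<in> prime_divisors"
  have \<sigma>: "chom \<sigma>" and D': "\<beta> D \<in> prime_divisors"
    and ord: "\<And>f. f \<noteq> 0 \<Longrightarrow> ord_at (center q p) D (\<sigma> f) = ord_at (center q p') (\<beta> D) f"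
    using iso D by (auto simp: divisor_iso_def)
  have "subst f Y X = \<sigma> f" for f using chom_eq_subst[OF \<sigma>, of f] Y X by simp
  moreover have "(f = 0 \<or> 0 \<le> ord_at (center q p') (\<beta> D) f \<longrightarrow> \<sigma> f = 0 \<or> 0 \<le> ord_at (center q p) D (\<sigma> f)) \<and>
      (f = 0 \<or> 0 < ord_at (center q p') (\<beta> D) f \<longrightarrow> \<sigma> f = 0 \<or> 0 < ord_at (center q p) D (\<sigma> f))" for f
    using ord[of f] chom_eq_0_iff[OF \<sigma>] by (cases "f = 0") simp_all
  ultimately have "image_divisor q p p' Y X D (\<beta> D)"
    by (simp add: image_divisor_def regular_along_def vanishes_along_def ord_along_eq)
  moreover have "push \<beta> ` div_class q p (prime_div D) = div_class q p' (prime_div (\<beta> D))"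
    by (simp add: div_class_eq push_coset[OF iso] push_prime_div bij_\<beta>[OF iso])
  ultimately show "\<exists>D'\<in>prime_divisors. image_divisor q p p' Y X D D' \<and>
     push \<beta> ` div_class q p (prime_div D) = div_class q p' (prime_div D')"
    using D' by blast
qed

subsection \<open>The map as a composition of elementary transformations\<close>

text \<open>A triple \<open>(a, b, c)\<close> stands for the class \<open>a \<H>\<^sub>y + b \<H>\<^sub>\<xi> + \<Sum> c\<^sub>k \<F>\<^sub>k\<close>.\<close>

type_synonym coordinates = "int \<times> int \<times> (nat \<Rightarrow> int)"

fun combination_of :: "(nat \<Rightarrow> P1 \<times> P1) \<Rightarrow> coordinates \<Rightarrow> divisor" where
  "combination_of cs (a, b, c) = combination cs a b c"

text \<open>Hiding \<beta> and keeping only its effect on coefficients, up to linear equivalence,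
  turns the composition of the steps into a calculation with integers.\<close>

definition realizes :: "(nat \<Rightarrow> P1 \<times> P1) \<Rightarrow> (nat \<Rightarrow> P1 \<times> P1) \<Rightarrow> (ratfun \<Rightarrow> ratfun) \<Rightarrow>
    (coordinates \<Rightarrow> coordinates) \<Rightarrow> bool" where
  "realizes cs cs' \<sigma> L \<longleftrightarrow> (\<exists>\<beta>. divisor_iso cs cs' \<sigma> \<beta> \<and>
     (\<forall>w. lin_eq cs' (push \<beta> (combination_of cs w)) (combination_of cs' (L w))))"

lemma realizes_comp:
  assumes "realizes cs cs' \<sigma> L" "realizes cs' cs'' \<sigma>' L'"
  shows "realizes cs cs'' (\<lambda>f. \<sigma> (\<sigma>' f)) (\<lambda>w. L' (L w))"
proof -
  obtain \<beta> \<beta>' where b: "divisor_iso cs cs' \<sigma> \<beta>" "divisor_iso cs' cs'' \<sigma>' \<beta>'"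
    and L: "\<And>w. lin_eq cs' (push \<beta> (combination_of cs w)) (combination_of cs' (L w))"
      "\<And>w. lin_eq cs'' (push \<beta>' (combination_of cs' w)) (combination_of cs'' (L' w))"
    using assms by (auto simp: realizes_def)
  have "lin_eq cs'' (push (\<lambda>D. \<beta>' (\<beta> D)) (combination_of cs w)) (combination_of cs'' (L' (L w)))" for w
    unfolding push_comp[OF bij_\<beta>[OF b(1)] bij_\<beta>[OF b(2)], symmetric]
    using L(1)[of w] L(2)[of "L w"] push_lin_eq_iff[OF b(2)] lin_eq_trans by blast
  then show ?thesis using divisor_iso_comp[OF b] by (auto simp: realizes_def)
qed

lemma push_combination:
  assumes "divisor_iso cs cs' \<sigma> \<beta>"
  shows "push \<beta> (combination cs a b c) =
    scale a (prime_div (\<beta> Line_y_inf) + (\<Sum>k\<in>{1..8}. if fst (cs k) = Infty then prime_div (\<beta> (Exc k)) else 0)) +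
    scale b (prime_div (\<beta> Line_xi_inf) + (\<Sum>k\<in>{1..8}. if snd (cs k) = Infty then prime_div (\<beta> (Exc k)) else 0)) +
    (\<Sum>k\<in>{1..8}. scale (c k) (prime_div (\<beta> (Exc k))))"
proof -
  note b = bij_\<beta>[OF assms]
  show ?thesis
    by (simp add: combination_def y_fibre_def xi_fibre_def push_simps[OF b] push_sum[OF b] push_prime_div[OF b]
        if_distrib[of "push \<beta>"] cong: if_cong)
qed

lemma sum_remove_two:
  fixes f :: "nat \<Rightarrow> divisor"
  assumes "finite A" "k \<in> A" "l \<in> A" "k \<noteq> l"
  shows "(\<Sum>j\<in>A. f j) = f k + f l + (\<Sum>j\<in>A - {k, l}. f j)"
proof -
  have "A = insert k (insert l (A - {k, l}))" using assms by auto
  then show ?thesis using assms by (metis (no_types, lifting) Diff_iff add.assoc finite_Diff finite_insert insert_iff sum.insert)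
qed

text \<open>Linear extension of \<open>H_y \<mapsto> H_y + H_\<xi> - F_k - F_l\<close>,
  \<open>F_k \<mapsto> H_\<xi> - F_k\<close> and \<open>F_l \<mapsto> H_\<xi> - F_l\<close>, all
  other classes being fixed.\<close>

fun twist_action :: "nat \<Rightarrow> nat \<Rightarrow> coordinates \<Rightarrow> coordinates" where
  "twist_action k l (a, b, c) = (a, b + a + c k + c l, c(k := - a - c k, l := - a - c l))"

lemma twist_realizes:
  assumes ab: "a \<noteq> b" and kl: "k \<in> {1..8}" "l \<in> {1..8}" "k \<noteq> l"
    and k: "cs k = (Fin 0, Fin b)" "cs' k = (Infty, Fin b)"
    and l: "cs l = (Infty, Fin a)" "cs' l = (Fin 0, Fin a)"
    and others: "\<And>j. j \<in> {1..8} \<Longrightarrow> j \<noteq> k \<Longrightarrow> j \<noteq> l \<Longrightarrow>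
      snd (cs j) \<notin> {Fin a, Fin b} \<and> cs j \<noteq> (Infty, Infty) \<and> cs' j = twist_point a b (cs j)"
  obtains \<sigma> where "realizes cs cs' \<sigma> (twist_action k l)"
    "\<sigma> y_fun = y_fun * ((xi_fun - const_fun a) / (xi_fun - const_fun b))" "\<sigma> xi_fun = xi_fun"
proof -
  obtain \<sigma> \<beta> where iso: "divisor_iso cs cs' \<sigma> \<beta>"
    and \<sigma>: "\<sigma> y_fun = y_fun * ((xi_fun - const_fun a) / (xi_fun - const_fun b))" "\<sigma> xi_fun = xi_fun"
    and \<beta>: "\<beta> (Exc k) = Curve (line_xi b)" "\<beta> (Exc l) = Curve (line_xi a)"
      "\<And>j. j \<in> {1..8} \<Longrightarrow> j \<noteq> k \<Longrightarrow> j \<noteq> l \<Longrightarrow> \<beta> (Exc j) = Exc j"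
      "\<beta> Line_y_inf = Line_y_inf" "\<beta> Line_xi_inf = Line_xi_inf"
    using twist_step[OF assms] by blast
  let ?F = "\<lambda>k. prime_div (Exc k)"
  note two = sum_remove_two[OF finite_atLeastAtMost kl]
  have tw: "snd (twist_point a b P) = snd P" "fst (twist_point a b P) = Infty \<longleftrightarrow> fst P = Infty"
    if "P \<noteq> (Infty, Infty)" for P
    by (cases "(a, b, P)" rule: twist_point.cases; simp)+
  have snd': "snd (cs' j) = snd (cs j) \<and> snd (cs j) \<notin> {Fin a, Fin b} \<and> (fst (cs' j) = Infty \<longleftrightarrow> fst (cs j) = Infty)"
    if "j \<in> {1..8} - {k, l}" for j
    using others[of j] that tw[of "cs j"] by simp
  \<comment> \<open>\<open>G j\<close> is equivalent to the image of the j-th exceptional curve. For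
    \<open>k\<close> and \<open>l\<close> this image is a line \<open>\<xi> = b\<close> or
    \<open>\<xi> = a\<close>, which passes through exactly one centre of the target.\<close>
  define G where "G j = (if j = k \<or> j = l then xi_fibre cs' - ?F j else ?F j)" for j
  have "(\<Sum>j\<in>{1..8} - {k, l}. if snd (cs' j) = Fin b then ?F j else 0) = 0"
    by (intro sum.neutral) (use snd' in auto)
  then have "(\<Sum>j\<in>{1..8}. if snd (cs' j) = Fin b then ?F j else 0) = ?F k"
    unfolding two using k l ab by simp
  then have Gk: "lin_eq cs' (prime_div (\<beta> (Exc k))) (G k)"
    using line_xi_lin_eq[of cs' b] by (simp add: \<beta> G_def)
  have "(\<Sum>j\<in>{1..8} - {k, l}. if snd (cs' j) = Fin a then ?F j else 0) = 0"
    by (intro sum.neutral) (use snd' in auto)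
  then have "(\<Sum>j\<in>{1..8}. if snd (cs' j) = Fin a then ?F j else 0) = ?F l"
    unfolding two using k l ab by simp
  then have Gl: "lin_eq cs' (prime_div (\<beta> (Exc l))) (G l)"
    using line_xi_lin_eq[of cs' a] by (simp add: \<beta> G_def)
  have G: "lin_eq cs' (prime_div (\<beta> (Exc j))) (G j)" if "j \<in> {1..8}" for j
    using Gk Gl \<beta>(3)[OF that] lin_eq_refl by (cases "j = k \<or> j = l") (auto simp: G_def)
  have "lin_eq cs' (push \<beta> (combination_of cs w)) (combination_of cs' (twist_action k l w))" for w
  proof -
    obtain m n c where w: "w = (m, n, c)" by (rule prod_cases3)
    have "lin_eq cs' (push \<beta> (combination cs m n c))
        (scale m (prime_div Line_y_inf + (\<Sum>j\<in>{1..8}. if fst (cs j) = Infty then G j else 0)) +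
         scale n (prime_div Line_xi_inf + (\<Sum>j\<in>{1..8}. if snd (cs j) = Infty then G j else 0)) +
         (\<Sum>j\<in>{1..8}. scale (c j) (G j)))"
      unfolding push_combination[OF iso] \<beta>(4,5)
      by (intro lin_eq_add lin_eq_scale lin_eq_sum) (auto simp: lin_eq_refl G)
    also have "prime_div Line_y_inf + (\<Sum>j\<in>{1..8}. if fst (cs j) = Infty then G j else 0) =
        y_fibre cs' + xi_fibre cs' - ?F k - ?F l"
    proof -
      have "(\<Sum>j\<in>{1..8}-{k,l}. if fst (cs j) = Infty then G j else 0) =
          (\<Sum>j\<in>{1..8}-{k,l}. if fst (cs' j) = Infty then ?F j else 0)"
        by (intro sum.cong) (auto simp: G_def snd')
      then show ?thesis unfolding y_fibre_def two using k l kl by (simp add: G_def)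
    qed
    also have "prime_div Line_xi_inf + (\<Sum>j\<in>{1..8}. if snd (cs j) = Infty then G j else 0) = xi_fibre cs'"
    proof -
      have "(\<Sum>j\<in>{1..8}-{k,l}. if snd (cs j) = Infty then G j else 0) =
          (\<Sum>j\<in>{1..8}-{k,l}. if snd (cs' j) = Infty then ?F j else 0)"
        by (intro sum.cong) (auto simp: G_def snd')
      then show ?thesis unfolding xi_fibre_def two using k l kl by simp
    qed
    also have "scale m (y_fibre cs' + xi_fibre cs' - ?F k - ?F l) + scale n (xi_fibre cs') +
        (\<Sum>j\<in>{1..8}. scale (c j) (G j)) = combination_of cs' (twist_action k l w)"
    proof -
      have "(\<Sum>j\<in>{1..8}-{k,l}. scale (c j) (G j)) =
          (\<Sum>j\<in>{1..8}-{k,l}. scale ((c(k := - m - c k, l := - m - c l)) j) (?F j))"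
        by (intro sum.cong) (auto simp: G_def)
      then show ?thesis unfolding w twist_action.simps combination_of.simps combination_def two
        using kl by (simp add: G_def scale_simps algebra_simps)
    qed
    finally show ?thesis by (simp add: w)
  qed
  then have "realizes cs cs' \<sigma> (twist_action k l)" using iso by (auto simp: realizes_def)
  then show thesis using that \<sigma> by blast
qed

fun swap_action :: "coordinates \<Rightarrow> coordinates" where
  "swap_action (a, b, c) = (b, a, c)"

lemma rotation_realizes:
  assumes C: "C \<noteq> 0" and cs': "\<And>j. j \<in> {1..8} \<Longrightarrow> cs' j = rotate_point C (cs j)"
  obtains \<sigma> where "realizes cs cs' \<sigma> swap_action"
    "\<sigma> y_fun = xi_fun" "\<sigma> xi_fun = const_fun C / y_fun"
proof -
  obtain \<sigma> \<beta> where iso: "divisor_iso cs cs' \<sigma> \<beta>"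
    and \<sigma>: "\<sigma> y_fun = xi_fun" "\<sigma> xi_fun = const_fun C / y_fun"
    and \<beta>: "\<And>j. j \<in> {1..8} \<Longrightarrow> \<beta> (Exc j) = Exc j"
      "\<beta> Line_y_inf = Curve (line_xi 0)" "\<beta> Line_xi_inf = Line_y_inf"
    using rotation_step[of C cs' cs, OF C cs'] by blast
  let ?F = "\<lambda>k. prime_div (Exc k)"
  have rot: "snd (rotate_point C P) = Fin 0 \<longleftrightarrow> fst P = Infty" "fst (rotate_point C P) = snd P" for P
    using C by (cases "(C, P)" rule: rotate_point.cases; simp)+
  have "lin_eq cs' (push \<beta> (combination_of cs w)) (combination_of cs' (swap_action w))" for w
  proof -
    obtain m n c where w: "w = (m, n, c)" by (rule prod_cases3)
    let ?s = "\<Sum>j\<in>{1..8}. if snd (cs' j) = Fin 0 then ?F j else 0"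
    have "(\<Sum>j\<in>{1..8}. if fst (cs j) = Infty then prime_div (\<beta> (Exc j)) else 0) = ?s"
      by (intro sum.cong) (auto simp: \<beta> cs' rot)
    moreover have "(\<Sum>j\<in>{1..8}. if snd (cs j) = Infty then prime_div (\<beta> (Exc j)) else 0) =
        (\<Sum>j\<in>{1..8}. if fst (cs' j) = Infty then ?F j else 0)"
      by (intro sum.cong) (auto simp: \<beta> cs' rot)
    moreover have "(\<Sum>j\<in>{1..8}. scale (c j) (prime_div (\<beta> (Exc j)))) = (\<Sum>j\<in>{1..8}. scale (c j) (?F j))"
      by (intro sum.cong) (auto simp: \<beta>)
    ultimately have "push \<beta> (combination cs m n c) =
        scale m (prime_div (Curve (line_xi 0)) + ?s) + scale n (y_fibre cs') + (\<Sum>j\<in>{1..8}. scale (c j) (?F j))"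
      unfolding push_combination[OF iso] \<beta>(2,3) y_fibre_def by simp
    moreover have "lin_eq cs' \<dots> (scale m (xi_fibre cs' - ?s + ?s) + scale n (y_fibre cs') + (\<Sum>j\<in>{1..8}. scale (c j) (?F j)))"
      by (intro lin_eq_add lin_eq_scale lin_eq_refl line_xi_lin_eq)
    ultimately show ?thesis by (simp add: w combination_def add.commute)
  qed
  then have "realizes cs cs' \<sigma> swap_action" using iso by (auto simp: realizes_def)
  then show thesis using that \<sigma> by blast
qed

text \<open>For an involution, moving the curves by \<pi> and permuting the coefficients by \<pi>
  are the same operation.\<close>

lemma relabel_realizes:
  assumes \<pi>: "\<pi> permutes {1..8}" and inv: "\<And>k. \<pi> (\<pi> k) = k" and cs': "\<And>k. k \<in> {1..8} \<Longrightarrow> cs' (\<pi> k) = cs k"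
  shows "realizes cs cs' (\<lambda>f. f) (\<lambda>(a, b, c). (a, b, \<lambda>k. c (\<pi> k)))"
proof -
  let ?\<beta> = "\<lambda>D. case D of Exc k \<Rightarrow> Exc (\<pi> k) | _ \<Rightarrow> D"
  have iso: "divisor_iso cs cs' (\<lambda>f. f) ?\<beta>" by (rule relabel_step[of \<pi> cs' cs, OF \<pi> cs'])
  have re: "(\<Sum>k\<in>{1..8}. g k) = (\<Sum>k\<in>{1..8}. g (\<pi> k))" for g :: "nat \<Rightarrow> divisor"
    using sum.permute[OF \<pi>, of g] by (simp add: comp_def)
  have "y_fibre cs' = prime_div Line_y_inf + (\<Sum>k\<in>{1..8}. if fst (cs k) = Infty then prime_div (Exc (\<pi> k)) else 0)"
    unfolding y_fibre_def by (subst re) (auto intro!: sum.cong simp: cs')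
  moreover have "xi_fibre cs' = prime_div Line_xi_inf + (\<Sum>k\<in>{1..8}. if snd (cs k) = Infty then prime_div (Exc (\<pi> k)) else 0)"
    unfolding xi_fibre_def by (subst re) (auto intro!: sum.cong simp: cs')
  moreover have "(\<Sum>k\<in>{1..8}. scale (c (\<pi> k)) (prime_div (Exc k))) = (\<Sum>k\<in>{1..8}. scale (c k) (prime_div (Exc (\<pi> k))))" for c
    by (subst re) (simp add: inv)
  ultimately have "push ?\<beta> (combination cs a b c) = combination cs' a b (\<lambda>k. c (\<pi> k))" for a b c
    unfolding push_combination[OF iso] unfolding combination_def by (simp cong: if_cong)
  then show ?thesis unfolding realizes_def using iso lin_eq_refl by (intro exI[of _ ?\<beta>]) auto
qed

text \<open>The lists \<open>cs1\<close> to \<open>cs6\<close> record the eight points after each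
  elementary transformation. The inequalities ensure that every twist finds no further marked point
  on its two rows.\<close>

lemma phi_realizes:
  fixes a1 a2 a3 a4 x5 x6 x7 x8 q :: complex
  assumes nz: "a1 \<noteq> 0" "a2 \<noteq> 0" "a3 \<noteq> 0" "a4 \<noteq> 0" "x5 \<noteq> 0" "x6 \<noteq> 0" "x7 \<noteq> 0" "x8 \<noteq> 0" "q \<noteq> 0"
    and rel: "q * a3 * a4 * x5 * x6 = a1 * a2 * x7 * x8"
    and distinct: "a1 \<noteq> a2" "a3 \<noteq> a4" "x8 \<noteq> x5" "x6 \<noteq> x5" "x6 \<noteq> x8" "x7 \<noteq> x5" "x7 \<noteq> x8"
      "q * x6 \<noteq> x7" "q * x8 \<noteq> x7" "x5 \<noteq> q * x6"
      "a3 * x5 \<noteq> a1 * x8" "a4 * x5 \<noteq> a1 * x8" "a3 * x5 \<noteq> a2 * x8" "a4 * x5 \<noteq> a2 * x8"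
    and cs: "\<And>k. cs k = [(Fin a1, Fin 0), (Fin a2, Fin 0), (Fin a3, Infty), (Fin a4, Infty),
        (Fin 0, Fin x5), (Fin 0, Fin x6), (Infty, Fin x7), (Infty, Fin x8)] ! (k - 1)"
    and cs': "\<And>k. cs' k = [(Fin a1, Fin 0), (Fin a2, Fin 0), (Fin a3, Infty), (Fin a4, Infty),
        (Fin 0, Fin (x5 / q)), (Fin 0, Fin x6), (Infty, Fin (x7 / q)), (Infty, Fin x8)] ! (k - 1)"
    and eta: "\<eta> = y_fun * ((xi_fun - const_fun x8) / (xi_fun - const_fun x5))"
    and X: "X = const_fun (x6 * x8) / (xi_fun *
        ((const_fun (a3 * a4) / \<eta> - const_fun a4) / (const_fun (a3 * a4) / \<eta> - const_fun (a3 * a4 * x5 / (a1 * x8)))) *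
        ((const_fun (a3 * a4) / \<eta> - const_fun a3) / (const_fun (a3 * a4) / \<eta> - const_fun (a3 * a4 * x5 / (a2 * x8)))))"
    and Y: "Y = const_fun (a3 * a4) / \<eta> * ((X - const_fun x6) / (X - const_fun (x7 / q)))"
  obtains \<sigma> \<pi> where "realizes cs cs' \<sigma> (\<lambda>w. (\<lambda>(a, b, c). (a, b, \<lambda>k. c (\<pi> k)))
      (twist_action 5 8 (swap_action (twist_action 2 4 (twist_action 1 3 (swap_action (twist_action 5 8 w)))))))"
    "\<And>k. k \<in> {1..8} \<Longrightarrow> \<pi> k = [2, 1, 4, 3, 7, 8, 5, 6] ! (k - 1)"
    "\<sigma> y_fun = Y" "\<sigma> xi_fun = X"
proof -
  \<comment> \<open>\<open>f1\<close> and \<open>f2\<close> are where \<open>a1\<close> and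
    \<open>a2\<close> end up after the first twist, which scales them by \<open>x8 / x5\<close>, and
    the first rotation, which inverts them. \<open>h5\<close> and \<open>h7\<close> are the
    positions of \<open>x5\<close> and \<open>x7\<close> after both middle twists.\<close>
  define f1 where "f1 = a3 * a4 * x5 / (a1 * x8)"
  define f2 where "f2 = a3 * a4 * x5 / (a2 * x8)"
  define h5 where "h5 = a1 * a2 * x8 ^ 2 / (x5 * a3 * a4)"
  define h7 where "h7 = a1 * a2 * x7 * x8 ^ 2 / (x5 ^ 2 * a3 * a4)"
  have f: "f1 \<noteq> 0" "f2 \<noteq> 0" "f1 \<noteq> a4" "f1 \<noteq> a3" "f2 \<noteq> a4" "f2 \<noteq> a3" "f1 \<noteq> f2"
    using nz distinct by (auto simp: f1_def f2_def divide_simps)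
  have h: "h5 \<noteq> 0" "h7 \<noteq> 0" using nz by (auto simp: h5_def h7_def)
  define cs1 where "cs1 k = [(Fin (a1 * x8 / x5), Fin 0), (Fin (a2 * x8 / x5), Fin 0), (Fin a3, Infty), (Fin a4, Infty),
     (Infty, Fin x5), (Fin 0, Fin x6), (Infty, Fin x7), (Fin 0, Fin x8)] ! (k - 1)" for k
  define cs2 where "cs2 k = [(Fin 0, Fin f1), (Fin 0, Fin f2), (Infty, Fin a4), (Infty, Fin a3),
     (Fin x5, Fin 0), (Fin x6, Infty), (Fin x7, Fin 0), (Fin x8, Infty)] ! (k - 1)" for k
  define cs3 where "cs3 k = [(Infty, Fin f1), (Fin 0, Fin f2), (Fin 0, Fin a4), (Infty, Fin a3),
     (Fin (x5 * a4 / f1), Fin 0), (Fin x6, Infty), (Fin (x7 * a4 / f1), Fin 0), (Fin x8, Infty)] ! (k - 1)" for k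
  define cs4 where "cs4 k = [(Infty, Fin f1), (Infty, Fin f2), (Fin 0, Fin a4), (Fin 0, Fin a3),
     (Fin h5, Fin 0), (Fin x6, Infty), (Fin h7, Fin 0), (Fin x8, Infty)] ! (k - 1)" for k
  define cs5 where "cs5 k = [(Fin f1, Fin 0), (Fin f2, Fin 0), (Fin a4, Infty), (Fin a3, Infty),
     (Fin 0, Fin (x7 / q)), (Infty, Fin x8), (Fin 0, Fin (x5 / q)), (Infty, Fin x6)] ! (k - 1)" for k
  define cs6 where "cs6 k = [(Fin a2, Fin 0), (Fin a1, Fin 0), (Fin a4, Infty), (Fin a3, Infty),
     (Infty, Fin (x7 / q)), (Infty, Fin x8), (Fin 0, Fin (x5 / q)), (Fin 0, Fin x6)] ! (k - 1)" for k
  obtain \<sigma>1 where 1: "realizes cs cs1 \<sigma>1 (twist_action 5 8)"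
    "\<sigma>1 y_fun = y_fun * ((xi_fun - const_fun x8) / (xi_fun - const_fun x5))" "\<sigma>1 xi_fun = xi_fun"
  proof (rule twist_realizes[of x8 x5 5 8 cs cs1])
    fix j :: nat assume "j \<in> {1..8}" "j \<noteq> 5" "j \<noteq> 8"
    then show "snd (cs j) \<notin> {Fin x8, Fin x5} \<and> cs j \<noteq> (Infty, Infty) \<and> cs1 j = twist_point x8 x5 (cs j)"
      unfolding in_1_8 using nz distinct by (elim disjE) (simp_all add: cs cs1_def)
  qed (use distinct in \<open>simp_all add: cs cs1_def\<close>)
  \<comment> \<open>The constant \<open>a3 * a4\<close> sends \<open>(a3, \<infinity>)\<close> to
    \<open>(\<infinity>, a4)\<close> and \<open>(a4, \<infinity>)\<close> to
    \<open>(\<infinity>, a3)\<close>, as needed for the centres of the next two twists.\<close>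
  obtain \<sigma>2 where 2: "realizes cs1 cs2 \<sigma>2 swap_action"
    "\<sigma>2 y_fun = xi_fun" "\<sigma>2 xi_fun = const_fun (a3 * a4) / y_fun"
  proof (rule rotation_realizes[of "a3 * a4" cs2 cs1])
    fix j :: nat assume "j \<in> {1..8}"
    then show "cs2 j = rotate_point (a3 * a4) (cs1 j)"
      unfolding in_1_8 using nz by (elim disjE) (simp_all add: cs2_def cs1_def f1_def f2_def)
  qed (use nz in simp_all)
  obtain \<sigma>3 where 3: "realizes cs2 cs3 \<sigma>3 (twist_action 1 3)"
    "\<sigma>3 y_fun = y_fun * ((xi_fun - const_fun a4) / (xi_fun - const_fun f1))" "\<sigma>3 xi_fun = xi_fun"
  proof (rule twist_realizes[of a4 f1 1 3 cs2 cs3])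
    fix j :: nat assume "j \<in> {1..8}" "j \<noteq> 1" "j \<noteq> 3"
    then show "snd (cs2 j) \<notin> {Fin a4, Fin f1} \<and> cs2 j \<noteq> (Infty, Infty) \<and> cs3 j = twist_point a4 f1 (cs2 j)"
      unfolding in_1_8 using nz f distinct by (elim disjE) (simp_all add: cs2_def cs3_def)
  qed (use f in \<open>simp_all add: cs2_def cs3_def\<close>)
  obtain \<sigma>4 where 4: "realizes cs3 cs4 \<sigma>4 (twist_action 2 4)"
    "\<sigma>4 y_fun = y_fun * ((xi_fun - const_fun a3) / (xi_fun - const_fun f2))" "\<sigma>4 xi_fun = xi_fun"
  proof (rule twist_realizes[of a3 f2 2 4 cs3 cs4])
    fix j :: nat assume "j \<in> {1..8}" "j \<noteq> 2" "j \<noteq> 4"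
    then show "snd (cs3 j) \<notin> {Fin a3, Fin f2} \<and> cs3 j \<noteq> (Infty, Infty) \<and> cs4 j = twist_point a3 f2 (cs3 j)"
      unfolding in_1_8 using nz f distinct
      by (elim disjE) (simp_all add: cs3_def cs4_def h5_def h7_def f1_def f2_def power2_eq_square mult_ac)
  qed (use f in \<open>simp_all add: cs3_def cs4_def\<close>)
  \<comment> \<open>The constant \<open>x6 * x8\<close> interchanges \<open>x6\<close> and
    \<open>x8\<close>. Given this choice, \<open>rel\<close> is the condition that \<open>h5\<close>
    and \<open>h7\<close> go to \<open>x7 / q\<close> and \<open>x5 / q\<close>.\<close>
  obtain \<sigma>5 where 5: "realizes cs4 cs5 \<sigma>5 swap_action"
    "\<sigma>5 y_fun = xi_fun" "\<sigma>5 xi_fun = const_fun (x6 * x8) / y_fun"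
  proof (rule rotation_realizes[of "x6 * x8" cs5 cs4])
    have "x6 * x8 / h5 = x7 / q" "x6 * x8 / h7 = x5 / q"
      using nz rel by (simp_all add: h5_def h7_def field_simps power2_eq_square)
    then show "cs5 j = rotate_point (x6 * x8) (cs4 j)" if "j \<in> {1..8}" for j
      using that unfolding in_1_8 using nz h by (elim disjE) (simp_all add: cs4_def cs5_def)
  qed (use nz in simp_all)
  obtain \<sigma>6 where 6: "realizes cs5 cs6 \<sigma>6 (twist_action 5 8)"
    "\<sigma>6 y_fun = y_fun * ((xi_fun - const_fun x6) / (xi_fun - const_fun (x7 / q)))" "\<sigma>6 xi_fun = xi_fun"
  proof (rule twist_realizes[of x6 "x7 / q" 5 8 cs5 cs6])
    have e: "f1 * x6 * q / x7 = a2" "f2 * x6 * q / x7 = a1"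
      using nz rel by (simp_all add: f1_def f2_def field_simps)
    have d: "x6 \<noteq> x7 / q" "x8 \<noteq> x7 / q" "x5 / q \<noteq> x6" "x5 / q \<noteq> x7 / q"
      using nz distinct by (simp_all add: field_simps)
    fix j :: nat assume "j \<in> {1..8}" "j \<noteq> 5" "j \<noteq> 8"
    then show "snd (cs5 j) \<notin> {Fin x6, Fin (x7 / q)} \<and> cs5 j \<noteq> (Infty, Infty) \<and> cs6 j = twist_point x6 (x7 / q) (cs5 j)"
      unfolding in_1_8 using nz d e distinct by (elim disjE) (simp_all add: cs5_def cs6_def)
  qed (use nz distinct in \<open>simp_all add: cs5_def cs6_def field_simps\<close>)
  \<comment> \<open>After the last twist the points are those of the target surface, but in a
    different order.\<close>
  define \<pi> where "\<pi> k = (if k \<in> {1..8} then [2, 1, 4, 3, 7, 8, 5, 6] ! (k - 1) else k)" for k :: nat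
  have \<pi>v: "\<pi> (Suc 0) = 2" "\<pi> 2 = Suc 0" "\<pi> 3 = 4" "\<pi> 4 = 3" "\<pi> 5 = 7" "\<pi> 6 = 8" "\<pi> 7 = 5" "\<pi> 8 = 6"
    by (simp_all add: \<pi>_def)
  have inv: "\<pi> (\<pi> k) = k" for k
  proof (cases "k \<in> {1..8}")
    case True
    then show ?thesis unfolding in_1_8 by (elim disjE) (simp_all add: \<pi>v)
  next
    case False
    then have "\<pi> k = k" unfolding \<pi>_def by (rule if_not_P)
    then show ?thesis by simp
  qed
  have im: "\<pi> k \<in> {1..8}" if "k \<in> {1..8}" for k
    using that unfolding in_1_8 by (elim disjE) (simp_all add: \<pi>v)
  have \<pi>: "\<pi> permutes {1..8}"
  proof (rule bij_imp_permutes)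
    show "bij_betw \<pi> {1..8} {1..8}" by (rule bij_betw_byWitness[where f' = \<pi>]) (use inv im in auto)
    show "\<pi> x = x" if "x \<notin> {1..8}" for x
      using that unfolding \<pi>_def by (rule if_not_P)
  qed
  have "cs' (\<pi> k) = cs6 k" if "k \<in> {1..8}" for k
    using that unfolding in_1_8 by (elim disjE) (simp_all add: \<pi>v cs' cs6_def)
  note 7 = relabel_realizes[OF \<pi> inv, of cs' cs6, OF this]
  note real = realizes_comp[OF 1(1) realizes_comp[OF 2(1) realizes_comp[OF 3(1) realizes_comp[OF 4(1)
    realizes_comp[OF 5(1) realizes_comp[OF 6(1) 7]]]]]]
  have c: "chom \<sigma>1" "chom \<sigma>2" "chom \<sigma>3" "chom \<sigma>4" "chom \<sigma>5" "chom \<sigma>6"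
    using 1(1) 2(1) 3(1) 4(1) 5(1) 6(1) by (auto simp: realizes_def divisor_iso_def)
  note cs = chom_mult chom_divide chom_diff chom_const
  note simps = 1(2,3) 2(2,3) 3(2,3) 4(2,3) 5(2,3) 6(2,3)
    cs[OF c(1)] cs[OF c(2)] cs[OF c(3)] cs[OF c(4)] cs[OF c(5)] cs[OF c(6)]
  have Xi: "\<sigma>1 (\<sigma>2 (\<sigma>3 (\<sigma>4 (\<sigma>5 xi_fun)))) = X"
    unfolding X simps eta f1_def[symmetric] f2_def[symmetric] by (simp only: mult.assoc)
  show thesis
  proof (rule that[OF real])
    show "\<pi> k = [2, 1, 4, 3, 7, 8, 5, 6] ! (k - 1)" if "k \<in> {1..8}" for k using that by (simp add: \<pi>_def)
    show "\<sigma>1 (\<sigma>2 (\<sigma>3 (\<sigma>4 (\<sigma>5 (\<sigma>6 xi_fun))))) = X" by (simp only: 6 Xi)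
    have "\<sigma>1 (\<sigma>2 (\<sigma>3 (\<sigma>4 (\<sigma>5 (\<sigma>6 y_fun))))) =
        \<sigma>1 (\<sigma>2 (\<sigma>3 (\<sigma>4 (\<sigma>5 y_fun)))) * ((X - const_fun x6) / (X - const_fun (x7 / q)))"
      unfolding Xi[symmetric] 6(2) cs[OF c(1)] cs[OF c(2)] cs[OF c(3)] cs[OF c(4)] cs[OF c(5)] by (rule refl)
    also have "\<sigma>1 (\<sigma>2 (\<sigma>3 (\<sigma>4 (\<sigma>5 y_fun)))) = const_fun (a3 * a4) / \<eta>"
      unfolding simps eta by (rule refl)
    finally show "\<sigma>1 (\<sigma>2 (\<sigma>3 (\<sigma>4 (\<sigma>5 (\<sigma>6 y_fun))))) = Y" unfolding Y .
  qed
qed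

subsection \<open>The root lattice\<close>

lemma forall_6: "(\<forall>i::6. P i) \<longleftrightarrow> P 0 \<and> P 1 \<and> P 2 \<and> P 3 \<and> P 4 \<and> P 5"
  using exhaust_6 by (metis insertE singletonD)

lemma vec_eq_6: "x = y \<longleftrightarrow> x $ 0 = y $ 0 \<and> x $ 1 = y $ 1 \<and> x $ 2 = y $ 2 \<and> x $ 3 = y $ 3 \<and> x $ 4 = y $ 4 \<and> x $ 5 = y $ (5::6)"
  by (simp add: vec_eq_iff forall_6)

lemma root_vec_nth:
  "root_vec x $ 0 = x $ 0 + x $ 3" "root_vec x $ 1 = x $ 2 - x $ 0 - x $ 3" "root_vec x $ 2 = x $ 1 - x $ 2"
  "root_vec x $ 3 = - x $ 1" "root_vec x $ 4 = x $ 5 - x $ 3" "root_vec x $ 5 = - x $ 5"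
  "root_vec x $ 6 = x $ 4 - x $ 3" "root_vec x $ 7 = - x $ 4" "root_vec x $ 8 = - x $ 0" "root_vec x $ 9 = - x $ 0"
  by (simp_all add: root_vec_def sum_6 simple_root_def axis_def)

lemma intersection_form_10:
  "intersection_form x y = x $ 0 * y $ 0 - x $ 1 * y $ 1 - x $ 2 * y $ 2 - x $ 3 * y $ 3 - x $ 4 * y $ 4
     - x $ 5 * y $ 5 - x $ 6 * y $ 6 - x $ 7 * y $ 7 - x $ 8 * y $ 8 - x $ 9 * y $ 9"
proof -
  have "(UNIV :: 10 set) - {0} = {1, 2, 3, 4, 5, 6, 7, 8, 9}" unfolding UNIV_10 by simp
  then show ?thesis by (simp add: intersection_form_def)
qed

lemma simple_root_nth:
  "simple_root 0 = axis 0 1 - axis 1 1 - axis 8 1 - axis 9 1" "simple_root 1 = axis 2 1 - axis 3 1"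
  "simple_root 2 = axis 1 1 - axis 2 1" "simple_root 3 = axis 0 1 - axis 1 1 - axis 4 1 - axis 6 1"
  "simple_root 4 = axis 6 1 - axis 7 1" "simple_root 5 = axis 4 1 - axis 5 1"
  by (simp_all add: simple_root_def)

lemma form_simple_root:
  "intersection_form (root_vec x) (simple_root 0) = x $ 2 - 2 * x $ 0"
  "intersection_form (root_vec x) (simple_root 1) = x $ 2 - 2 * x $ 1"
  "intersection_form (root_vec x) (simple_root 2) = x $ 0 + x $ 1 + x $ 3 - 2 * x $ 2"
  "intersection_form (root_vec x) (simple_root 3) = x $ 2 + x $ 4 + x $ 5 - 2 * x $ 3"
  "intersection_form (root_vec x) (simple_root 4) = x $ 3 - 2 * x $ 4"
  "intersection_form (root_vec x) (simple_root 5) = x $ 3 - 2 * x $ 5"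
  by (simp_all add: intersection_form_10 root_vec_nth simple_root_nth axis_def)

lemma simple_reflection_nth:
  "simple_reflection i x $ j = x $ j + (if j = i then intersection_form (root_vec x) (simple_root i) else 0)"
  by (simp add: simple_reflection_def axis_def)

lemma sigma_nth:
  "sigma x $ 0 = x $ 1" "sigma x $ 1 = x $ 0" "sigma x $ 2 = x $ 2" "sigma x $ 3 = x $ 3"
  "sigma x $ 4 = x $ 5" "sigma x $ 5 = x $ 4"
  by (simp_all add: sigma_def root_permutation_def sum_6 axis_def)

lemma word_map_simps: "word_map [] x = x" "word_map (i # is) x = simple_reflection i (word_map is x)"
  by (simp_all add: word_map_def)

definition phi_word :: "6 list" where "phi_word = [4, 3, 2, 0, 1, 2, 3, 4]"

lemma word_map_phi_word:
  "word_map phi_word x $ 0 = x $ 1 + x $ 5 - x $ 4" "word_map phi_word x $ 1 = x $ 0 + x $ 5 - x $ 4"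
  "word_map phi_word x $ 2 = x $ 2 + 2 * (x $ 5 - x $ 4)" "word_map phi_word x $ 3 = x $ 3 + 2 * (x $ 5 - x $ 4)"
  "word_map phi_word x $ 4 = 2 * x $ 5 - x $ 4" "word_map phi_word x $ 5 = x $ 5"
  by (simp_all add: phi_word_def word_map_simps simple_reflection_nth form_simple_root)

text \<open>On the basis: the fourth simple root loses one null root, the fifth gains one, and the
  other four are fixed.\<close>

lemma phi_word_action:
  "(sigma \<circ> word_map phi_word) x = x + (x $ 5 - x $ 4) *s null_root"
  by (simp add: vec_eq_6 sigma_nth word_map_phi_word null_root_def)

lemma translation_phi: "translation (sigma \<circ> word_map phi_word)"
  unfolding translation_def
proof
  let ?\<tau> = "id(0 := 1, 1 := 0, 4 := 5, 5 := 4) :: 6 \<Rightarrow> 6"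
  have "?\<tau> (?\<tau> i) = i" for i by simp
  then have "bij ?\<tau>" by (intro bij_betw_byWitness[where f' = ?\<tau>]) auto
  moreover have "\<forall>i j. intersection_form (simple_root (?\<tau> i)) (simple_root (?\<tau> j)) = intersection_form (simple_root i) (simple_root j)"
    unfolding forall_6 by (simp add: intersection_form_10 simple_root_nth axis_def)
  ultimately have "diagram_automorphism ?\<tau>" by (simp add: diagram_automorphism_def)
  then show "sigma \<circ> word_map phi_word \<in> extended_affine_weyl"
    unfolding extended_affine_weyl_def sigma_def by blast
  show "\<exists>n. \<forall>i. (sigma \<circ> word_map phi_word) (axis i 1) = axis i 1 + n i *s null_root"
    unfolding phi_word_action by (intro exI[of _ "\<lambda>i. (axis i 1 :: root_lattice) $ 5 - (axis i 1 :: root_lattice) $ 4"]) simp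
qed

text \<open>The negative of the intersection form on the root lattice, as a sum of squares.\<close>

definition root_norm :: "root_lattice \<Rightarrow> int" where
  "root_norm x = (x $ 1 - x $ 0)\<^sup>2 + (x $ 2 - x $ 1 - x $ 0)\<^sup>2 + (x $ 3 - x $ 2)\<^sup>2
     + (x $ 4 + x $ 5 - x $ 3)\<^sup>2 + (x $ 5 - x $ 4)\<^sup>2"

definition positive :: "root_lattice \<Rightarrow> bool" where
  "positive x \<longleftrightarrow> (\<forall>i. 0 \<le> x $ i)"

lemma root_norm_eq:
  "root_norm x = 2 * ((x $ 0)\<^sup>2 + (x $ 1)\<^sup>2 + (x $ 2)\<^sup>2 + (x $ 3)\<^sup>2 + (x $ 4)\<^sup>2 + (x $ 5)\<^sup>2
     - x $ 0 * x $ 2 - x $ 1 * x $ 2 - x $ 2 * x $ 3 - x $ 3 * x $ 4 - x $ 3 * x $ 5)"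
  by (simp add: root_norm_def power2_eq_square algebra_simps)

text \<open>The five squares are those of the coordinates in \<int>^5 when the simple roots are sent
  to \<open>- e1 - e2\<close>, \<open>e1 - e2\<close>, \<open>e2 - e3\<close>,
  \<open>e3 - e4\<close>, \<open>e4 - e5\<close>, \<open>e4 + e5\<close>, the finite lattice of type
  D5. The kernel of this map is spanned by the null root.\<close>

lemma root_norm_eq_0:
  assumes "root_norm x = 0"
  shows "x $ 1 = x $ 0 \<and> x $ 2 = 2 * x $ 0 \<and> x $ 3 = 2 * x $ 0 \<and> x $ 4 = x $ 0 \<and> x $ 5 = x $ 0"
proof -
  have "x $ 1 - x $ 0 = 0" "x $ 2 - x $ 1 - x $ 0 = 0" "x $ 3 - x $ 2 = 0" "x $ 4 + x $ 5 - x $ 3 = 0" "x $ 5 - x $ 4 = 0"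
    using assms unfolding root_norm_def
    by (smt (verit) zero_le_power2 zero_eq_power2)+
  then show ?thesis by linarith
qed

text \<open>The form is semidefinite and even. The resulting gap is what forces one of two
  nonnegative norms with sum at most 2 to be 2 at most and leaves room for only one nonzero
  norm.\<close>

lemma root_norm_ge_2: "root_norm x \<noteq> 0 \<Longrightarrow> 2 \<le> root_norm x"
proof -
  assume "root_norm x \<noteq> 0"
  moreover have "0 \<le> root_norm x" unfolding root_norm_def by (intro add_nonneg_nonneg zero_le_power2)
  moreover have "even (root_norm x)" unfolding root_norm_eq by simp
  ultimately show ?thesis by presburger
qed

text \<open>The positive and the negative part of a root have nonpositive inner product, so one of them is
  isotropic, that is, a multiple of the null root.\<close>

lemma root_sign:
  assumes "root_norm x = 2" shows "positive x \<or> (\<forall>i. x $ i \<le> 0)"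
proof -
  define p where "p = (\<chi> i. max (x $ i) 0)"
  define n where "n = (\<chi> i. max (- x $ i) 0)"
  have pn: "0 \<le> p $ i" "0 \<le> n $ i" "p $ i * n $ i = 0" "x $ i = p $ i - n $ i" for i
    by (auto simp: p_def n_def max_def)
  have nn: "0 \<le> p $ i * n $ j" for i j using pn by simp
  define B where "B = p $ 0 * n $ 2 + p $ 2 * n $ 0 + p $ 1 * n $ 2 + p $ 2 * n $ 1 + p $ 2 * n $ 3 + p $ 3 * n $ 2
        + p $ 3 * n $ 4 + p $ 4 * n $ 3 + p $ 3 * n $ 5 + p $ 5 * n $ 3"
  have "0 \<le> B" unfolding B_def by (intro add_nonneg_nonneg nn)
  moreover have "root_norm x = root_norm p + root_norm n + 2 * B
      - 4 * (p $ 0 * n $ 0 + p $ 1 * n $ 1 + p $ 2 * n $ 2 + p $ 3 * n $ 3 + p $ 4 * n $ 4 + p $ 5 * n $ 5)"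
    unfolding root_norm_eq pn(4) B_def by (simp add: power2_eq_square algebra_simps)
  ultimately have "root_norm p + root_norm n \<le> 2" using assms by (simp add: pn(3) del: mult_eq_0_iff)
  then have "root_norm p = 0 \<or> root_norm n = 0" using root_norm_ge_2[of p] root_norm_ge_2[of n] by linarith
  then show ?thesis
  proof
    assume "root_norm p = 0"
    note e = root_norm_eq_0[OF this]
    have all: "(\<forall>i. p $ i = 0) \<or> (\<forall>i. 0 < p $ i)"
      unfolding forall_6 using e pn(1)[of 0] by linarith
    then show ?thesis
    proof
      assume "\<forall>i. p $ i = 0"
      then show ?thesis using pn by auto
    next
      assume p: "\<forall>i. 0 < p $ i"
      have "n $ i = 0" for i using pn(3)[of i] p by (metis less_irrefl mult_eq_0_iff)
      then show ?thesis using pn by (simp add: positive_def)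
    qed
  next
    assume "root_norm n = 0"
    note e = root_norm_eq_0[OF this]
    have all: "(\<forall>i. n $ i = 0) \<or> (\<forall>i. 0 < n $ i)"
      unfolding forall_6 using e pn(2)[of 0] by linarith
    then show ?thesis
    proof
      assume "\<forall>i. n $ i = 0"
      then show ?thesis using pn by (simp add: positive_def)
    next
      assume n: "\<forall>i. 0 < n $ i"
      have "p $ i = 0" for i using pn(3)[of i] n by (metis less_irrefl mult_eq_0_iff)
      then show ?thesis using pn by simp
    qed
  qed
qed

lemma root_norm_reflection: "root_norm (simple_reflection i x) = root_norm x"
  using exhaust_6[of i]
  by (auto simp: root_norm_eq simple_reflection_nth form_simple_root power2_eq_square algebra_simps)

lemma simple_reflection_involution: "simple_reflection i (simple_reflection i x) = x"
  using exhaust_6[of i] by (auto simp: vec_eq_6 simple_reflection_nth form_simple_root)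

text \<open>A simple reflection changes only one coefficient. If a positive root becomes negative,
  all its other coefficients must vanish, and norm 2 leaves only the simple root itself.\<close>

lemma positive_reflection:
  assumes "root_norm x = 2" "positive x" "\<not> positive (simple_reflection i x)"
  shows "x = axis i 1"
proof -
  have neg: "simple_reflection i x $ j \<le> 0" for j
    using root_sign[of "simple_reflection i x"] assms root_norm_reflection by metis
  have 0: "x $ j = 0" if "j \<noteq> i" for j
    using neg[of j] that assms(2) by (simp add: simple_reflection_nth positive_def order_antisym)
  have "root_norm x = 2 * (x $ i)\<^sup>2"
    using exhaust_6[of i] 0 by (auto simp: root_norm_eq)
  then have "(x $ i)\<^sup>2 = 1" using assms(1) by simp
  then have "x $ i = 1" using assms(2) by (auto simp: power2_eq_1_iff positive_def dest: spec[of _ i])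
  then show ?thesis using 0 by (auto simp: vec_eq_iff axis_def)
qed

definition inversions :: "(root_lattice \<Rightarrow> root_lattice) \<Rightarrow> root_lattice set" where
  "inversions w = {x. root_norm x = 2 \<and> positive x \<and> \<not> positive (w x)}"

text \<open>Each further letter makes at most one more positive root negative, so the number of
  inversions is a lower bound for the length of any word with the same action.\<close>

lemma inversions_word_map: "finite (inversions (word_map is)) \<and> card (inversions (word_map is)) \<le> length is"
proof (induction "is")
  case Nil
  then show ?case by (simp add: inversions_def word_map_simps)
next
  case (Cons i "is")
  \<comment> \<open>A root that becomes negative only at the new letter must have been carried to
    the i-th simple root; by injectivity there is at most one.\<close>
  let ?S = "{x. word_map is x = axis i 1}"
  have norm: "root_norm (word_map js x) = root_norm x" for js x
    by (induction js) (simp_all add: word_map_simps root_norm_reflection)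
  have inj: "inj (word_map js)" for js
  proof (induction js)
    case (Cons j js)
    then show ?case by (auto simp: inj_def word_map_simps) (metis simple_reflection_involution)
  qed (simp add: inj_def word_map_simps)
  have S: "finite ?S \<and> card ?S \<le> 1"
  proof (cases "?S = {}")
    case False
    then obtain x where x: "word_map is x = axis i 1" by auto
    have "y = x" if "word_map is y = axis i 1" for y
      by (rule injD[OF inj[of "is"]]) (simp only: x that)
    then have "?S = {x}" using x by blast
    then show ?thesis by simp
  qed simp
  have "inversions (word_map (i # is)) \<subseteq> inversions (word_map is) \<union> ?S"
  proof
    fix x assume "x \<in> inversions (word_map (i # is))"
    then have x: "root_norm x = 2" "positive x" "\<not> positive (simple_reflection i (word_map is x))"
      by (auto simp: inversions_def word_map_simps)
    then have "positive (word_map is x) \<Longrightarrow> word_map is x = axis i 1"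
      using positive_reflection[of "word_map is x" i] by (simp add: norm)
    then show "x \<in> inversions (word_map is) \<union> ?S"
      using x unfolding inversions_def by blast
  qed
  moreover have "card (inversions (word_map is) \<union> ?S) \<le> length (i # is)"
    using card_Un_le[of "inversions (word_map is)" ?S] Cons S by simp
  moreover have "finite (inversions (word_map is) \<union> ?S)" using Cons S by simp
  ultimately show ?case 
    by (intro conjI) (rule finite_subset, assumption+, rule le_trans[OF card_mono], assumption+)
qed

text \<open>The eight witnesses are norm-2 vectors between zero and the null root with coefficient 1
  at the fourth and 0 at the fifth simple root. Up to the diagram automorphism the word subtracts
  one null root from each, which makes them negative.\<close>

lemma reduced_phi_word: "reduced_word phi_word"
  unfolding reduced_word_def
proof (intro allI impI)
  fix js assume js: "word_map js = word_map phi_word"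
  define v :: "int list \<Rightarrow> root_lattice" where "v l = (\<chi> i. if i = 0 then l ! 0 else if i = 1 then l ! 1
    else if i = 2 then l ! 2 else if i = 3 then l ! 3 else if i = 4 then l ! 4 else l ! 5)" for l
  have v: "v l $ 0 = l ! 0" "v l $ 1 = l ! 1" "v l $ 2 = l ! 2" "v l $ 3 = l ! 3" "v l $ 4 = l ! 4" "v l $ 5 = l ! 5" for l
    by (simp_all add: v_def)
  let ?I = "[[0,0,0,0,1,0], [0,0,0,1,1,0], [0,0,1,1,1,0], [0,1,1,1,1,0], [1,0,1,1,1,0], [1,1,1,1,1,0], [1,1,2,1,1,0], [1,1,2,2,1,0]]"
  have "distinct (map v ?I)" by (simp add: vec_eq_6 v)
  then have "card (set (map v ?I)) = 8" by (subst distinct_card) simp_all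
  moreover have "set (map v ?I) \<subseteq> inversions (word_map js)"
    unfolding js inversions_def positive_def forall_6 by (simp add: root_norm_eq v word_map_phi_word)
  then have "card (set (map v ?I)) \<le> card (inversions (word_map js))"
    using inversions_word_map by (intro card_mono) blast+
  moreover have "card (inversions (word_map js)) \<le> length js"
    using inversions_word_map by blast
  ultimately have "8 \<le> length js" by linarith
  then show "length phi_word \<le> length js" by (simp add: phi_word_def)
qed

subsection \<open>Conjugation of matrix polynomials\<close>

lemma mat22_nth [simp]:
  "mat22 a b c d $ 1 $ 1 = a" "mat22 a b c d $ 1 $ 2 = b" "mat22 a b c d $ 2 $ 1 = c" "mat22 a b c d $ 2 $ 2 = d"
  by (simp_all add: mat22_def)

lemma mat2_eq_iff: "A = B \<longleftrightarrow> A $ 1 $ 1 = B $ 1 $ 1 \<and> A $ 1 $ 2 = B $ 1 $ 2 \<and> A $ 2 $ 1 = B $ 2 $ 1 \<and> A $ 2 $ 2 = B $ 2 $ 2"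
  for A B :: mat2
  by (auto simp: vec_eq_iff forall_2)

lemma mat2_mult_nth: "(A ** B) $ i $ j = A $ i $ 1 * B $ 1 $ j + A $ i $ 2 * B $ 2 $ j" for A B :: mat2
  by (simp add: matrix_matrix_mult_def sum_2)

lemma mat2_vec_nth: "(A *v x) $ i = A $ i $ 1 * x $ 1 + A $ i $ 2 * x $ 2" for A :: mat2
  by (simp add: matrix_vector_mult_def sum_2)

lemma mat_1_nth: "(mat 1 :: mat2) $ 1 $ 1 = 1" "(mat 1 :: mat2) $ 1 $ 2 = 0" "(mat 1 :: mat2) $ 2 $ 1 = 0" "(mat 1 :: mat2) $ 2 $ 2 = 1"
  by (simp_all add: mat_def)

lemma matrix_inv_inverse:
  fixes g :: mat2
  assumes "invertible g" shows "g ** matrix_inv g = mat 1" "matrix_inv g ** g = mat 1"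
  using someI_ex[OF assms[unfolded invertible_def]] by (auto simp: matrix_inv_def)

lemma matrix_inv_eq:
  fixes g :: mat2
  assumes "g ** h = mat 1" "h ** g = mat 1" shows "invertible g" "matrix_inv g = h"
proof -
  show "invertible g" using assms by (auto simp: invertible_def)
  then have "matrix_inv g ** g = mat 1" by (rule matrix_inv_inverse(2))
  then have "matrix_inv g ** g ** h = h" by simp
  then show "matrix_inv g = h" using assms by (simp add: matrix_mul_assoc[symmetric])
qed

lemma conj_rel_iff:
  "((A0, A1, A2), (B0, B1, B2)) \<in> conj_rel \<longleftrightarrow>
     (\<exists>g h :: mat2. g ** h = mat 1 \<and> h ** g = mat 1 \<and> B0 = g ** A0 ** h \<and> B1 = g ** A1 ** h \<and> B2 = g ** A2 ** h)"
proof
  assume "((A0, A1, A2), (B0, B1, B2)) \<in> conj_rel"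
  then obtain g :: mat2 where "invertible g" "B0 = g ** A0 ** matrix_inv g" "B1 = g ** A1 ** matrix_inv g"
    "B2 = g ** A2 ** matrix_inv g" by (auto simp: conj_rel_def)
  then show "\<exists>g h :: mat2. g ** h = mat 1 \<and> h ** g = mat 1 \<and> B0 = g ** A0 ** h \<and> B1 = g ** A1 ** h \<and> B2 = g ** A2 ** h"
    using matrix_inv_inverse by blast
next
  assume "\<exists>g h :: mat2. g ** h = mat 1 \<and> h ** g = mat 1 \<and> B0 = g ** A0 ** h \<and> B1 = g ** A1 ** h \<and> B2 = g ** A2 ** h"
  then obtain g h :: mat2 where gh: "g ** h = mat 1" "h ** g = mat 1"
    and "B0 = g ** A0 ** h" "B1 = g ** A1 ** h" "B2 = g ** A2 ** h" by blast
  then show "((A0, A1, A2), (B0, B1, B2)) \<in> conj_rel"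
    using matrix_inv_eq[OF gh] by (auto simp: conj_rel_def)
qed

lemma conj_cancel:
  fixes g h A :: mat2
  assumes "h ** g = mat 1" shows "h ** (g ** A ** h) ** g = A"
proof -
  have "h ** (g ** A ** h) ** g = (h ** g) ** A ** (h ** g)" by (simp only: matrix_mul_assoc)
  then show ?thesis using assms by simp
qed

lemma conj_rel_sym: "(A, B) \<in> conj_rel \<Longrightarrow> (B, A) \<in> conj_rel"
  by (cases A; cases B) (auto simp: conj_rel_iff conj_cancel[symmetric] intro: conj_cancel[symmetric])

lemma conj_rel_refl: "(A, A) \<in> conj_rel"
  by (cases A) (auto simp: conj_rel_iff intro!: exI[of _ "mat 1"])

lemma conj_rel_trans:
  assumes "(A, B) \<in> conj_rel" "(B, C) \<in> conj_rel" shows "(A, C) \<in> conj_rel"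
proof -
  obtain A0 A1 A2 B0 B1 B2 C0 C1 C2 where e: "A = (A0, A1, A2)" "B = (B0, B1, B2)" "C = (C0, C1, C2)"
    by (metis surj_pair)
  obtain g h where g: "g ** h = mat 1" "h ** g = mat 1" "B0 = g ** A0 ** h" "B1 = g ** A1 ** h" "B2 = g ** A2 ** h"
    using assms(1) unfolding e conj_rel_iff by blast
  obtain g' h' where g': "g' ** h' = mat 1" "h' ** g' = mat 1" "C0 = g' ** B0 ** h'" "C1 = g' ** B1 ** h'" "C2 = g' ** B2 ** h'"
    using assms(2) unfolding e conj_rel_iff by blast
  have "(g' ** g) ** (h ** h') = g' ** (g ** h) ** h'" "(h ** h') ** (g' ** g) = h ** (h' ** g') ** g"
    by (simp_all only: matrix_mul_assoc)
  then have "(g' ** g) ** (h ** h') = mat 1" "(h ** h') ** (g' ** g) = mat 1" using g g' by simp_all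
  moreover have "C0 = (g' ** g) ** A0 ** (h ** h')" "C1 = (g' ** g) ** A1 ** (h ** h')" "C2 = (g' ** g) ** A2 ** (h ** h')"
    unfolding g' g by (simp_all only: matrix_mul_assoc)
  ultimately show ?thesis unfolding e conj_rel_iff by blast
qed

lemma conj_relI:
  fixes g :: mat2
  assumes "g $ 1 $ 1 * g $ 2 $ 2 - g $ 1 $ 2 * g $ 2 $ 1 \<noteq> 0"
    and "g ** A0 = B0 ** g" "g ** A1 = B1 ** g" "g ** A2 = B2 ** g"
  shows "((A0, A1, A2), (B0, B1, B2)) \<in> conj_rel"
proof -
  have "invertible g" using assms(1) by (simp add: invertible_det_nz det_2)
  then have i: "g ** matrix_inv g = mat 1" "matrix_inv g ** g = mat 1"
    using matrix_inv_inverse by auto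
  have "B = g ** A ** matrix_inv g" if "g ** A = B ** g" for A B
    unfolding that using i by (simp flip: matrix_mul_assoc)
  then show ?thesis unfolding conj_rel_iff using assms i by blast
qed

lemma matpoly_at_nth: "matpoly_at (A0, A1, A2) z $ i $ j = A0 $ i $ j + z * A1 $ i $ j + z\<^sup>2 * A2 $ i $ j"
  by (simp add: matpoly_at_def)

lemma matpoly_at_conj:
  "matpoly_at (g ** A0 ** h, g ** A1 ** h, g ** A2 ** h) z = g ** matpoly_at (A0, A1, A2) z ** h"
  by (simp add: mat2_eq_iff matpoly_at_nth mat2_mult_nth algebra_simps)

lemma spectrum_conj_subset:
  fixes g h A :: mat2
  assumes "h ** g = mat 1" shows "mat_spectrum A \<subseteq> mat_spectrum (g ** A ** h)"
proof
  fix l assume "l \<in> mat_spectrum A"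
  then obtain v where v: "v \<noteq> 0" "A *v v = l *s v" by (auto simp: mat_spectrum_def eigenvector_of_def)
  have hg: "h *v (g *v v) = v" by (simp add: matrix_vector_mul_assoc assms)
  then have "g *v v \<noteq> 0" using v(1) by auto
  moreover have "(g ** A ** h) *v (g *v v) = l *s (g *v v)"
    using v(2) hg by (simp add: vector_scalar_commute flip: matrix_vector_mul_assoc)
  ultimately show "l \<in> mat_spectrum (g ** A ** h)" by (auto simp: mat_spectrum_def eigenvector_of_def)
qed

lemma Xbar_conj:
  assumes "(A, B) \<in> conj_rel" "A \<in> Xbar p" shows "B \<in> Xbar p"
proof -
  obtain A0 A1 A2 B0 B1 B2 where e: "A = (A0, A1, A2)" "B = (B0, B1, B2)" by (metis surj_pair)
  obtain g h where g: "g ** h = mat 1" "h ** g = mat 1" and B: "B0 = g ** A0 ** h" "B1 = g ** A1 ** h" "B2 = g ** A2 ** h"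
    using assms(1) unfolding e conj_rel_iff by blast
  have s: "mat_spectrum (g ** M ** h) = mat_spectrum M" for M
    using spectrum_conj_subset[OF g(2), of M] spectrum_conj_subset[OF g(1), of "g ** M ** h"]
    by (simp add: conj_cancel[OF g(2)])
  have "det g * det h = 1" using g(1) by (metis det_I det_mul)
  then have d: "det (g ** M ** h) = det M" for M
    by (simp add: det_mul mult.commute mult.left_commute)
  show ?thesis using assms(2) unfolding e B by (simp add: Xbar_def s matpoly_at_conj d)
qed

lemma X_space_iff: "cl \<in> X_space p \<longleftrightarrow> (\<exists>A\<in>Xbar p. cl = conj_rel `` {A})"
  by (auto simp: X_space_def quotient_def)

lemma X_space_memD:
  assumes "cl \<in> X_space p" "A \<in> cl"
  shows "A \<in> Xbar p" "cl = conj_rel `` {A}"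
proof -
  obtain A' where A': "A' \<in> Xbar p" "cl = conj_rel `` {A'}" using assms(1) X_space_iff by blast
  then have c: "(A', A) \<in> conj_rel" using assms(2) by auto
  show "A \<in> Xbar p" using Xbar_conj[OF c A'(1)] .
  show "cl = conj_rel `` {A}"
    unfolding A'(2) using conj_rel_trans[OF c] conj_rel_trans[OF conj_rel_sym[OF c]] by auto
qed

text \<open>One product condition covers both triangular shapes: the normal form has an upper
  triangular constant term and a lower triangular leading term, and its image under \<phi> has them
  the other way round.\<close>

lemma spectrum_triangular:
  fixes M :: mat2 assumes "M $ 1 $ 2 * M $ 2 $ 1 = 0"
  shows "mat_spectrum M = {M $ 1 $ 1, M $ 2 $ 2}"
proof (intro equalityI subsetI)
  fix l assume "l \<in> mat_spectrum M"
  then obtain v where v: "v \<noteq> 0" "M *v v = l *s v" by (auto simp: mat_spectrum_def eigenvector_of_def)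
  have "M $ 1 $ 1 * v $ 1 + M $ 1 $ 2 * v $ 2 = l * v $ 1" "M $ 2 $ 1 * v $ 1 + M $ 2 $ 2 * v $ 2 = l * v $ 2"
    using v(2) by (simp_all add: vec_eq_iff forall_2 mat2_vec_nth)
  moreover have "v $ 1 \<noteq> 0 \<or> v $ 2 \<noteq> 0" using v(1) by (auto simp: vec_eq_iff forall_2)
  ultimately show "l \<in> {M $ 1 $ 1, M $ 2 $ 2}"
    using assms by auto
next
  have ex: "l \<in> mat_spectrum M" if "x \<noteq> 0 \<or> y \<noteq> 0" "M $ 1 $ 1 * x + M $ 1 $ 2 * y = l * x" "M $ 2 $ 1 * x + M $ 2 $ 2 * y = l * y" for l x y
  proof -
    let ?v = "vector [x, y] :: complex ^ 2"
    have "?v \<noteq> 0" using that(1) by (auto simp: vec_eq_iff forall_2)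
    moreover have "M *v ?v = l *s ?v" using that by (simp add: vec_eq_iff forall_2 mat2_vec_nth)
    ultimately show ?thesis by (auto simp: mat_spectrum_def eigenvector_of_def)
  qed
  fix l assume l: "l \<in> {M $ 1 $ 1, M $ 2 $ 2}"
  show "l \<in> mat_spectrum M"
  proof (cases "M $ 1 $ 2 = 0")
    case True
    show ?thesis
    proof (cases "l = M $ 2 $ 2")
      case False
      then show ?thesis using l True
        by (intro ex[of "M $ 1 $ 1 - M $ 2 $ 2" "M $ 2 $ 1"]) (auto simp: algebra_simps)
    qed (use True in \<open>auto intro!: ex[of 0 1]\<close>)
  next
    case False
    then show ?thesis using l assms
      by (intro ex[of "M $ 1 $ 2" "l - M $ 1 $ 1"]) (auto simp: algebra_simps)
  qed
qed

lemma det_normal_form: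
  "det (matpoly_at (normal_form p a b \<beta> \<gamma> y) z) =
     (kappa1 p * z\<^sup>2 + a * z + theta1 p) * (kappa2 p * z\<^sup>2 + b * z + theta2 p) - (z - y) * z * (\<gamma> * z + \<beta>)"
  by (simp add: normal_form_def det_2 matpoly_at_nth power2_eq_square algebra_simps)

lemma normal_form_Xbar_iff:
  "normal_form p a b \<beta> \<gamma> y \<in> Xbar p \<longleftrightarrow> (\<forall>z. (kappa1 p * z\<^sup>2 + a * z + theta1 p) * (kappa2 p * z\<^sup>2 + b * z + theta2 p) - (z - y) * z * (\<gamma> * z + \<beta>)
      = kappa1 p * kappa2 p * ((z - c1 p) * (z - c2 p) * (z - c3 p) * (z - c4 p)))"
  unfolding det_normal_form[symmetric] by (simp add: Xbar_def normal_form_def spectrum_triangular)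

text \<open>The image of the normal form under \<open>\<phi>\<close>, computed in the basis \<open>(u, t v)\<close>, where \<open>(u, v)\<close> is the
  basis of the normal form.\<close>

definition gauged_form :: "complex \<Rightarrow> params \<Rightarrow> complex \<Rightarrow> complex \<Rightarrow> complex \<Rightarrow> complex \<Rightarrow> complex \<Rightarrow> complex \<Rightarrow> matpoly" where
  "gauged_form q p a b \<beta> \<gamma> y t =
     (mat22 (q * theta1 p) 0 (\<beta> / t) (theta2 p), mat22 (q * a) (- q * y * t) (\<gamma> / t) b,
      mat22 (q * kappa1 p) (q * t) 0 (kappa2 p))"

lemma shift_params_simps [simp]:
  "kappa1 (shift_params q p) = q * kappa1 p" "theta1 (shift_params q p) = q * theta1 p"
  "kappa2 (shift_params q p) = kappa2 p" "theta2 (shift_params q p) = theta2 p"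
  "c1 (shift_params q p) = c1 p" "c2 (shift_params q p) = c2 p" "c3 (shift_params q p) = c3 p" "c4 (shift_params q p) = c4 p"
  by (simp_all add: shift_params_def)

text \<open>The two outer diagonal factors have determinants \<open>q z\<close> and
  \<open>1 / z\<close>, so the determinant is multiplied by \<open>q\<close>, which matches the
  change of \<open>kappa1\<close>.\<close>

lemma gauged_form_Xbar:
  assumes "normal_form p a b \<beta> \<gamma> y \<in> Xbar p" "t \<noteq> 0"
  shows "gauged_form q p a b \<beta> \<gamma> y t \<in> Xbar (shift_params q p)"
proof -
  have "det (matpoly_at (gauged_form q p a b \<beta> \<gamma> y t) z) = q * det (matpoly_at (normal_form p a b \<beta> \<gamma> y) z)" for z
    unfolding det_normal_form using assms(2) by (simp add: gauged_form_def det_2 matpoly_at_nth power2_eq_square field_simps)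
  moreover have "det (matpoly_at (normal_form p a b \<beta> \<gamma> y) z) = kappa1 p * kappa2 p * ((z - c1 p) * (z - c2 p) * (z - c3 p) * (z - c4 p))" for z
    using assms(1) by (simp add: normal_form_Xbar_iff det_normal_form)
  ultimately show ?thesis by (simp add: gauged_form_def Xbar_def spectrum_triangular)
qed

lemma gauged_form_conj:
  assumes "t \<noteq> 0" shows "(gauged_form q p a b \<beta> \<gamma> y t, gauged_form q p a b \<beta> \<gamma> y 1) \<in> conj_rel"
  unfolding gauged_form_def
  by (rule conj_relI[of "mat22 1 0 0 t"]) (use assms in \<open>simp_all add: mat2_eq_iff mat2_mult_nth\<close>)

lemma gauged_at:
  assumes "l \<noteq> 0" "m \<noteq> 0" "z \<noteq> 0"
  shows "mat22 (q * z) 0 0 1 ** (mat22 (1 / l) 0 0 (1 / m) ** matpoly_at (normal_form p a b \<beta> \<gamma> y) z ** mat22 l 0 0 m) ** mat22 (1 / z) 0 0 1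
    = matpoly_at (gauged_form q p a b \<beta> \<gamma> y (m / l)) z"
  using assms by (simp add: mat2_eq_iff mat2_mult_nth matpoly_at_nth normal_form_def gauged_form_def power2_eq_square field_simps)

text \<open>Excluding \<open>z = 0\<close> is harmless, since a quadratic polynomial is determined
  by its values at 1, -1 and 2.\<close>

lemma matpoly_eqI:
  assumes "\<And>z. z \<noteq> 0 \<Longrightarrow> matpoly_at A z = matpoly_at B z" shows "A = B"
proof -
  obtain A0 A1 A2 B0 B1 B2 where e: "A = (A0, A1, A2)" "B = (B0, B1, B2)" by (metis surj_pair)
  have lin: "x0 = y0 \<and> x1 = y1 \<and> x2 = y2"
    if "x0 + x1 + x2 = y0 + y1 + y2" "x0 - x1 + x2 = y0 - y1 + y2" "x0 + 2 * x1 + 4 * x2 = y0 + 2 * y1 + 4 * y2"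
    for x0 x1 x2 y0 y1 y2 :: complex
    using that by algebra
  have "A0 $ i $ j = B0 $ i $ j \<and> A1 $ i $ j = B1 $ i $ j \<and> A2 $ i $ j = B2 $ i $ j" for i j
  proof (rule lin)
    have eq: "A0 $ i $ j + z * A1 $ i $ j + z\<^sup>2 * A2 $ i $ j = B0 $ i $ j + z * B1 $ i $ j + z\<^sup>2 * B2 $ i $ j" if "z \<noteq> 0" for z
      using assms[OF that] unfolding e by (metis matpoly_at_nth)
    show "A0 $ i $ j + A1 $ i $ j + A2 $ i $ j = B0 $ i $ j + B1 $ i $ j + B2 $ i $ j" using eq[of 1] by simp
    show "A0 $ i $ j - A1 $ i $ j + A2 $ i $ j = B0 $ i $ j - B1 $ i $ j + B2 $ i $ j" using eq[of "-1"] by simp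
    show "A0 $ i $ j + 2 * A1 $ i $ j + 4 * A2 $ i $ j = B0 $ i $ j + 2 * B1 $ i $ j + 4 * B2 $ i $ j" using eq[of 2] by simp
  qed
  then show ?thesis unfolding e by (simp add: vec_eq_iff)
qed

lemma phi_rel_gauged:
  assumes "normal_form p a b \<beta> \<gamma> y \<in> Xbar p"
  shows "phi_rel q p (conj_rel `` {normal_form p a b \<beta> \<gamma> y}) (conj_rel `` {gauged_form q p a b \<beta> \<gamma> y 1})"
proof -
  let ?N = "normal_form p a b \<beta> \<gamma> y"
  let ?u = "vector [1, 0] :: complex ^ 2" and ?v = "vector [0, 1] :: complex ^ 2"
  have c: "columns2 ?u ?v = mat 1" by (simp add: mat2_eq_iff columns2_def mat_1_nth)
  have "matrix_inv (mat 1 :: mat2) = mat 1" by (rule matrix_inv_eq) simp_all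
  then have at: "mat22 (q * z) 0 0 1 ** (matrix_inv (columns2 ?u ?v) ** matpoly_at ?N z ** columns2 ?u ?v) ** mat22 (1 / z) 0 0 1
      = matpoly_at (gauged_form q p a b \<beta> \<gamma> y 1) z" if "z \<noteq> 0" for z
    using gauged_at[of 1 1 z q p a b \<beta> \<gamma> y] that
    by (simp add: c) (simp add: mat2_eq_iff mat2_mult_nth)
  have uv: "?u \<noteq> 0" "?v \<noteq> 0" by (auto simp: vec_eq_iff forall_2)
  obtain N0 N1 N2 where N: "?N = (N0, N1, N2)" by (metis surj_pair)
  have "eigenvector_of N0 (theta1 p) ?u" "eigenvector_of N2 (kappa2 p) ?v"
    using uv N by (auto simp: eigenvector_of_def normal_form_def vec_eq_iff forall_2 mat2_vec_nth)
  moreover have "invertible (columns2 ?u ?v)" unfolding c by (rule matrix_inv_eq(1)[of _ "mat 1"]) simp_all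
  moreover have "conj_rel `` {?N} \<in> X_space p" using assms X_space_iff by blast
  moreover have "(N0, N1, N2) \<in> conj_rel `` {?N}" using conj_rel_refl N by simp
  ultimately show ?thesis
    unfolding phi_rel_def using at[unfolded N] N by (intro conjI exI[of _ N0] exI[of _ N1] exI[of _ N2]
        exI[of _ "gauged_form q p a b \<beta> \<gamma> y 1"] exI[of _ ?u] exI[of _ ?v]) auto
qed

text \<open>The choices in \<open>phi_rel\<close> do not affect the class. In the basis of the
  normal form the two eigenlines are the coordinate axes, because the eigenvalues are distinct; what
  remains is a diagonal rescaling \<open>(l, m)\<close>, and it changes the result only by
  conjugation.\<close>

lemma phi_relD:
  assumes "phi_rel q p cl cl'" "normal_form p a b \<beta> \<gamma> y \<in> cl" and ne: "kappa1 p \<noteq> kappa2 p" "theta1 p \<noteq> theta2 p"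
  shows "cl' = conj_rel `` {gauged_form q p a b \<beta> \<gamma> y 1}"
proof -
  let ?N = "normal_form p a b \<beta> \<gamma> y"
  obtain A0 A1 A2 B u v where cl: "cl \<in> X_space p" and A: "(A0, A1, A2) \<in> cl"
    and u: "eigenvector_of A0 (theta1 p) u" and v: "eigenvector_of A2 (kappa2 p) v"
    and inv: "invertible (columns2 u v)"
    and B: "\<And>z. z \<noteq> 0 \<Longrightarrow> matpoly_at B z = mat22 (q * z) 0 0 1
           ** (matrix_inv (columns2 u v) ** matpoly_at (A0, A1, A2) z ** columns2 u v) ** mat22 (1 / z) 0 0 1"
    and cl': "cl' = conj_rel `` {B}"
    using assms(1) unfolding phi_rel_def by blast
  obtain N0 N1 N2 where N: "?N = (N0, N1, N2)" by (metis surj_pair)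
  have "(?N, (A0, A1, A2)) \<in> conj_rel" using X_space_memD(2)[OF cl assms(2)] A by auto
  then obtain g h where gh: "g ** h = mat 1" "h ** g = mat 1"
    and A': "A0 = g ** N0 ** h" "A1 = g ** N1 ** h" "A2 = g ** N2 ** h"
    unfolding N conj_rel_iff by blast
  have eig: "N *v (h *v w) = l *s (h *v w)" if "(g ** N ** h) *v w = l *s w" for N l w
  proof -
    have "h *v ((g ** N ** h) *v w) = (h ** g) *v (N *v (h *v w))"
      by (simp add: matrix_vector_mul_assoc matrix_mul_assoc)
    then show ?thesis using that gh by (simp add: vector_scalar_commute)
  qed
  have nz: "h *v w \<noteq> 0" if "w \<noteq> 0" for w
  proof
    assume "h *v w = 0"
    then have "(g ** h) *v w = 0" by (simp flip: matrix_vector_mul_assoc)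
    then show False using gh that by simp
  qed
  define l where "l = (h *v u) $ 1"
  define m where "m = (h *v v) $ 2"
  have NN: "N0 = mat22 (theta1 p) (- y) 0 (theta2 p)" "N2 = mat22 (kappa1 p) 0 \<gamma> (kappa2 p)"
    using N by (auto simp: normal_form_def)
  have "N0 *v (h *v u) = theta1 p *s (h *v u)" "u \<noteq> 0"
    using eig[of N0 u] u unfolding A' eigenvector_of_def by auto
  then have hu: "(h *v u) $ 2 = 0" "l \<noteq> 0"
    using nz[of u] ne unfolding NN by (auto simp: vec_eq_iff forall_2 mat2_vec_nth[of "mat22 _ _ _ _"] l_def)
  have "N2 *v (h *v v) = kappa2 p *s (h *v v)" "v \<noteq> 0"
    using eig[of N2 v] v unfolding A' eigenvector_of_def by auto
  then have hv: "(h *v v) $ 1 = 0" "m \<noteq> 0"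
    using nz[of v] ne unfolding NN by (auto simp: vec_eq_iff forall_2 mat2_vec_nth[of "mat22 _ _ _ _"] m_def)
  have "(h ** columns2 u v) $ i $ 1 = (h *v u) $ i" "(h ** columns2 u v) $ i $ 2 = (h *v v) $ i" for i
    by (simp_all add: mat2_mult_nth mat2_vec_nth columns2_def)
  then have hc: "h ** columns2 u v = mat22 l 0 0 m"
    using hu hv by (simp add: mat2_eq_iff l_def m_def)
  have "g ** (h ** columns2 u v) = columns2 u v" using gh by (simp add: matrix_mul_assoc)
  then have c: "columns2 u v = g ** mat22 l 0 0 m" by (simp add: hc)
  have D: "mat22 (1 / l) 0 0 (1 / m) ** mat22 l 0 0 m = mat 1" "mat22 l 0 0 m ** mat22 (1 / l) 0 0 (1 / m) = mat 1"
    using hu hv by (simp_all add: mat2_eq_iff mat2_mult_nth mat_1_nth)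
  have "matrix_inv (columns2 u v) = mat22 (1 / l) 0 0 (1 / m) ** h"
  proof (rule matrix_inv_eq)
    have "columns2 u v ** (mat22 (1 / l) 0 0 (1 / m) ** h) = g ** (mat22 l 0 0 m ** mat22 (1 / l) 0 0 (1 / m)) ** h"
      unfolding c by (simp only: matrix_mul_assoc)
    then show "columns2 u v ** (mat22 (1 / l) 0 0 (1 / m) ** h) = mat 1" using D gh by simp
    have "mat22 (1 / l) 0 0 (1 / m) ** h ** columns2 u v = mat22 (1 / l) 0 0 (1 / m) ** (h ** columns2 u v)"
      by (simp only: matrix_mul_assoc)
    then show "mat22 (1 / l) 0 0 (1 / m) ** h ** columns2 u v = mat 1" unfolding hc D .
  qed
  then have "matrix_inv (columns2 u v) ** matpoly_at (A0, A1, A2) z ** columns2 u v =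
      mat22 (1 / l) 0 0 (1 / m) ** ((h ** g) ** matpoly_at ?N z ** (h ** columns2 u v))" for z
    unfolding A' matpoly_at_conj N by (simp only: matrix_mul_assoc)
  then have "matrix_inv (columns2 u v) ** matpoly_at (A0, A1, A2) z ** columns2 u v =
      mat22 (1 / l) 0 0 (1 / m) ** matpoly_at ?N z ** mat22 l 0 0 m" for z
    unfolding hc gh by (simp add: matrix_mul_assoc)
  then have "matpoly_at B z = matpoly_at (gauged_form q p a b \<beta> \<gamma> y (m / l)) z" if "z \<noteq> 0" for z
    using B[OF that] gauged_at[OF hu(2) hv(2) that, of q p a b \<beta> \<gamma> y] by simp
  then have "B = gauged_form q p a b \<beta> \<gamma> y (m / l)" by (rule matpoly_eqI)
  then have BC: "(B, gauged_form q p a b \<beta> \<gamma> y 1) \<in> conj_rel"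
    using gauged_form_conj[of "m / l"] hu hv by simp
  show ?thesis
    unfolding cl' using conj_rel_trans[OF BC] conj_rel_trans[OF conj_rel_sym[OF BC]] by auto
qed

subsection \<open>The map in coordinates\<close>

text \<open>Write \<open>G\<close> and \<open>N\<close> for the constants in the first two claims.
  Applying the image matrix polynomial to its \<open>kappa2\<close>-eigenvector
  \<open>(q, d)\<close> and taking the determinant with \<open>(q, d)\<close> gives
  \<open>q (z N + G)\<close>. So \<open>G \<noteq> 0\<close> says that the new eigenlines differ,
  and \<open>Y N = - G\<close> that the new upper right entry vanishes at \<open>Y\<close>. The last
  identity evaluates the new lower right entry at \<open>Y\<close>, from which \<open>X\<close> is
  obtained through the determinant.\<close>

lemma phi_identities:
  fixes q k1 k2 t1 t2 u1 u2 u3 u4 y x :: complex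
  assumes nz: "q \<noteq> 0" "k1 \<noteq> 0" "k2 \<noteq> 0" "t1 \<noteq> 0" "t2 \<noteq> 0" "u1 \<noteq> 0" "u2 \<noteq> 0" "u3 \<noteq> 0" "u4 \<noteq> 0" "y \<noteq> 0" "x \<noteq> 0"
    and rel: "k1 * k2 * u1 * u2 * u3 * u4 = t1 * t2"
    and xs: "x5 = u1 * u2 / t1" "x6 = u1 * u2 / t2" "x7 = 1 / k1" "x8 = q / k2"
    and eta: "\<eta> = y * ((x - x8) / (x - x5))"
    and X: "X = x6 * x8 / (x * ((u3 * u4 / \<eta> - u4) / (u3 * u4 / \<eta> - u3 * u4 * x5 / (u1 * x8))) *
        ((u3 * u4 / \<eta> - u3) / (u3 * u4 / \<eta> - u3 * u4 * x5 / (u2 * x8))))"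
    and Y: "Y = u3 * u4 / \<eta> * ((X - x6) / (X - x7 / q))"
    and XY: "X \<noteq> 0" "Y \<noteq> 0"
    and a: "a = ((y - u1) * (y - u2) / x - k1 * y\<^sup>2 - t1) / y"
    and b: "b = (k1 * k2 * x * (y - u3) * (y - u4) - k2 * y\<^sup>2 - t2) / y"
    and ga: "\<gamma> = k1 * b + k2 * a + k1 * k2 * (u1 + u2 + u3 + u4)"
    and be: "\<beta> = - (t1 * b + t2 * a + k1 * k2 * (u1 * u2 * u3 + u1 * u2 * u4 + u1 * u3 * u4 + u2 * u3 * u4)) / y"
    and d: "d = k2 - q * k1"
  shows "d * (q * t1 - t2) - q * \<beta> \<noteq> 0"
    and "Y * (d * (q * a - d * y - b) - q * \<gamma>) = - (d * (q * t1 - t2) - q * \<beta>)"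
    and "k2 * Y\<^sup>2 + (q * a - y * d) * Y + q * t1 = q * k1 * k2 * X * ((Y - u3) * (Y - u4))"
proof -
  \<comment> \<open>These abbreviations clear all denominators: \<open>\<eta> = E / (k2 V)\<close>,
    and \<open>X = XN / (q k1 x XD)\<close> with \<open>XN\<close> and \<open>XD\<close>
    polynomial.\<close>
  define U where "U = k2 * x - q"
  define V where "V = t1 * x - u1 * u2"
  define E where "E = t1 * y * U"
  have xU: "x - x8 = U / k2" and xV: "x - x5 = V / t1" using nz by (simp_all add: xs U_def V_def field_simps)
  have eta0: "\<eta> \<noteq> 0" using XY Y by auto
  then have UV: "U \<noteq> 0" "V \<noteq> 0" using eta xU xV by auto
  have E0: "E \<noteq> 0" using UV nz by (simp add: E_def)
  have eta': "\<eta> = E / (k2 * V)" unfolding eta xU xV E_def using nz UV by (simp add: field_simps)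
  define XD where "XD = (E - u3 * k2 * V) * (E - u4 * k2 * V)"
  define XN where "XN = t1 * (u1 * y * U - q * V) * (u2 * y * U - q * V)"
  have n: "u3 * u4 / \<eta> - u4 = u4 * (u3 * k2 * V - E) / E" "u3 * u4 / \<eta> - u3 = u3 * (u4 * k2 * V - E) / E"
    unfolding eta' using nz UV E0 by (simp_all add: field_simps)
  have m: "u3 * u4 / \<eta> - u3 * u4 * x5 / (u1 * x8) = u3 * u4 * k2 * (q * V - u2 * y * U) / (E * q)"
    "u3 * u4 / \<eta> - u3 * u4 * x5 / (u2 * x8) = u3 * u4 * k2 * (q * V - u1 * y * U) / (E * q)"
    unfolding eta' xs E_def using nz UV by (simp_all add: field_simps)
  \<comment> \<open>Since division by zero yields zero, \<open>X \<noteq> 0\<close> already forces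
    every factor of the nested fraction to be nonzero.\<close>
  have fac: "u3 * k2 * V - E \<noteq> 0" "u4 * k2 * V - E \<noteq> 0" "q * V - u2 * y * U \<noteq> 0" "q * V - u1 * y * U \<noteq> 0"
    using XY(1) unfolding X n m by (auto split: if_splits)
  have X1: "X = x6 * x8 * u3 * u4 * k2\<^sup>2 * ((q * V - u1 * y * U) * (q * V - u2 * y * U)) / (q\<^sup>2 * x * ((u3 * k2 * V - E) * (u4 * k2 * V - E)))"
  proof -
    have "D / (x * ((u4 * p3 / E) / (u3 * u4 * k2 * r2 / (E * q))) * ((u3 * p4 / E) / (u3 * u4 * k2 * r1 / (E * q)))) =
        D * u3 * u4 * k2\<^sup>2 * (r1 * r2) / (q\<^sup>2 * x * (p3 * p4))"
      if "p3 \<noteq> 0" "p4 \<noteq> 0" "r1 \<noteq> 0" "r2 \<noteq> 0" for D p3 p4 r1 r2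
      using nz E0 that by (simp add: field_simps power2_eq_square)
    from this[OF fac(1,2,4,3)] show ?thesis unfolding X n m by simp
  qed
  have XD: "XD = (u3 * k2 * V - E) * (u4 * k2 * V - E)" by (simp add: XD_def algebra_simps)
  have XN: "XN = t1 * ((q * V - u1 * y * U) * (q * V - u2 * y * U))" by (simp add: XN_def algebra_simps)
  have XD0: "XD \<noteq> 0" unfolding XD using fac by simp
  have "x6 * x8 * u3 * u4 * k2\<^sup>2 / q\<^sup>2 = t1 / (q * k1)"
  proof -
    have "x6 * x8 * u3 * u4 * k2\<^sup>2 / q\<^sup>2 = (k1 * k2 * u1 * u2 * u3 * u4) / (t2 * q * k1)"
      unfolding xs using nz by (simp add: field_simps power2_eq_square)
    then show ?thesis unfolding rel using nz by simp
  qed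
  then have X2: "X = XN / (q * k1 * x * XD)"
    unfolding X1 XD[symmetric] XN using nz XD0 by (simp add: divide_simps) (simp add: algebra_simps)
  have XX: "q * k1 * X * (x * XD) = XN" unfolding X2 using nz XD0 by simp
  define G where "G = d * (q * t1 - t2) - q * \<beta>"
  define N where "N = d * (q * a - d * y - b) - q * \<gamma>"
  have ya: "x * (y * a) = (y - u1) * (y - u2) - (k1 * y\<^sup>2 + t1) * x"
    unfolding a using nz by (simp add: field_simps)
  have yb: "y * b = k1 * k2 * x * (y - u3) * (y - u4) - k2 * y\<^sup>2 - t2"
    unfolding b using nz by simp
  have Neq: "N = - k2 * b - q\<^sup>2 * k1 * a - d\<^sup>2 * y - q * k1 * k2 * (u1 + u2 + u3 + u4)"
    unfolding N_def ga d by (simp add: algebra_simps power2_eq_square)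
  have hN: "x * y * N = - k2 * x * (y * b) - q\<^sup>2 * k1 * (x * (y * a)) - d\<^sup>2 * x * y\<^sup>2 - q * k1 * k2 * (u1 + u2 + u3 + u4) * x * y"
    unfolding Neq by (simp add: algebra_simps power2_eq_square)
  \<comment> \<open>Multiplication by \<open>t1\<close> lets \<open>t2\<close> occur only in the
    product \<open>t1 * t2\<close>, which \<open>rel\<close> replaces; the rest is a polynomial
    identity.\<close>
  have h1: "t1 * (x * y * N) = - t1 * k2 * x * (k1 * k2 * x * (y - u3) * (y - u4) - k2 * y\<^sup>2)
      - t1 * q\<^sup>2 * k1 * ((y - u1) * (y - u2) - (k1 * y\<^sup>2 + t1) * x) - t1 * d\<^sup>2 * x * y\<^sup>2
      - t1 * q * k1 * k2 * (u1 + u2 + u3 + u4) * x * y + k2 * x * (t1 * t2)"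
    unfolding hN ya yb by (simp add: algebra_simps)
  have "t1 * V * (x * y * N) = V * (t1 * (x * y * N))" by (simp only: mult_ac)
  also have "\<dots> = V * (- t1 * k2 * x * (k1 * k2 * x * (y - u3) * (y - u4) - k2 * y\<^sup>2)
      - t1 * q\<^sup>2 * k1 * ((y - u1) * (y - u2) - (k1 * y\<^sup>2 + t1) * x) - t1 * d\<^sup>2 * x * y\<^sup>2
      - t1 * q * k1 * k2 * (u1 + u2 + u3 + u4) * x * y + k2 * x * (k1 * k2 * u1 * u2 * u3 * u4))"
    unfolding h1 rel ..
  also have "\<dots> = k1 * (XN - x * XD)"
    unfolding XN_def XD_def E_def U_def V_def d by algebra
  finally have A: "t1 * V * (x * y * N) = k1 * (XN - x * XD)" .
  have hG: "y\<^sup>2 * x * G = d * (q * t1 - t2) * x * y\<^sup>2 + q * (t1 * x * (y * b) + t2 * (x * (y * a))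
      + k1 * k2 * (u1 * u2 * u3 + u1 * u2 * u4 + u1 * u3 * u4 + u2 * u3 * u4) * x * y)"
    unfolding G_def be using nz(10) by (simp add: field_simps power2_eq_square)
  have h2: "t1 * (y\<^sup>2 * x * G) = d * (q * t1 * t1 - t1 * t2) * x * y\<^sup>2
      + q * (t1 * x * (t1 * (k1 * k2 * x * (y - u3) * (y - u4) - k2 * y\<^sup>2) - t1 * t2)
      + t1 * t2 * ((y - u1) * (y - u2) - (k1 * y\<^sup>2 + t1) * x)
      + t1 * k1 * k2 * (u1 * u2 * u3 + u1 * u2 * u4 + u1 * u3 * u4 + u2 * u3 * u4) * x * y)"
    unfolding hG ya yb by (simp add: algebra_simps)
  have "- t1 * t1 * U * (y\<^sup>2 * x * G) = - t1 * U * (t1 * (y\<^sup>2 * x * G))" by simp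
  also have "\<dots> = - t1 * U * (d * (q * t1 * t1 - k1 * k2 * u1 * u2 * u3 * u4) * x * y\<^sup>2
      + q * (t1 * x * (t1 * (k1 * k2 * x * (y - u3) * (y - u4) - k2 * y\<^sup>2) - k1 * k2 * u1 * u2 * u3 * u4)
      + k1 * k2 * u1 * u2 * u3 * u4 * ((y - u1) * (y - u2) - (k1 * y\<^sup>2 + t1) * x)
      + t1 * k1 * k2 * (u1 * u2 * u3 + u1 * u2 * u4 + u1 * u3 * u4 + u2 * u3 * u4) * x * y))"
    unfolding h2 rel ..
  also have "\<dots> = k1 * k2 * u3 * u4 * XN - q * k1 * t1 * x * XD"
    unfolding XN_def XD_def E_def U_def V_def d by algebra
  finally have B: "- t1 * t1 * U * (y\<^sup>2 * x * G) = k1 * k2 * u3 * u4 * XN - q * k1 * t1 * x * XD" .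
  \<comment> \<open>With this, the right-hand sides of \<open>B\<close> and \<open>A\<close> factor
    through \<open>X - x6\<close> and \<open>X - x7 / q\<close>; dividing one by the other
    reproduces the formula for \<open>Y\<close>.\<close>
  have x6: "k1 * k2 * u3 * u4 * x6 = t1"
    unfolding xs using rel nz by (simp add: field_simps)
  have dn: "X - x6 \<noteq> 0" "X - x7 / q \<noteq> 0" using XY(2) Y by auto
  have "k1 * k2 * u3 * u4 * XN - q * k1 * t1 * x * XD = k1 * k2 * u3 * u4 * q * k1 * (x * XD) * (X - x6)"
    unfolding XX[symmetric] x6[symmetric] by (simp add: algebra_simps)
  then have B': "- t1 * t1 * U * (y\<^sup>2 * x * G) = k1 * k2 * u3 * u4 * q * k1 * (x * XD) * (X - x6)" using B by simp
  then show "G \<noteq> 0" using dn XD0 nz by auto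
  have "XN - x * XD = q * k1 * (x * XD) * (X - x7 / q)"
    unfolding XX[symmetric] xs using nz by (simp add: algebra_simps)
  then have A': "t1 * V * (x * y * N) = k1 * (q * k1 * (x * XD) * (X - x7 / q))" using A by simp
  have Y': "Y * (E * (X - x7 / q)) = u3 * u4 * k2 * V * (X - x6)"
    unfolding Y eta' using dn E0 nz UV by simp
  have "(q * k1 * k1 * E * t1 * x * y * V * (x * XD) * (X - x7 / q)) * (Y * N) = (q * k1 * k1 * x * XD) * (Y * (E * (X - x7 / q))) * (t1 * V * (x * y * N))"
    by (simp only: mult_ac)
  also have "\<dots> = (q * k1 * k1 * x * XD) * (u3 * u4 * k2 * V * (X - x6)) * (k1 * (q * k1 * (x * XD) * (X - x7 / q)))"
    unfolding Y' A' ..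
  also have "\<dots> = V * (q * k1 * k1 * (x * XD) * (X - x7 / q)) * (k1 * k2 * u3 * u4 * q * k1 * (x * XD) * (X - x6))"
    by (simp only: mult_ac)
  also have "\<dots> = V * (q * k1 * k1 * (x * XD) * (X - x7 / q)) * (- t1 * t1 * U * (y\<^sup>2 * x * G))"
    unfolding B' ..
  also have "\<dots> = (q * k1 * k1 * E * t1 * x * y * V * (x * XD) * (X - x7 / q)) * (- G)"
    unfolding E_def by (simp add: power2_eq_square mult_ac)
  finally have "(q * k1 * k1 * E * t1 * x * y * V * (x * XD) * (X - x7 / q)) * (Y * N) =
      (q * k1 * k1 * E * t1 * x * y * V * (x * XD) * (X - x7 / q)) * (- G)" .
  moreover have "q * k1 * k1 * E * t1 * x * y * V * (x * XD) * (X - x7 / q) \<noteq> 0"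
    using nz E0 UV XD0 dn by simp
  ultimately show "Y * N = - G" by (metis mult_left_cancel)
  define C where "C = u3 * u4"
  \<comment> \<open>The third claim is reduced to three relations in terms of \<eta>:
    \<open>r1\<close> for \<open>Y\<close>, \<open>r2\<close> for the product \<open>X x\<close>,
    and \<open>r3\<close> for \<open>q a - y d\<close>. Together with two constant relations they
    imply it by polynomial algebra.\<close>
  have r1: "Y * \<eta> * (X - x7 / q) = C * (X - x6)" unfolding Y C_def using eta0 dn by simp
  have yU: "y * U = k2 * V * \<eta> / t1" unfolding eta' E_def using nz UV by simp
  have "q * k1 * X * (x * XD) = t1 * (u1 * (y * U) - q * V) * (u2 * (y * U) - q * V)"
    unfolding XX XN_def by (simp add: mult_ac)
  moreover have "XD = (k2 * V)\<^sup>2 * ((\<eta> - u3) * (\<eta> - u4))"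
  proof -
    have "E = k2 * V * \<eta>" unfolding eta' using nz UV by simp
    then show ?thesis unfolding XD_def by (simp add: power2_eq_square algebra_simps)
  qed
  ultimately have "V\<^sup>2 * (k2 * (q * k1 * k2 * X * x * ((\<eta> - u3) * (\<eta> - u4)))) =
      V\<^sup>2 * (k2 * k2 * x5 * \<eta>\<^sup>2 - k2 * q * (u1 + u2) * \<eta> + q\<^sup>2 * t1)"
    unfolding yU xs using nz by (simp add: field_simps power2_eq_square)
  also have "q\<^sup>2 * t1 = k2 * (q * x8 * t1)" unfolding xs using nz by (simp add: power2_eq_square)
  also have "V\<^sup>2 * (k2 * k2 * x5 * \<eta>\<^sup>2 - k2 * q * (u1 + u2) * \<eta> + k2 * (q * x8 * t1)) =
      V\<^sup>2 * (k2 * (k2 * x5 * \<eta>\<^sup>2 - q * (u1 + u2) * \<eta> + q * x8 * t1))" by (simp add: algebra_simps)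
  finally have "V\<^sup>2 * (k2 * (q * k1 * k2 * X * x * ((\<eta> - u3) * (\<eta> - u4)))) =
      V\<^sup>2 * (k2 * (k2 * x5 * \<eta>\<^sup>2 - q * (u1 + u2) * \<eta> + q * x8 * t1))" .
  then have r2: "q * k1 * k2 * X * x * ((\<eta> - u3) * (\<eta> - u4)) = k2 * x5 * \<eta>\<^sup>2 - q * (u1 + u2) * \<eta> + q * x8 * t1"
    using UV nz by simp
  define m where "m = q * a - y * d"
  have "x * y * m = q * (x * (y * a)) - d * x * y\<^sup>2" unfolding m_def by (simp add: power2_eq_square algebra_simps)
  then have "x * y * m = - y * (y * U) - q * (u1 + u2) * y - q * V"
    unfolding ya d U_def V_def by (simp add: power2_eq_square algebra_simps)
  moreover have "q * V * \<eta> = y * (q * t1 * (x - x8))" unfolding eta' xU E_def using nz UV by simp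
  moreover have "y * U * \<eta> = k2 * \<eta>\<^sup>2 * (x - x5)" unfolding yU xV by (simp add: power2_eq_square)
  ultimately have "y * (x * m * \<eta>) = y * (- k2 * \<eta>\<^sup>2 * (x - x5) - q * (u1 + u2) * \<eta> - q * t1 * (x - x8))"
    by algebra
  then have r3: "x * m * \<eta> = - k2 * \<eta>\<^sup>2 * (x - x5) - q * (u1 + u2) * \<eta> - q * t1 * (x - x8)" using nz by simp
  define K where "K = q * k1 * k2"
  have k: "K * (x7 / q) = k2" "K * C * x6 = q * t1" unfolding K_def C_def xs using nz rel by (simp_all add: field_simps)
  define x7q where "x7q = x7 / q"
  have r2': "K * X * x * ((\<eta> - u3) * (\<eta> - u4)) = k2 * x5 * \<eta>\<^sup>2 - q * (u1 + u2) * \<eta> + q * x8 * t1"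
    using r2 by (simp add: K_def)
  have "x * \<eta> * (K * X * ((Y - u3) * (Y - u4)) - (k2 * Y\<^sup>2 + m * Y + q * t1)) = 0"
    using r1 r2' r3 k unfolding x7q_def[symmetric] C_def by algebra
  then show "k2 * Y\<^sup>2 + (q * a - y * d) * Y + q * t1 = q * k1 * k2 * X * ((Y - u3) * (Y - u4))"
    using nz eta0 by (simp add: m_def K_def)
qed

text \<open>Passing to a basis of eigenvectors for the new eigenlines brings the image back to
  normal form; \<open>ne\<close> says that these lines are different.\<close>

lemma gauged_form_normal:
  fixes q a b \<beta> \<gamma> y Y :: complex and p :: params
  defines "d \<equiv> kappa2 p - q * kappa1 p" and "T \<equiv> q * theta1 p - theta2 p"
  defines "a' \<equiv> b + y * d - T / Y" and "b' \<equiv> q * a - y * d + T / Y"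
  assumes "q \<noteq> 0" "Y \<noteq> 0" and ne: "d * T - q * \<beta> \<noteq> 0"
    and YN: "Y * (d * (q * a - d * y - b) - q * \<gamma>) = - (d * T - q * \<beta>)"
  shows "(normal_form (shift_params q p) a' b' ((T * a' - (q * a * T - q * y * \<beta>)) / Y) (- q * \<beta> / Y) Y,
    gauged_form q p a b \<beta> \<gamma> y 1) \<in> conj_rel"
proof -
  define \<beta>' where "\<beta>' = (T * a' - (q * a * T - q * y * \<beta>)) / Y"
  have Yb': "Y * b' = Y * (q * a) - Y * (y * d) + T" and Ya': "Y * a' = Y * b + Y * (y * d) - T"
    using assms(6) by (simp_all add: a'_def b'_def distrib_left right_diff_distrib)
  have Y\<beta>: "Y * \<beta>' = T * a' - (q * a * T - q * y * \<beta>)" using assms(6) by (simp add: \<beta>'_def)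
  \<comment> \<open>The first column spans the \<open>q \<theta>1\<close>-eigenline of the constant
    term. The second is \<open>- Y / q\<close> times the \<open>kappa2\<close>-eigenvector
    \<open>(q, d)\<close> of the leading term, scaled so that the upper right entry becomes
    \<open>z - Y\<close>.\<close>
  let ?G = "mat22 T (- Y) \<beta> (- d * Y / q)"
  have e1: "T - Y * b' = y * (d * Y) - q * a * Y" using Yb' by algebra
  have e2: "q * \<beta> - d * (Y * b') = - (q * (\<gamma> * Y)) - b * (d * Y)" using Yb' YN by algebra
  have e3: "q * (\<beta> * a') - d * (Y * \<beta>') = q * (\<gamma> * T + b * \<beta>)"
  proof -
    have "Y * (q * (\<beta> * a') - d * (Y * \<beta>') - q * (\<gamma> * T + b * \<beta>)) = 0"
      using Ya' Y\<beta> YN by algebra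
    then show ?thesis using assms(6) by simp
  qed
  show ?thesis
    unfolding normal_form_def gauged_form_def \<beta>'_def[symmetric]
  proof (rule conj_relI[of ?G])
    have "?G $ 1 $ 1 * ?G $ 2 $ 2 - ?G $ 1 $ 2 * ?G $ 2 $ 1 = - Y / q * (d * T - q * \<beta>)"
      using assms(5) by (simp add: field_simps)
    then show "?G $ 1 $ 1 * ?G $ 2 $ 2 - ?G $ 1 $ 2 * ?G $ 2 $ 1 \<noteq> 0" using ne assms(5,6) by simp
    show "?G ** mat22 (theta1 (shift_params q p)) (- Y) 0 (theta2 (shift_params q p)) =
        mat22 (q * theta1 p) 0 (\<beta> / 1) (theta2 p) ** ?G"
      using assms(5) by (simp add: mat2_eq_iff mat2_mult_nth T_def field_simps)
    show "?G ** mat22 (kappa1 (shift_params q p)) 0 (- q * \<beta> / Y) (kappa2 (shift_params q p)) =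
        mat22 (q * kappa1 p) (q * 1) 0 (kappa2 p) ** ?G"
      using assms(5,6) by (simp add: mat2_eq_iff mat2_mult_nth d_def field_simps)
    have "T * a' + - Y * \<beta>' = q * a * T + - q * y * \<beta>" using Y\<beta> by algebra
    moreover have "\<beta> * a' + - d * Y / q * \<beta>' = \<gamma> * T + b * \<beta>" using e3 assms(5) by (simp add: field_simps)
    moreover have "T + - Y * b' = q * a * (- Y) + - q * y * (- d * Y / q)" using e1 assms(5) by (simp add: field_simps)
    moreover have "\<beta> + - d * Y / q * b' = \<gamma> * (- Y) + b * (- d * Y / q)" using e2 assms(5) by (simp add: field_simps)
    ultimately show "?G ** mat22 a' 1 \<beta>' b' = mat22 (q * a) (- q * y * 1) (\<gamma> / 1) b ** ?G"
      by (simp add: mat2_eq_iff mat2_mult_nth)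
  qed
qed

text \<open>The definition of \<open>x\<close> gives \<open>a\<close>; the determinant at
  \<open>z = y\<close>, where the off-diagonal product vanishes, gives \<open>b\<close>; comparing
  coefficients of the determinant gives \<gamma> and \<beta>.\<close>

lemma normal_form_coefficients:
  assumes p: "p \<in> param_space" and N: "normal_form p a b \<beta> \<gamma> y \<in> Xbar p"
    and P: "kappa1 p * y\<^sup>2 + a * y + theta1 p \<noteq> 0"
    and x: "x = (y - c1 p) * (y - c2 p) / (kappa1 p * y\<^sup>2 + a * y + theta1 p)" and nz: "x \<noteq> 0" "y \<noteq> 0"
  shows "a = ((y - c1 p) * (y - c2 p) / x - kappa1 p * y\<^sup>2 - theta1 p) / y"
    and "b = (kappa1 p * kappa2 p * x * (y - c3 p) * (y - c4 p) - kappa2 p * y\<^sup>2 - theta2 p) / y"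
    and "\<gamma> = kappa1 p * b + kappa2 p * a + kappa1 p * kappa2 p * (c1 p + c2 p + c3 p + c4 p)"
    and "\<beta> = - (theta1 p * b + theta2 p * a + kappa1 p * kappa2 p * (c1 p * c2 p * c3 p + c1 p * c2 p * c4 p + c1 p * c3 p * c4 p + c2 p * c3 p * c4 p)) / y"
proof -
  have det: "(kappa1 p * z\<^sup>2 + a * z + theta1 p) * (kappa2 p * z\<^sup>2 + b * z + theta2 p) - (z - y) * z * (\<gamma> * z + \<beta>)
      = kappa1 p * kappa2 p * ((z - c1 p) * (z - c2 p) * (z - c3 p) * (z - c4 p))" for z
    using N by (simp add: normal_form_Xbar_iff)
  have xP0: "(y - c1 p) * (y - c2 p) = (kappa1 p * y\<^sup>2 + a * y + theta1 p) * x" using P unfolding x by simp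
  then have xP: "(y - c1 p) * (y - c2 p) / x = kappa1 p * y\<^sup>2 + a * y + theta1 p"
    using nz by simp
  show "a = ((y - c1 p) * (y - c2 p) / x - kappa1 p * y\<^sup>2 - theta1 p) / y"
    unfolding xP using nz by simp
  have "(kappa1 p * y\<^sup>2 + a * y + theta1 p) * (kappa2 p * y\<^sup>2 + b * y + theta2 p) =
      (kappa1 p * y\<^sup>2 + a * y + theta1 p) * (kappa1 p * kappa2 p * x * (y - c3 p) * (y - c4 p))"
  proof -
    have "(kappa1 p * y\<^sup>2 + a * y + theta1 p) * (kappa2 p * y\<^sup>2 + b * y + theta2 p) =
        kappa1 p * kappa2 p * (((y - c1 p) * (y - c2 p)) * ((y - c3 p) * (y - c4 p)))"
      using det[of y] by (simp add: mult.assoc)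
    then show ?thesis unfolding xP0 by (simp only: mult_ac)
  qed
  then have "kappa2 p * y\<^sup>2 + b * y + theta2 p = kappa1 p * kappa2 p * x * (y - c3 p) * (y - c4 p)"
    using P by simp
  then show "b = (kappa1 p * kappa2 p * x * (y - c3 p) * (y - c4 p) - kappa2 p * y\<^sup>2 - theta2 p) / y"
    using nz by (simp add: field_simps)
  have rel: "kappa1 p * kappa2 p * c1 p * c2 p * c3 p * c4 p = theta1 p * theta2 p" using p by (simp add: param_space_def)
  \<comment> \<open>Coefficients of the difference between the determinant and its prescribed value.
    The leading terms cancel, and the constant terms agree by the relation between the
    parameters.\<close>
  define f3 where "f3 = kappa1 p * b + kappa2 p * a - \<gamma> + kappa1 p * kappa2 p * (c1 p + c2 p + c3 p + c4 p)"
  define f2 where "f2 = kappa1 p * theta2 p + kappa2 p * theta1 p + a * b - \<beta> + y * \<gamma>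
    - kappa1 p * kappa2 p * (c1 p * c2 p + c1 p * c3 p + c1 p * c4 p + c2 p * c3 p + c2 p * c4 p + c3 p * c4 p)"
  define f1 where "f1 = theta1 p * b + theta2 p * a + y * \<beta>
    + kappa1 p * kappa2 p * (c1 p * c2 p * c3 p + c1 p * c2 p * c4 p + c1 p * c3 p * c4 p + c2 p * c3 p * c4 p)"
  have f: "f3 * z ^ 3 + f2 * z\<^sup>2 + f1 * z = 0" for z
  proof -
    have "f3 * z ^ 3 + f2 * z\<^sup>2 + f1 * z = (kappa1 p * z\<^sup>2 + a * z + theta1 p) * (kappa2 p * z\<^sup>2 + b * z + theta2 p)
        - (z - y) * z * (\<gamma> * z + \<beta>) - kappa1 p * kappa2 p * ((z - c1 p) * (z - c2 p) * (z - c3 p) * (z - c4 p))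
        + (kappa1 p * kappa2 p * c1 p * c2 p * c3 p * c4 p - theta1 p * theta2 p)"
      unfolding f3_def f2_def f1_def by algebra
    then show ?thesis using det[of z] rel by simp
  qed
  have e: "f3 + f2 + f1 = 0" "- f3 + f2 - f1 = 0" "f3 * 8 + f2 * 4 + f1 * 2 = 0"
    using f[of 1] f[of "-1"] f[of 2] by simp_all
  have "6 * f3 = 0" using e by algebra
  moreover have "2 * f2 = 0" using e by algebra
  ultimately have f0: "f3 = 0" "f1 = 0" using e(1) by auto
  show "\<gamma> = kappa1 p * b + kappa2 p * a + kappa1 p * kappa2 p * (c1 p + c2 p + c3 p + c4 p)"
    using f0(1) unfolding f3_def by algebra
  have "y * \<beta> = - (theta1 p * b + theta2 p * a + kappa1 p * kappa2 p * (c1 p * c2 p * c3 p + c1 p * c2 p * c4 p + c1 p * c3 p * c4 p + c2 p * c3 p * c4 p))"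
    using f0(2) unfolding f1_def by algebra
  then show "\<beta> = - (theta1 p * b + theta2 p * a + kappa1 p * kappa2 p * (c1 p * c2 p * c3 p + c1 p * c2 p * c4 p + c1 p * c3 p * c4 p + c2 p * c3 p * c4 p)) / y"
    using nz by (metis nonzero_mult_div_cancel_left)
qed

text \<open>With these coefficients the determinant can differ from its prescribed value only in the
  quadratic term. At \<open>z = y\<close> both agree by the choice of \<open>a\<close> and
  \<open>b\<close>, and \<open>y \<noteq> 0\<close> then removes the quadratic term.\<close>

lemma normal_form_exists:
  assumes p: "p \<in> param_space" and nz: "x \<noteq> 0" "y \<noteq> 0" "y \<noteq> c1 p" "y \<noteq> c2 p"
  obtains a b \<beta> \<gamma> where "normal_form p a b \<beta> \<gamma> y \<in> Xbar p" "kappa1 p * y\<^sup>2 + a * y + theta1 p \<noteq> 0"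
    "x = (y - c1 p) * (y - c2 p) / (kappa1 p * y\<^sup>2 + a * y + theta1 p)"
proof -
  define a where "a = ((y - c1 p) * (y - c2 p) / x - kappa1 p * y\<^sup>2 - theta1 p) / y"
  define b where "b = (kappa1 p * kappa2 p * x * (y - c3 p) * (y - c4 p) - kappa2 p * y\<^sup>2 - theta2 p) / y"
  define \<gamma> where "\<gamma> = kappa1 p * b + kappa2 p * a + kappa1 p * kappa2 p * (c1 p + c2 p + c3 p + c4 p)"
  define \<beta> where "\<beta> = - (theta1 p * b + theta2 p * a + kappa1 p * kappa2 p * (c1 p * c2 p * c3 p + c1 p * c2 p * c4 p + c1 p * c3 p * c4 p + c2 p * c3 p * c4 p)) / y"
  have rel: "kappa1 p * kappa2 p * c1 p * c2 p * c3 p * c4 p = theta1 p * theta2 p" using p by (simp add: param_space_def)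
  have P: "kappa1 p * y\<^sup>2 + a * y + theta1 p = (y - c1 p) * (y - c2 p) / x" using nz by (simp add: a_def)
  have Q: "kappa2 p * y\<^sup>2 + b * y + theta2 p = kappa1 p * kappa2 p * x * (y - c3 p) * (y - c4 p)" using nz by (simp add: b_def)
  have PQ: "(kappa1 p * y\<^sup>2 + a * y + theta1 p) * (kappa2 p * y\<^sup>2 + b * y + theta2 p) =
      kappa1 p * kappa2 p * ((y - c1 p) * (y - c2 p) * (y - c3 p) * (y - c4 p))"
    unfolding P Q using nz by simp
  have ybeta: "y * \<beta> = - (theta1 p * b + theta2 p * a + kappa1 p * kappa2 p * (c1 p * c2 p * c3 p + c1 p * c2 p * c4 p + c1 p * c3 p * c4 p + c2 p * c3 p * c4 p))"
    using nz by (simp add: \<beta>_def)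
  define f2 where "f2 = kappa1 p * theta2 p + kappa2 p * theta1 p + a * b - \<beta> + y * \<gamma>
    - kappa1 p * kappa2 p * (c1 p * c2 p + c1 p * c3 p + c1 p * c4 p + c2 p * c3 p + c2 p * c4 p + c3 p * c4 p)"
  have f: "(kappa1 p * z\<^sup>2 + a * z + theta1 p) * (kappa2 p * z\<^sup>2 + b * z + theta2 p) - (z - y) * z * (\<gamma> * z + \<beta>)
      - kappa1 p * kappa2 p * ((z - c1 p) * (z - c2 p) * (z - c3 p) * (z - c4 p)) = f2 * z\<^sup>2" for z
  proof -
    have "(kappa1 p * z\<^sup>2 + a * z + theta1 p) * (kappa2 p * z\<^sup>2 + b * z + theta2 p) - (z - y) * z * (\<gamma> * z + \<beta>)
      - kappa1 p * kappa2 p * ((z - c1 p) * (z - c2 p) * (z - c3 p) * (z - c4 p)) = f2 * z\<^sup>2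
      + (theta1 p * theta2 p - kappa1 p * kappa2 p * c1 p * c2 p * c3 p * c4 p)
      + z * (y * \<beta> + (theta1 p * b + theta2 p * a + kappa1 p * kappa2 p * (c1 p * c2 p * c3 p + c1 p * c2 p * c4 p + c1 p * c3 p * c4 p + c2 p * c3 p * c4 p)))"
      unfolding f2_def \<gamma>_def by algebra
    then show ?thesis using rel ybeta by simp
  qed
  have "f2 * y\<^sup>2 = 0" using f[of y] PQ by simp
  then have "f2 = 0" using nz by simp
  then have "normal_form p a b \<beta> \<gamma> y \<in> Xbar p" using f by (simp add: normal_form_Xbar_iff)
  moreover have "kappa1 p * y\<^sup>2 + a * y + theta1 p \<noteq> 0" unfolding P using nz by simp
  moreover have "x = (y - c1 p) * (y - c2 p) / (kappa1 p * y\<^sup>2 + a * y + theta1 p)" unfolding P using nz by simp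
  ultimately show thesis by (rule that)
qed

lemma phi_at_point:
  fixes q y x \<eta> X Y :: complex and p :: params
  defines "x5 \<equiv> c1 p * c2 p / theta1 p" and "x6 \<equiv> c1 p * c2 p / theta2 p" and "x7 \<equiv> 1 / kappa1 p" and "x8 \<equiv> q / kappa2 p"
  assumes p: "p \<in> param_space" and q: "q \<noteq> 0" and ne: "kappa1 p \<noteq> kappa2 p" "theta1 p \<noteq> theta2 p"
    and nz: "x \<noteq> 0" "y \<noteq> 0" "y \<noteq> c1 p" "y \<noteq> c2 p"
    and eta: "\<eta> = y * ((x - x8) / (x - x5))"
    and X: "X = x6 * x8 / (x * ((c3 p * c4 p / \<eta> - c4 p) / (c3 p * c4 p / \<eta> - c3 p * c4 p * x5 / (c1 p * x8))) *
        ((c3 p * c4 p / \<eta> - c3 p) / (c3 p * c4 p / \<eta> - c3 p * c4 p * x5 / (c2 p * x8))))"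
    and Y: "Y = c3 p * c4 p / \<eta> * ((X - x6) / (X - x7 / q))"
    and XY: "X \<noteq> 0" "Y \<noteq> 0" "Y \<noteq> c1 p" "Y \<noteq> c2 p" "Y \<noteq> c3 p" "Y \<noteq> c4 p"
  shows "(\<exists>cl cl'. has_coords p cl y x \<and> phi_rel q p cl cl') \<and>
    (\<forall>cl cl'. has_coords p cl y x \<and> phi_rel q p cl cl' \<longrightarrow> has_coords (shift_params q p) cl' Y X)"
proof (intro conjI allI impI)
  obtain a b \<beta> \<gamma> where N: "normal_form p a b \<beta> \<gamma> y \<in> Xbar p" "kappa1 p * y\<^sup>2 + a * y + theta1 p \<noteq> 0"
    "x = (y - c1 p) * (y - c2 p) / (kappa1 p * y\<^sup>2 + a * y + theta1 p)"
    using normal_form_exists[OF p nz] by blast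
  have "conj_rel `` {normal_form p a b \<beta> \<gamma> y} \<in> X_space p" using N(1) X_space_iff by blast
  moreover have "normal_form p a b \<beta> \<gamma> y \<in> conj_rel `` {normal_form p a b \<beta> \<gamma> y}" using conj_rel_refl by blast
  ultimately have "has_coords p (conj_rel `` {normal_form p a b \<beta> \<gamma> y}) y x"
    unfolding has_coords_def using N by blast
  then show "\<exists>cl cl'. has_coords p cl y x \<and> phi_rel q p cl cl'"
    using phi_rel_gauged[OF N(1)] by blast
next
  fix cl cl' assume "has_coords p cl y x \<and> phi_rel q p cl cl'"
  then obtain a b \<beta> \<gamma> where cl: "cl \<in> X_space p" "normal_form p a b \<beta> \<gamma> y \<in> cl"
    and P: "kappa1 p * y\<^sup>2 + a * y + theta1 p \<noteq> 0"
    and x: "x = (y - c1 p) * (y - c2 p) / (kappa1 p * y\<^sup>2 + a * y + theta1 p)" and phi: "phi_rel q p cl cl'"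
    unfolding has_coords_def by blast
  have N: "normal_form p a b \<beta> \<gamma> y \<in> Xbar p" using X_space_memD[OF cl] by blast
  have cl': "cl' = conj_rel `` {gauged_form q p a b \<beta> \<gamma> y 1}" by (rule phi_relD[OF phi cl(2) ne])
  have gX: "gauged_form q p a b \<beta> \<gamma> y 1 \<in> Xbar (shift_params q p)" by (rule gauged_form_Xbar[OF N]) simp
  have pz: "kappa1 p \<noteq> 0" "kappa2 p \<noteq> 0" "theta1 p \<noteq> 0" "theta2 p \<noteq> 0" "c1 p \<noteq> 0" "c2 p \<noteq> 0" "c3 p \<noteq> 0" "c4 p \<noteq> 0"
    and rel: "kappa1 p * kappa2 p * c1 p * c2 p * c3 p * c4 p = theta1 p * theta2 p"
    using p by (auto simp: param_space_def)
  define d where "d = kappa2 p - q * kappa1 p"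
  define T where "T = q * theta1 p - theta2 p"
  note id = phi_identities[OF q pz nz(2,1) rel x5_def[THEN meta_eq_to_obj_eq] x6_def[THEN meta_eq_to_obj_eq]
      x7_def[THEN meta_eq_to_obj_eq] x8_def[THEN meta_eq_to_obj_eq] eta X Y XY(1,2)
      normal_form_coefficients[OF p N P x nz(1,2)] d_def, folded T_def]
  define a' where "a' = b + y * d - T / Y"
  define b' where "b' = q * a - y * d + T / Y"
  define \<beta>' where "\<beta>' = (T * a' - (q * a * T - q * y * \<beta>)) / Y"
  define \<gamma>' where "\<gamma>' = - q * \<beta> / Y"
  have conj: "(normal_form (shift_params q p) a' b' \<beta>' \<gamma>' Y, gauged_form q p a b \<beta> \<gamma> y 1) \<in> conj_rel"
    unfolding a'_def b'_def \<beta>'_def \<gamma>'_def d_def T_def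
    by (rule gauged_form_normal[OF q XY(2)]) (use id in \<open>simp_all only: d_def T_def not_False_eq_True simp_thms\<close>)
  have mem: "normal_form (shift_params q p) a' b' \<beta>' \<gamma>' Y \<in> cl'"
    unfolding cl' using conj_rel_sym[OF conj] by blast
  have NX: "normal_form (shift_params q p) a' b' \<beta>' \<gamma>' Y \<in> Xbar (shift_params q p)"
    by (rule Xbar_conj[OF conj_rel_sym[OF conj] gX])
  have Q: "kappa2 p * Y\<^sup>2 + b' * Y + theta2 p = q * kappa1 p * kappa2 p * X * ((Y - c3 p) * (Y - c4 p))"
  proof -
    have "b' * Y = (q * a - y * d) * Y + T" using XY(2) by (simp add: b'_def distrib_right)
    then show ?thesis using id(3) by (simp add: T_def add.assoc)
  qed
  \<comment> \<open>At \<open>z = Y\<close> the off-diagonal product vanishes, so the product of the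
    diagonal entries is the prescribed determinant; cancelling the known lower right entry leaves
    the formula that defines the second coordinate.\<close>
  have "(q * kappa1 p * Y\<^sup>2 + a' * Y + q * theta1 p) * (kappa2 p * Y\<^sup>2 + b' * Y + theta2 p) =
      q * kappa1 p * kappa2 p * ((Y - c1 p) * (Y - c2 p) * (Y - c3 p) * (Y - c4 p))"
    using NX[unfolded normal_form_Xbar_iff, rule_format, of Y] by simp
  then have "(q * kappa1 p * kappa2 p * ((Y - c3 p) * (Y - c4 p))) * ((q * kappa1 p * Y\<^sup>2 + a' * Y + q * theta1 p) * X)
      = (q * kappa1 p * kappa2 p * ((Y - c3 p) * (Y - c4 p))) * ((Y - c1 p) * (Y - c2 p))"
    unfolding Q by (simp only: mult_ac)
  then have PX: "(q * kappa1 p * Y\<^sup>2 + a' * Y + q * theta1 p) * X = (Y - c1 p) * (Y - c2 p)"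
    using q pz XY by simp
  then have P0: "q * kappa1 p * Y\<^sup>2 + a' * Y + q * theta1 p \<noteq> 0" using XY by auto
  moreover have "X = (Y - c1 p) * (Y - c2 p) / (q * kappa1 p * Y\<^sup>2 + a' * Y + q * theta1 p)"
    using PX P0 by (simp add: field_simps)
  moreover have "cl' \<in> X_space (shift_params q p)" unfolding cl' using gX X_space_iff by blast
  ultimately show "has_coords (shift_params q p) cl' Y X"
    unfolding has_coords_def using mem by auto
qed

subsection \<open>Values of rational functions at generic points\<close>

definition generic_point :: "(complex \<Rightarrow> complex \<Rightarrow> bool) \<Rightarrow> bool" where
  "generic_point Q \<longleftrightarrow> (\<exists>g. g \<noteq> 0 \<and> (\<forall>y x. poly_at g y x \<noteq> 0 \<longrightarrow> Q y x))"

lemma poly_at_mult: "poly_at (P * Q) y x = poly_at P y x * poly_at Q y x"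
  and poly_at_add: "poly_at (P + Q) y x = poly_at P y x + poly_at Q y x"
  by (simp_all add: poly_at_def)

lemma generic_point_conj:
  assumes "generic_point Q" "generic_point R" shows "generic_point (\<lambda>y x. Q y x \<and> R y x)"
proof -
  obtain g h where "g \<noteq> 0" "\<And>y x. poly_at g y x \<noteq> 0 \<Longrightarrow> Q y x" "h \<noteq> 0" "\<And>y x. poly_at h y x \<noteq> 0 \<Longrightarrow> R y x"
    using assms unfolding generic_point_def by blast
  then show ?thesis unfolding generic_point_def by (intro exI[of _ "g * h"]) (simp add: poly_at_mult)
qed

lemma generic_point_mono: "generic_point Q \<Longrightarrow> (\<And>y x. Q y x \<Longrightarrow> R y x) \<Longrightarrow> generic_point R"
  unfolding generic_point_def by blast

text \<open>The reduced denominator divides any other denominator, so every fraction for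
  \<open>f\<close> computes its value wherever its own denominator is nonzero.\<close>

lemma ratfun_at_fract:
  assumes "f = to_fract a / to_fract b" "poly_at b y x \<noteq> 0"
  shows "poly_at (denom f) y x \<noteq> 0" "ratfun_at f y x = poly_at a y x / poly_at b y x"
proof -
  have b: "b \<noteq> 0" using assms(2) by (auto simp: poly_at_def)
  have "to_fract (numer f) / to_fract (denom f) = to_fract a / to_fract b"
    using assms(1) numer_denom(1) by simp
  then have "to_fract (numer f * b) = to_fract (a * denom f)"
    using b by (simp add: frac_eq_eq)
  then have eq: "numer f * b = a * denom f" by (simp only: to_fract_eq_iff)
  then have "denom f dvd numer f * b" by simp
  then have "denom f dvd b"
    using numer_denom(3)[of f] by (simp add: coprime_commute coprime_dvd_mult_right_iff)
  then obtain c where c: "b = denom f * c" by blast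
  show d: "poly_at (denom f) y x \<noteq> 0" using assms(2) by (auto simp: c poly_at_mult)
  have "poly_at (numer f) y x * poly_at b y x = poly_at a y x * poly_at (denom f) y x"
    using eq by (metis poly_at_mult)
  then show "ratfun_at f y x = poly_at a y x / poly_at b y x"
    using d assms(2) by (simp add: ratfun_at_def frac_eq_eq)
qed

text \<open>Lets formulas in the function field be evaluated pointwise: the exceptional curve may
  grow with each operation, so only nonzero divisors in the field have to be checked.\<close>

definition agrees :: "ratfun \<Rightarrow> (complex \<Rightarrow> complex \<Rightarrow> complex) \<Rightarrow> bool" where
  "agrees f F \<longleftrightarrow> generic_point (\<lambda>y x. poly_at (denom f) y x \<noteq> 0 \<and> ratfun_at f y x = F y x)"

lemma agrees_fract:
  assumes "f = to_fract a / to_fract b" "b \<noteq> 0" shows "agrees f (\<lambda>y x. poly_at a y x / poly_at b y x)"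
  unfolding agrees_def generic_point_def using ratfun_at_fract[OF assms(1)] assms(2) by blast

lemma agrees_cong:
  assumes "agrees f F" "generic_point (\<lambda>y x. F y x = G y x)" shows "agrees f G"
  using generic_point_conj[OF assms(1)[unfolded agrees_def] assms(2)]
  unfolding agrees_def by (rule generic_point_mono) auto

lemma agrees_repr:
  assumes "agrees f F" shows "generic_point (\<lambda>y x. poly_at (denom f) y x \<noteq> 0 \<and> F y x = poly_at (numer f) y x / poly_at (denom f) y x)"
  using assms unfolding agrees_def by (rule generic_point_mono) (auto simp: ratfun_at_def)

lemma agrees_const: "agrees (const_fun c) (\<lambda>y x. c)"
  using agrees_fract[of "const_fun c" "[:[:c:]:]" 1] by (simp add: const_fun_def poly_at_def)

lemma agrees_y: "agrees y_fun (\<lambda>y x. y)" and agrees_xi: "agrees xi_fun (\<lambda>y x. x)"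
  using agrees_fract[of y_fun y_poly 1] agrees_fract[of xi_fun xi_poly 1]
  by (simp_all add: y_fun_def xi_fun_def y_poly_def xi_poly_def poly_at_def)

lemma agrees_add:
  assumes "agrees f F" "agrees g G" shows "agrees (f + g) (\<lambda>y x. F y x + G y x)"
proof (rule agrees_cong)
  have "f + g = to_fract (numer f) / to_fract (denom f) + to_fract (numer g) / to_fract (denom g)"
    by (simp only: numer_denom)
  also have "\<dots> = to_fract (numer f * denom g + numer g * denom f) / to_fract (denom f * denom g)"
    by (simp add: add_frac_eq)
  finally show "agrees (f + g) (\<lambda>y x. poly_at (numer f * denom g + numer g * denom f) y x / poly_at (denom f * denom g) y x)"
    by (rule agrees_fract) simp
  show "generic_point (\<lambda>y x. poly_at (numer f * denom g + numer g * denom f) y x / poly_at (denom f * denom g) y x = F y x + G y x)"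
    using generic_point_conj[OF agrees_repr[OF assms(1)] agrees_repr[OF assms(2)]]
    by (rule generic_point_mono) (simp add: poly_at_mult poly_at_add add_frac_eq)
qed

lemma agrees_mult:
  assumes "agrees f F" "agrees g G" shows "agrees (f * g) (\<lambda>y x. F y x * G y x)"
proof (rule agrees_cong)
  have "f * g = (to_fract (numer f) / to_fract (denom f)) * (to_fract (numer g) / to_fract (denom g))"
    by (simp only: numer_denom)
  also have "\<dots> = to_fract (numer f * numer g) / to_fract (denom f * denom g)" by simp
  finally show "agrees (f * g) (\<lambda>y x. poly_at (numer f * numer g) y x / poly_at (denom f * denom g) y x)"
    by (rule agrees_fract) simp
  show "generic_point (\<lambda>y x. poly_at (numer f * numer g) y x / poly_at (denom f * denom g) y x = F y x * G y x)"
    using generic_point_conj[OF agrees_repr[OF assms(1)] agrees_repr[OF assms(2)]]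
    by (rule generic_point_mono) (simp add: poly_at_mult)
qed

lemma agrees_diff:
  assumes "agrees f F" "agrees g G" shows "agrees (f - g) (\<lambda>y x. F y x - G y x)"
  using agrees_add[OF assms(1) agrees_mult[OF agrees_const[of "-1"] assms(2)]] by (simp add: const_fun_minus)

lemma agrees_nonzero:
  assumes "agrees f F" "f \<noteq> 0" shows "generic_point (\<lambda>y x. F y x \<noteq> 0)"
proof -
  have "generic_point (\<lambda>y x. poly_at (numer f) y x \<noteq> 0)"
    unfolding generic_point_def using assms(2) by (intro exI[of _ "numer f"]) simp
  from generic_point_conj[OF agrees_repr[OF assms(1)] this] show ?thesis
    by (rule generic_point_mono) simp
qed

lemma agrees_divide:
  assumes "agrees f F" "agrees g G" "g \<noteq> 0" shows "agrees (f / g) (\<lambda>y x. F y x / G y x)"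
proof (rule agrees_cong)
  have "f / g = (to_fract (numer f) / to_fract (denom f)) / (to_fract (numer g) / to_fract (denom g))"
    by (simp only: numer_denom)
  also have "\<dots> = to_fract (numer f * denom g) / to_fract (denom f * numer g)" by simp
  finally show "agrees (f / g) (\<lambda>y x. poly_at (numer f * denom g) y x / poly_at (denom f * numer g) y x)"
    by (rule agrees_fract) (use assms(3) in simp)
  show "generic_point (\<lambda>y x. poly_at (numer f * denom g) y x / poly_at (denom f * numer g) y x = F y x / G y x)"
    using generic_point_conj[OF agrees_repr[OF assms(1)] agrees_repr[OF assms(2)]]
    by (rule generic_point_mono) (simp add: poly_at_mult)
qed

lemma phi_in_coords_formula:
  fixes q :: complex and p :: params and \<eta> X Y :: ratfun
  defines "x5 \<equiv> c1 p * c2 p / theta1 p" and "x6 \<equiv> c1 p * c2 p / theta2 p" and "x7 \<equiv> 1 / kappa1 p" and "x8 \<equiv> q / kappa2 p"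
  assumes p: "p \<in> param_space" and q: "q \<noteq> 0" and ne: "kappa1 p \<noteq> kappa2 p" "theta1 p \<noteq> theta2 p"
    and eta: "\<eta> = y_fun * ((xi_fun - const_fun x8) / (xi_fun - const_fun x5))"
    and X: "X = const_fun (x6 * x8) / (xi_fun *
        ((const_fun (c3 p * c4 p) / \<eta> - const_fun (c4 p)) / (const_fun (c3 p * c4 p) / \<eta> - const_fun (c3 p * c4 p * x5 / (c1 p * x8)))) *
        ((const_fun (c3 p * c4 p) / \<eta> - const_fun (c3 p)) / (const_fun (c3 p * c4 p) / \<eta> - const_fun (c3 p * c4 p * x5 / (c2 p * x8)))))"
    and Y: "Y = const_fun (c3 p * c4 p) / \<eta> * ((X - const_fun x6) / (X - const_fun (x7 / q)))"
    and \<sigma>: "chom \<sigma>" "\<sigma> y_fun = Y" "\<sigma> xi_fun = X"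
  shows "phi_in_coords q p Y X"
proof -
  \<comment> \<open>\<open>X\<close> and \<open>Y\<close> are images of \<open>\<xi>\<close> and
    \<open>y\<close> under an injective homomorphism, so they are nonzero and \<open>Y\<close> is
    not constant. As division by zero gives zero, all denominators in the formulas are nonzero as
    well.\<close>
  have X0: "X \<noteq> 0" and Y0: "Y \<noteq> 0" using chom_eq_0_iff[OF \<sigma>(1)] \<sigma>(2,3) y_fun_neq_0 xi_fun_neq_0 by metis+
  have Yc: "Y - const_fun c \<noteq> 0" for c
  proof -
    have "\<sigma> (y_fun - const_fun c) = Y - const_fun c" by (simp add: \<sigma> chom_diff chom_const)
    then show ?thesis using chom_eq_0_iff[OF \<sigma>(1)] y_minus_neq_0 by metis
  qed
  have eta0: "\<eta> \<noteq> 0" using Y0 unfolding Y by auto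
  have x50: "xi_fun - const_fun x5 \<noteq> 0" by (rule xi_minus_neq_0)
  have den: "const_fun (c3 p * c4 p) / \<eta> - const_fun (c3 p * c4 p * x5 / (c1 p * x8)) \<noteq> 0"
    "const_fun (c3 p * c4 p) / \<eta> - const_fun (c3 p * c4 p * x5 / (c2 p * x8)) \<noteq> 0"
    "xi_fun * ((const_fun (c3 p * c4 p) / \<eta> - const_fun (c4 p)) / (const_fun (c3 p * c4 p) / \<eta> - const_fun (c3 p * c4 p * x5 / (c1 p * x8)))) *
        ((const_fun (c3 p * c4 p) / \<eta> - const_fun (c3 p)) / (const_fun (c3 p * c4 p) / \<eta> - const_fun (c3 p * c4 p * x5 / (c2 p * x8)))) \<noteq> 0"
    using X0 unfolding X by (metis divide_eq_0_iff mult_eq_0_iff)+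
  have Xd: "X - const_fun (x7 / q) \<noteq> 0" using Y0 unfolding Y by (metis divide_eq_0_iff mult_eq_0_iff)
  note R = agrees_const agrees_y agrees_xi agrees_mult agrees_diff
  define E where "E y x = y * ((x - x8) / (x - x5))" for y x :: complex
  define XX where "XX y x = x6 * x8 / (x * ((c3 p * c4 p / E y x - c4 p) / (c3 p * c4 p / E y x - c3 p * c4 p * x5 / (c1 p * x8))) *
        ((c3 p * c4 p / E y x - c3 p) / (c3 p * c4 p / E y x - c3 p * c4 p * x5 / (c2 p * x8))))" for y x
  define YY where "YY y x = c3 p * c4 p / E y x * ((XX y x - x6) / (XX y x - x7 / q))" for y x
  have aE: "agrees \<eta> E" unfolding eta E_def by (intro R agrees_divide x50)
  have aX: "agrees X XX" unfolding X XX_def by (intro R agrees_divide aE eta0 den)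
  have aY: "agrees Y YY" unfolding Y YY_def by (intro R agrees_divide aE aX eta0 Xd)
  note nz = agrees_nonzero[OF aX X0] agrees_nonzero[OF aY Y0]
    agrees_nonzero[OF agrees_diff[OF aY agrees_const[of "c1 p"]] Yc] agrees_nonzero[OF agrees_diff[OF aY agrees_const[of "c2 p"]] Yc]
    agrees_nonzero[OF agrees_diff[OF aY agrees_const[of "c3 p"]] Yc] agrees_nonzero[OF agrees_diff[OF aY agrees_const[of "c4 p"]] Yc]
    agrees_nonzero[OF agrees_y y_fun_neq_0] agrees_nonzero[OF agrees_xi xi_fun_neq_0]
    agrees_nonzero[OF agrees_diff[OF agrees_y agrees_const[of "c1 p"]] y_minus_neq_0]
    agrees_nonzero[OF agrees_diff[OF agrees_y agrees_const[of "c2 p"]] y_minus_neq_0]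
  note gen = generic_point_conj[OF aX[unfolded agrees_def] generic_point_conj[OF aY[unfolded agrees_def]
    generic_point_conj[OF nz(1) generic_point_conj[OF nz(2) generic_point_conj[OF nz(3) generic_point_conj[OF nz(4)
    generic_point_conj[OF nz(5) generic_point_conj[OF nz(6) generic_point_conj[OF nz(7) generic_point_conj[OF nz(8)
    generic_point_conj[OF nz(9) nz(10)]]]]]]]]]]]
  have "generic_point (\<lambda>y x. poly_at (denom Y) y x \<noteq> 0 \<and> poly_at (denom X) y x \<noteq> 0 \<and>
     (\<exists>a b. has_coords p a y x \<and> phi_rel q p a b) \<and>
     (\<forall>a b. has_coords p a y x \<and> phi_rel q p a b \<longrightarrow>
        has_coords (shift_params q p) b (ratfun_at Y y x) (ratfun_at X y x)))"
  proof (rule generic_point_mono[OF gen])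
    fix y x
    assume H: "(poly_at (denom X) y x \<noteq> 0 \<and> ratfun_at X y x = XX y x) \<and>
      (poly_at (denom Y) y x \<noteq> 0 \<and> ratfun_at Y y x = YY y x) \<and> XX y x \<noteq> 0 \<and> YY y x \<noteq> 0 \<and>
      YY y x - c1 p \<noteq> 0 \<and> YY y x - c2 p \<noteq> 0 \<and> YY y x - c3 p \<noteq> 0 \<and> YY y x - c4 p \<noteq> 0 \<and>
      y \<noteq> 0 \<and> x \<noteq> 0 \<and> y - c1 p \<noteq> 0 \<and> y - c2 p \<noteq> 0"
    have "(\<exists>cl cl'. has_coords p cl y x \<and> phi_rel q p cl cl') \<and>
      (\<forall>cl cl'. has_coords p cl y x \<and> phi_rel q p cl cl' \<longrightarrow> has_coords (shift_params q p) cl' (YY y x) (XX y x))"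
      by (rule phi_at_point[OF p q ne _ _ _ _ E_def[unfolded x5_def x8_def]
        XX_def[unfolded x5_def x6_def x8_def]
        YY_def[unfolded x6_def x7_def]])
        (use H in simp_all)
    then show "poly_at (denom Y) y x \<noteq> 0 \<and> poly_at (denom X) y x \<noteq> 0 \<and>
     (\<exists>a b. has_coords p a y x \<and> phi_rel q p a b) \<and>
     (\<forall>a b. has_coords p a y x \<and> phi_rel q p a b \<longrightarrow>
        has_coords (shift_params q p) b (ratfun_at Y y x) (ratfun_at X y x))"
      using H by simp
  qed
  then show ?thesis unfolding phi_in_coords_def generic_point_def .
qed

subsection \<open>Genericity of the parameters\<close>

text \<open>The first two factors separate the eigenvalues; all factors from the second on are the
  distinctness conditions on the centres in \<open>phi_realizes\<close>, cleared of
  denominators.\<close>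

definition discriminant :: "complex \<Rightarrow> params \<Rightarrow> complex" where
  "discriminant q p = (kappa1 p - kappa2 p) * (theta1 p - theta2 p) * (c1 p - c2 p) * (c3 p - c4 p) *
     (q * theta1 p - kappa2 p * c1 p * c2 p) * (q * theta2 p - kappa2 p * c1 p * c2 p) *
     (theta1 p - kappa1 p * c1 p * c2 p) * (q * kappa1 p - kappa2 p) * (q * kappa1 p * c1 p * c2 p - theta2 p) *
     (q * q * kappa1 p - kappa2 p) * (theta2 p - q * theta1 p) *
     (kappa2 p * c2 p * c3 p - q * theta1 p) * (kappa2 p * c2 p * c4 p - q * theta1 p) *
     (kappa2 p * c1 p * c3 p - q * theta1 p) * (kappa2 p * c1 p * c4 p - q * theta1 p)"

lemma param_polynomials_diff:
  assumes "f \<in> param_polynomials" "g \<in> param_polynomials" shows "(\<lambda>p. f p - g p) \<in> param_polynomials"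
  using param_polynomials.add[OF assms(1) param_polynomials.mult[OF param_polynomials.const[of "-1"] assms(2)]] by simp

lemma discriminant_polynomial: "discriminant q \<in> param_polynomials"
  unfolding discriminant_def[abs_def]
  by (intro param_polynomials.mult param_polynomials_diff param_polynomials.const) (rule param_polynomials.coordinate; simp)+

lemma discriminant_nonzero:
  assumes "q \<noteq> 0" shows "\<exists>p\<in>param_space. discriminant q p \<noteq> 0"
proof -
  define Q where "Q = norm q"
  have Q: "0 < Q" using assms by (simp add: Q_def)
  \<comment> \<open>\<open>R\<close> is larger than 1, the norm of \<open>q\<close>, its square and
    its inverse, so that powers of \<open>R\<close> cannot meet them.\<close>
  define R where "R = 2 + Q\<^sup>2 + 1 / Q"
  have R: "1 < R" "Q\<^sup>2 < R" "1 / Q < R" using Q by (simp_all add: R_def add_pos_pos)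
  have "2 * Q \<le> 1 + Q\<^sup>2" using sum_squares_bound[of 1 Q] by simp
  then have QR: "Q < R" using Q by (simp add: R_def) (smt (verit) divide_pos_pos zero_le_power2)
  define r where "r = complex_of_real R"
  have nr: "norm (r ^ k) = R ^ k" for k using R by (simp add: r_def norm_power)
  have Rk: "R \<le> R ^ k" if "0 < k" for k using R that by (simp add: self_le_power)
  have r1: "r ^ k \<noteq> 1" if "0 < k" for k
    using nr[of k] Rk[OF that] R by auto
  have rq: "r ^ k \<noteq> q" if "0 < k" for k
    using nr[of k] Rk[OF that] QR by (auto simp: Q_def)
  have "q * q \<noteq> r"
  proof
    assume "q * q = r"
    then have "Q\<^sup>2 = R" using nr[of 1] by (simp add: Q_def power2_eq_square flip: norm_mult)
    then show False using R by simp
  qed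
  moreover have "q * r ^ 3 \<noteq> 1"
  proof
    assume "q * r ^ 3 = 1"
    then have "Q * R ^ 3 = 1" using nr[of 3] by (metis Q_def norm_mult norm_one)
    then have "R ^ 3 = 1 / Q" using Q by (simp add: field_simps)
    then show False using R Rk[of 3] by simp
  qed
  ultimately have c: "q * q \<noteq> r" "q * r ^ 3 \<noteq> 1" by auto
  have r0: "r \<noteq> 0" using R by (simp add: r_def)
  \<comment> \<open>Powers of \<open>r\<close> with exponents satisfying
    \<open>1 + 2 + 3 = 6\<close>, which is the relation between the parameters. Each factor of the
    discriminant then compares two powers of \<open>r\<close>, or a power of \<open>r\<close> with
    \<open>q\<close>, its square or its inverse.\<close>
  define p where "p = \<lparr>kappa1 = 1, kappa2 = r, theta1 = 1, theta2 = r ^ 6, c1 = 1, c2 = r ^ 2, c3 = 1, c4 = r ^ 3\<rparr>"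
  have "p \<in> param_space" using r0 by (simp add: p_def param_space_def power_numeral_reduce)
  moreover have "discriminant q p \<noteq> 0"
  proof -
    have "q * r ^ 6 - r * 1 * r ^ 2 = r ^ 3 * (q * r ^ 3 - 1)" "q * 1 * 1 * r ^ 2 - r ^ 6 = r ^ 2 * (q - r ^ 4)"
      "r * 1 * r ^ 2 = r ^ 3" "r * r ^ 2 * 1 = r ^ 3" "r * r ^ 2 * r ^ 3 = r ^ 6" "r * 1 * r ^ 3 = r ^ 4"
      by (simp_all add: power_numeral_reduce algebra_simps)
    then show ?thesis
      using r0 c r1[of 1] r1[of 2] r1[of 3] r1[of 6] rq[of 1] rq[of 3] rq[of 4] rq[of 6]
      unfolding discriminant_def p_def by auto
  qed
  ultimately show ?thesis by blast
qed


subsection \<open>The induced action on the Picard group\<close>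

lemma lattice_divisor_root_vec:
  "lattice_divisor cs (root_vec x) = combination cs (x $ 2) (x $ 3)
     (\<lambda>k. [x $ 1 - x $ 2, - x $ 1, x $ 0 - x $ 2, - x $ 0, x $ 5 - x $ 3, - x $ 5, x $ 4 - x $ 3, - x $ 4] ! (k - 1))"
  by (simp add: lattice_divisor_def root_vec_nth exc_coefficients_def[abs_def])

text \<open>Multiplying out the three pairs of twists and rotations on the coefficients of a root
  vector gives the translation directly, with no reflections involved.\<close>

lemma phi_action:
  assumes \<pi>: "\<forall>k\<in>{1..8}. \<pi> k = [2, 1, 4, 3, 7, 8, 5, 6] ! (k - 1)"
    and w: "w = (x $ 2, x $ 3, \<lambda>k. [x $ 1 - x $ 2, - x $ 1, x $ 0 - x $ 2, - x $ 0, x $ 5 - x $ 3, - x $ 5, x $ 4 - x $ 3, - x $ 4] ! (k - 1))"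
  shows "combination_of cs ((\<lambda>(a, b, c). (a, b, \<lambda>k. c (\<pi> k)))
      (twist_action 5 8 (swap_action (twist_action 2 4 (twist_action 1 3 (swap_action (twist_action 5 8 w)))))))
    = lattice_divisor cs (root_vec (x + (x $ 5 - x $ 4) *s null_root))"
proof -
  have \<pi>v: "\<pi> (Suc 0) = 2" "\<pi> 2 = Suc 0" "\<pi> 3 = 4" "\<pi> 4 = 3" "\<pi> 5 = 7" "\<pi> 6 = 8" "\<pi> 7 = 5" "\<pi> 8 = 6"
    by (simp_all add: \<pi>)
  have eq: "combination cs a b c = combination cs a' b' c'"
    if "a = a'" "b = b'" "\<And>k. k \<in> {1..8} \<Longrightarrow> c k = c' k" for a b c a' b' c'
    using that combination_cong by blast
  show ?thesis
    unfolding w lattice_divisor_root_vec twist_action.simps swap_action.simps prod.case combination_of.simps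
  proof (rule eq, goal_cases)
    case (3 k)
    then show ?case unfolding in_1_8 by (elim disjE) (simp_all add: null_root_def \<pi>v)
  qed (simp_all add: null_root_def)
qed

theorem proposition5p1:
  fixes q :: complex
  assumes "q \<noteq> 0"
  shows "generically (\<lambda>p.
      bij_betw (lattice_class q p) UNIV (carrier (Pic q p)) \<and>
      bij_betw (lattice_class q (shift_params q p)) UNIV (carrier (Pic q (shift_params q p))) \<and>
      (\<exists>Y X \<Phi> T. phi_in_coords q p Y X \<and>
         \<Phi> \<in> iso (Pic q p) (Pic q (shift_params q p)) \<and>
         acts_by_images q p (shift_params q p) Y X \<Phi> \<and>
         (\<forall>x. \<Phi> (lattice_class q p (root_vec x)) =
               lattice_class q (shift_params q p) (root_vec (T x))) \<and>
         translation T \<and>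
         T = sigma \<circ> word_map [4, 3, 2, 0, 1, 2, 3, 4])) \<and>
    reduced_word [4, 3, 2, 0, 1, 2, 3, 4]"
proof
  show "reduced_word [4, 3, 2, 0, 1, 2, 3, 4]"
    using reduced_phi_word by (simp add: phi_word_def)
  show "generically (\<lambda>p.
      bij_betw (lattice_class q p) UNIV (carrier (Pic q p)) \<and>
      bij_betw (lattice_class q (shift_params q p)) UNIV (carrier (Pic q (shift_params q p))) \<and>
      (\<exists>Y X \<Phi> T. phi_in_coords q p Y X \<and>
         \<Phi> \<in> iso (Pic q p) (Pic q (shift_params q p)) \<and>
         acts_by_images q p (shift_params q p) Y X \<Phi> \<and>
         (\<forall>x. \<Phi> (lattice_class q p (root_vec x)) =
               lattice_class q (shift_params q p) (root_vec (T x))) \<and>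
         translation T \<and>
         T = sigma \<circ> word_map [4, 3, 2, 0, 1, 2, 3, 4]))"
    unfolding generically_def
  proof (intro bexI[of _ "discriminant q"] conjI ballI impI bij_lattice_class)
    show "\<exists>p\<in>param_space. discriminant q p \<noteq> 0" by (rule discriminant_nonzero[OF assms])
    show "discriminant q \<in> param_polynomials" by (rule discriminant_polynomial)
    fix p assume p: "p \<in> param_space" and disc: "discriminant q p \<noteq> 0"
    let ?p' = "shift_params q p"
    have pz: "kappa1 p \<noteq> 0" "kappa2 p \<noteq> 0" "theta1 p \<noteq> 0" "theta2 p \<noteq> 0" "c1 p \<noteq> 0" "c2 p \<noteq> 0" "c3 p \<noteq> 0" "c4 p \<noteq> 0"
      and rel: "kappa1 p * kappa2 p * c1 p * c2 p * c3 p * c4 p = theta1 p * theta2 p"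
      using p by (auto simp: param_space_def)
    have g: "kappa1 p \<noteq> kappa2 p" "theta1 p \<noteq> theta2 p" "c1 p \<noteq> c2 p" "c3 p \<noteq> c4 p"
      "q * theta1 p \<noteq> kappa2 p * c1 p * c2 p" "q * theta2 p \<noteq> kappa2 p * c1 p * c2 p"
      "theta1 p \<noteq> kappa1 p * c1 p * c2 p" "q * kappa1 p \<noteq> kappa2 p" "q * kappa1 p * c1 p * c2 p \<noteq> theta2 p"
      "q * q * kappa1 p \<noteq> kappa2 p" "theta2 p \<noteq> q * theta1 p"
      "kappa2 p * c2 p * c3 p \<noteq> q * theta1 p" "kappa2 p * c2 p * c4 p \<noteq> q * theta1 p"
      "kappa2 p * c1 p * c3 p \<noteq> q * theta1 p" "kappa2 p * c1 p * c4 p \<noteq> q * theta1 p"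
      using disc by (simp_all add: discriminant_def)
    define x5 where "x5 = c1 p * c2 p / theta1 p"
    define x6 where "x6 = c1 p * c2 p / theta2 p"
    define x7 where "x7 = 1 / kappa1 p"
    define x8 where "x8 = q / kappa2 p"
    note x = x5_def x6_def x7_def x8_def
    define \<eta> where "\<eta> = y_fun * ((xi_fun - const_fun x8) / (xi_fun - const_fun x5))"
    define X where "X = const_fun (x6 * x8) / (xi_fun *
        ((const_fun (c3 p * c4 p) / \<eta> - const_fun (c4 p)) / (const_fun (c3 p * c4 p) / \<eta> - const_fun (c3 p * c4 p * x5 / (c1 p * x8)))) *
        ((const_fun (c3 p * c4 p) / \<eta> - const_fun (c3 p)) / (const_fun (c3 p * c4 p) / \<eta> - const_fun (c3 p * c4 p * x5 / (c2 p * x8)))))"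
    define Y where "Y = const_fun (c3 p * c4 p) / \<eta> * ((X - const_fun x6) / (X - const_fun (x7 / q)))"
    have xz: "x5 \<noteq> 0" "x6 \<noteq> 0" "x7 \<noteq> 0" "x8 \<noteq> 0" using pz assms by (simp_all add: x)
    \<comment> \<open>The relation between the parameters, expressed in the coordinates of the
      blown-up points.\<close>
    have xrel: "q * c3 p * c4 p * x5 * x6 = c1 p * c2 p * x7 * x8"
    proof -
      have "q * c3 p * c4 p * x5 * x6 = q * c1 p * c2 p * (kappa1 p * kappa2 p * c1 p * c2 p * c3 p * c4 p) / (kappa1 p * kappa2 p * (theta1 p * theta2 p))"
        unfolding x using pz by simp
      then show ?thesis unfolding rel x using pz by simp
    qed
    have distinct: "x8 \<noteq> x5" "x6 \<noteq> x5" "x6 \<noteq> x8" "x7 \<noteq> x5" "x7 \<noteq> x8" "q * x6 \<noteq> x7" "q * x8 \<noteq> x7" "x5 \<noteq> q * x6"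
      "c3 p * x5 \<noteq> c1 p * x8" "c4 p * x5 \<noteq> c1 p * x8" "c3 p * x5 \<noteq> c2 p * x8" "c4 p * x5 \<noteq> c2 p * x8"
      using g pz assms unfolding x by (auto simp: divide_simps mult_ac)
    have cs: "center q p k = [(Fin (c1 p), Fin 0), (Fin (c2 p), Fin 0), (Fin (c3 p), Infty), (Fin (c4 p), Infty),
        (Fin 0, Fin x5), (Fin 0, Fin x6), (Infty, Fin x7), (Infty, Fin x8)] ! (k - 1)" for k
      by (simp add: center_def x)
    have cs': "center q ?p' k = [(Fin (c1 p), Fin 0), (Fin (c2 p), Fin 0), (Fin (c3 p), Infty), (Fin (c4 p), Infty),
        (Fin 0, Fin (x5 / q)), (Fin 0, Fin x6), (Infty, Fin (x7 / q)), (Infty, Fin x8)] ! (k - 1)" for k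
      by (simp add: center_def x mult.commute)
    obtain \<sigma> \<pi> where real: "realizes (center q p) (center q ?p') \<sigma> (\<lambda>w. (\<lambda>(a, b, c). (a, b, \<lambda>k. c (\<pi> k)))
        (twist_action 5 8 (swap_action (twist_action 2 4 (twist_action 1 3 (swap_action (twist_action 5 8 w)))))))"
      and \<pi>: "\<forall>k\<in>{1..8}. \<pi> k = [2, 1, 4, 3, 7, 8, 5, 6] ! (k - 1)"
      and \<sigma>: "\<sigma> y_fun = Y" "\<sigma> xi_fun = X"
      by (rule phi_realizes[OF pz(5-8) xz assms xrel g(3,4) distinct cs cs' \<eta>_def X_def Y_def]) blast
    obtain \<beta> where iso: "divisor_iso (center q p) (center q ?p') \<sigma> \<beta>"
      and act: "\<And>w. lin_eq (center q ?p') (push \<beta> (combination_of (center q p) w)) (combination_of (center q ?p')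
        ((\<lambda>(a, b, c). (a, b, \<lambda>k. c (\<pi> k)))
        (twist_action 5 8 (swap_action (twist_action 2 4 (twist_action 1 3 (swap_action (twist_action 5 8 w))))))))"
      using real unfolding realizes_def by blast
    have "chom \<sigma>" using iso by (simp add: divisor_iso_def)
    then have "phi_in_coords q p Y X"
      by (rule phi_in_coords_formula[OF p assms g(1,2) \<eta>_def[unfolded x] X_def[unfolded x] Y_def[unfolded x] _ \<sigma>])
    moreover have "(\<lambda>C. push \<beta> ` C) \<in> iso (Pic q p) (Pic q ?p')" by (rule push_iso[OF iso])
    moreover have "acts_by_images q p ?p' Y X (\<lambda>C. push \<beta> ` C)" by (rule push_acts_by_images[OF iso \<sigma>])
    moreover have "push \<beta> ` lattice_class q p (root_vec x) = lattice_class q ?p' (root_vec ((sigma \<circ> word_map phi_word) x))" for x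
    proof -
      let ?w = "(x $ 2, x $ 3, \<lambda>k. [x $ 1 - x $ 2, - x $ 1, x $ 0 - x $ 2, - x $ 0, x $ 5 - x $ 3, - x $ 5, x $ 4 - x $ 3, - x $ 4] ! (k - 1))"
      have "lin_eq (center q ?p') (push \<beta> (lattice_divisor (center q p) (root_vec x)))
          (lattice_divisor (center q ?p') (root_vec (x + (x $ 5 - x $ 4) *s null_root)))"
        using act[of ?w] unfolding phi_action[OF \<pi> refl, where x = x]
        unfolding combination_of.simps lattice_divisor_root_vec[symmetric] .
      then show ?thesis
        by (simp only: lattice_class_eq push_coset[OF iso] divisor_coset_eq_iff phi_word_action)
    qed
    ultimately show "\<exists>Y X \<Phi> T. phi_in_coords q p Y X \<and>
         \<Phi> \<in> iso (Pic q p) (Pic q ?p') \<and>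
         acts_by_images q p ?p' Y X \<Phi> \<and>
         (\<forall>x. \<Phi> (lattice_class q p (root_vec x)) = lattice_class q ?p' (root_vec (T x))) \<and>
         translation T \<and> T = sigma \<circ> word_map [4, 3, 2, 0, 1, 2, 3, 4]"
      using translation_phi unfolding phi_word_def by blast
  qed
qed

end
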